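(* Let $\mathcal T$ be a physical theory, and let $P_2:\widetilde{\mathcal F}_{\mathcal T}\to\widetilde{\mathcal H}_{\mathcal T}$, $(\bar\Gamma,\bar\gamma)\mapsto\bar\gamma$, be the projection on the second component. Then $$P_2\circ(\rightarrow)=(\triangleright)\circ(I\otimes P_2)\quad\text{as maps } \widetilde V_{\mathcal T}\otimes\widetilde{\mathcal F}_{\mathcal T}\to\widetilde{\mathcal H}_{\mathcal T},$$ that is, $P_2\big(\bar\Gamma_1\rightarrow(\bar\Gamma_2,\bar\gamma_2)\big)=\bar\Gamma_1\triangleright\bar\gamma_2$ for all $\bar\Gamma_1\in\widetilde V_{\mathcal T}$ and $(\bar\Gamma_2,\bar\gamma_2)\in\widetilde{\mathcal F}_{\mathcal T}$. In other words, $P_2$ is a morphism of pre-Lie modules.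
   Context: **Feynman graphs.** A graph $\Gamma$ is given by a finite set $\mathcal V(\Gamma)$ of vertices, a finite set $\mathcal E(\Gamma)$ of half-edges, a map $\partial:\mathcal E(\Gamma)\to\mathcal V(\Gamma)$ and an involution $\sigma_\Gamma:\mathcal E(\Gamma)\to\mathcal E(\Gamma)$. Half-edges are partitioned into types and $\sigma_\Gamma$ respects types. Fixed points of $\sigma_\Gamma$ are the external edges; pairs $\{e,\sigma_\Gamma(e)\}$ with $e\ne\sigma_\Gamma(e)$ are the internal edges; $st(v)=\partial^{-1}(v)$. Graphs are considered up to isomorphism. $\pi_0(\Gamma)$ is the set of connected components. A $1PI$ graph is a connected graph which remains connected when any one internal edge is cut (replaced by two external edges); a graph is locally $1PI$ if all its connected components are $1PI$. The residue $\mathrm{res}\,\Gamma$ is obtained by shrinking each connected component to a point (retaining its external edges). A covering subgraph $\gamma$ of $\Gamma$ is a graph obtained from $\Gamma$ by cutting some internal edges (same vertices and half-edges). $\Gamma/\gamma$ is obtained by shrinking each connected component of $\gamma$ inside $\Gamma$ to a point. **Theory.** A theory $\mathcal T$ prescribes a set $\mathcal E(\mathcal T)$ of half-edge types and a set $\mathcal V(\mathcal T)$ of vertex types. The types of the half-edges in $st(v)$ need not determine the type of $v$; vertex types sharing the same collection of half-edge types are distinguished by an integer index. **Specified graphs.** A specified graph of $\mathcal T$ is a couple $\bar\Gamma=(\Gamma,\underline i)$ where $\Gamma$ is a locally $1PI$ superficially divergent graph (the residue of each component is a vertex of $\mathcal T$) with half-edges and vertices of the types prescribed by $\mathcal T$,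 and $\underline i:\pi_0(\Gamma)\to\mathbb N$ is such that $\underline i(\gamma)$ is one of the indices allowed by the possible types of the vertex obtained by contracting the component $\gamma$. A specified graph $\bar\gamma=(\gamma,\underline j)$ is a specified covering subgraph of $\bar\Gamma=(\Gamma,\underline i)$, written $\bar\gamma\subset\bar\Gamma$, if $\gamma$ is a covering subgraph of $\Gamma$ and $\underline j(\gamma_0)=\underline i(\gamma_0)$ for every component $\gamma_0$ of $\gamma$ that is also a component of $\Gamma$. The contracted graph $\bar\Gamma/\bar\gamma$ is $\Gamma/\gamma$ with the new vertices given the types specified by $\underline j$, and with specification $\underline i$. $\widetilde V_{\mathcal T}$ is the vector space (over a field $k$) generated by the connected ($1PI$) specified graphs; $\widetilde{\mathcal H}_{\mathcal T}=S(\widetilde V_{\mathcal T})$ is the vector space spanned by all specified graphs (product: disjoint union); $\widetilde{\mathcal F}_{\mathcal T}$ is the vector space spanned by pairs $(\bar\Gamma,\bar\gamma)$ with $\bar\Gamma$ a connected $1PI$ specified graph, $\bar\gamma\subset\bar\Gamma$ and $\bar\Gamma/\bar\gamma\in\widetilde V_{\mathcal T}$. **Insertion.** For a connected specified graph $\bar\Gamma_1$, a specified graph $\bar\Gamma_2=(\Gamma_2,\underline j)$ (not necessarily connected) and $v\in\mathcal V(\Gamma_2)$, $\bar\Gamma_1\triangleright_v\bar\Gamma_2=(\Gamma_1\cup_v\Gamma_2,\underline j)$ if $v=\mathrm{res}\,\bar\Gamma_1$ (the type of $v$ is that of the vertex $\mathrm{res}\,\bar\Gamma_1$), and $0$ otherwise.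 Here $\Gamma_1\cup_v\Gamma_2$ is the sum of all possible graphs obtained by replacing $v$ by $\Gamma_1$ in $\Gamma_2$, i.e. the sum over all type-preserving bijections between the external edges of $\Gamma_1$ and $st(v)$; specifications of components are kept. One sets $\bar\Gamma_1\triangleright\bar\Gamma_2=\sum_{v\in\mathcal V(\Gamma_2)}\bar\Gamma_1\triangleright_v\bar\Gamma_2$. **Convention for pairs.** In a pair $(\bar\Gamma,\bar\gamma)$, and in its image $\bar\gamma$ under $P_2$, the components of $\gamma$ consisting of a single vertex without internal edge are suppressed from the notation: $\mathcal V(\gamma)$ denotes the set of vertices lying in components of $\gamma$ having at least one internal edge, and $\bar\Gamma_1\triangleright\bar\gamma=\sum_{v\in\mathcal V(\gamma)}\bar\Gamma_1\triangleright_v\bar\gamma$. **Action.** $$\bar\Gamma_1\rightarrow(\bar\Gamma_2,\bar\gamma_2)=\sum_{v\in\mathcal V(\gamma_2),\ v=\mathrm{res}\,\bar\Gamma_1}(\bar\Gamma_1\triangleright_v\bar\Gamma_2,\ \bar\Gamma_1\triangleright_v\bar\gamma_2),$$ where the insertion is performed simultaneously (with the same bijection) in $\bar\Gamma_2$ and in its subgraph $\bar\gamma_2$, summing over the bijections. All maps are extended (bi)linearly. **Pre-Lie modules.** For a left pre-Lie algebra $(\mathcal A,\circ)$, a left $\mathcal A$-module is a vector space $\mathcal M$ with a bilinear map $\succ:\mathcal A\otimes\mathcal M\to\mathcal M$ such that $a\succ(b\succ m)-(a\circ b)\succ m=b\succ(a\succ m)-(b\circ a)\succ m$; morphisms are linear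 maps commuting with $\succ$. Here $\mathcal A=(\widetilde V_{\mathcal T},\triangleright)$. *)

theory Defs
  imports Complex_Main "HOL-Library.Multiset" "HOL-Library.FuncSet" "HOL-Library.Poly_Mapping"
begin

section \<open>Theories and graphs\<close>

text \<open>A vertex type is the multiset of the types of the half-edges at the vertex together with an
  index, which distinguishes vertex types having the same half-edge types.\<close>

record 'e field_theory =
  half_edge_types :: "'e set"
  vertex_types :: "('e multiset \<times> nat) set"

definition physical_theory :: "'e field_theory \<Rightarrow> bool" where
  "physical_theory T \<longleftrightarrow> (\<forall>(M, n) \<in> vertex_types T. set_mset M \<subseteq> half_edge_types T)"

text \<open>The values of \<open>bd\<close>, \<open>sigma\<close>, \<open>htype\<close> outside \<open>hedges\<close>, of \<open>vindex\<close> outside \<open>verts\<close>, and of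
  specifications outside the set of components are irrelevant: all notions below only look at the
  values on these sets, and isomorphisms identify graphs that differ elsewhere.\<close>

record ('v, 'h, 'e) fgraph =
  verts :: "'v set"
  hedges :: "'h set"
  bd :: "'h \<Rightarrow> 'v"
  sigma :: "'h \<Rightarrow> 'h"
  htype :: "'h \<Rightarrow> 'e"
  vindex :: "'v \<Rightarrow> nat"

definition wf_graph :: "('v, 'h, 'e) fgraph \<Rightarrow> bool" where
  "wf_graph G \<longleftrightarrow> finite (verts G) \<and> finite (hedges G) \<and>
     (\<forall>h \<in> hedges G. bd G h \<in> verts G \<and> sigma G h \<in> hedges G \<and>
        sigma G (sigma G h) = h \<and> htype G (sigma G h) = htype G h)"

definition externals :: "('v, 'h, 'e) fgraph \<Rightarrow> 'h set" where
  "externals G = {h \<in> hedges G. sigma G h = h}"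

definition internals :: "('v, 'h, 'e) fgraph \<Rightarrow> 'h set" where
  "internals G = {h \<in> hedges G. sigma G h \<noteq> h}"

definition star :: "('v, 'h, 'e) fgraph \<Rightarrow> 'v \<Rightarrow> 'h set" where
  "star G v = {h \<in> hedges G. bd G h = v}"

definition vertex_type :: "('v, 'h, 'e) fgraph \<Rightarrow> 'v \<Rightarrow> 'e multiset \<times> nat" where
  "vertex_type G v = (image_mset (htype G) (mset_set (star G v)), vindex G v)"

definition links :: "('v, 'h, 'e) fgraph \<Rightarrow> ('v \<times> 'v) set" where
  "links G = {(bd G h, bd G (sigma G h)) | h. h \<in> hedges G}"

text \<open>A connected component is represented by its set of vertices.\<close>

definition component_of :: "('v, 'h, 'e) fgraph \<Rightarrow> 'v \<Rightarrow> 'v set" where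
  "component_of G v = {w \<in> verts G. (v, w) \<in> (links G)\<^sup>*}"

definition components :: "('v, 'h, 'e) fgraph \<Rightarrow> 'v set set" where
  "components G = component_of G ` verts G"

definition component_graph :: "('v, 'h, 'e) fgraph \<Rightarrow> 'v set \<Rightarrow> ('v, 'h, 'e) fgraph" where
  "component_graph G C = G\<lparr>verts := C, hedges := {h \<in> hedges G. bd G h \<in> C}\<rparr>"

definition connected_graph :: "('v, 'h, 'e) fgraph \<Rightarrow> bool" where
  "connected_graph G \<longleftrightarrow> is_singleton (components G)"

definition cut :: "('v, 'h, 'e) fgraph \<Rightarrow> 'h \<Rightarrow> ('v, 'h, 'e) fgraph" where
  "cut G h = G\<lparr>sigma := (sigma G)(h := h, sigma G h := sigma G h)\<rparr>"

definition one_PI :: "('v, 'h, 'e) fgraph \<Rightarrow> bool" where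
  "one_PI G \<longleftrightarrow> connected_graph G \<and> (\<forall>h \<in> internals G. connected_graph (cut G h))"

definition locally_one_PI :: "('v, 'h, 'e) fgraph \<Rightarrow> bool" where
  "locally_one_PI G \<longleftrightarrow> (\<forall>C \<in> components G. one_PI (component_graph G C))"

definition covering_subgraph :: "('v, 'h, 'e) fgraph \<Rightarrow> ('v, 'h, 'e) fgraph \<Rightarrow> bool" where
  "covering_subgraph g G \<longleftrightarrow> wf_graph g \<and> wf_graph G \<and>
     verts g = verts G \<and> hedges g = hedges G \<and> (\<forall>v \<in> verts G. vindex g v = vindex G v) \<and>
     (\<forall>h \<in> hedges G. bd g h = bd G h \<and> htype g h = htype G h \<and> sigma g h \<in> {h, sigma G h})"


section \<open>Specified graphs\<close>

type_synonym ('v, 'h, 'e) sgraph = "('v, 'h, 'e) fgraph \<times> ('v set \<Rightarrow> nat)"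

text \<open>Contraction of the components of \<open>g\<close> inside \<open>G\<close>: the vertices are the components of \<open>g\<close>, the
  half-edges are those that are not part of an internal edge of \<open>g\<close>. A component of the result is a
  set of components of \<open>g\<close> whose union is a component of \<open>G\<close>.\<close>

fun contract :: "('v, 'h, 'e) sgraph \<Rightarrow> ('v, 'h, 'e) sgraph \<Rightarrow> ('v set, 'h, 'e) sgraph" where
  "contract (G, i) (g, j) =
     (\<lparr>verts = components g, hedges = externals g, bd = (\<lambda>h. component_of g (bd g h)),
       sigma = sigma G, htype = htype G, vindex = j\<rparr>, \<lambda>D. i (\<Union>D))"

definition residue :: "('v, 'h, 'e) sgraph \<Rightarrow> ('v set, 'h, 'e) sgraph" where
  "residue X = contract X X"

text \<open>The last clause says that the residue of each component, taken with the index prescribed by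
  the specification, is a vertex of the theory; in particular the graph is superficially
  divergent.\<close>

definition specified_graph :: "'e field_theory \<Rightarrow> ('v, 'h, 'e) sgraph \<Rightarrow> bool" where
  "specified_graph T X \<longleftrightarrow> wf_graph (fst X) \<and> locally_one_PI (fst X) \<and>
     htype (fst X) ` hedges (fst X) \<subseteq> half_edge_types T \<and>
     vertex_type (fst X) ` verts (fst X) \<subseteq> vertex_types T \<and>
     (\<forall>C \<in> components (fst X). vertex_type (fst (residue X)) C \<in> vertex_types T)"

definition connected_specified_graph :: "'e field_theory \<Rightarrow> ('v, 'h, 'e) sgraph \<Rightarrow> bool" where
  "connected_specified_graph T X \<longleftrightarrow> specified_graph T X \<and> connected_graph (fst X)"

text \<open>For connected \<open>X\<close>: its only component is the set of all its vertices.\<close>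

definition residue_type :: "('v, 'h, 'e) sgraph \<Rightarrow> 'e multiset \<times> nat" where
  "residue_type X = vertex_type (fst (residue X)) (verts (fst X))"

text \<open>A component of \<open>g\<close> may have the same vertices as a component of \<open>G\<close> and still be a different
  graph, because edges inside it are cut; hence the premise on \<open>sigma\<close>.\<close>

fun specified_covering_subgraph ::
  "'e field_theory \<Rightarrow> ('v, 'h, 'e) sgraph \<Rightarrow> ('v, 'h, 'e) sgraph \<Rightarrow> bool" where
  "specified_covering_subgraph T (g, j) (G, i) \<longleftrightarrow>
     specified_graph T (g, j) \<and> specified_graph T (G, i) \<and> covering_subgraph g G \<and>
     (\<forall>C \<in> components g \<inter> components G.
        (\<forall>h \<in> hedges G. bd G h \<in> C \<longrightarrow> sigma g h = sigma G h) \<longrightarrow> j C = i C)"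

definition specified_pair ::
  "'e field_theory \<Rightarrow> ('v, 'h, 'e) sgraph \<times> ('v, 'h, 'e) sgraph \<Rightarrow> bool" where
  "specified_pair T p \<longleftrightarrow> connected_specified_graph T (fst p) \<and>
     specified_covering_subgraph T (snd p) (fst p) \<and>
     connected_specified_graph T (contract (fst p) (snd p))"

fun sgraph_iso ::
  "('v \<Rightarrow> 'w) \<Rightarrow> ('h \<Rightarrow> 'l) \<Rightarrow> ('v, 'h, 'e) sgraph \<Rightarrow> ('w, 'l, 'e) sgraph \<Rightarrow> bool" where
  "sgraph_iso f k (G, i) (G', i') \<longleftrightarrow>
     bij_betw f (verts G) (verts G') \<and> bij_betw k (hedges G) (hedges G') \<and>
     (\<forall>h \<in> hedges G. bd G' (k h) = f (bd G h) \<and> sigma G' (k h) = k (sigma G h) \<and>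
        htype G' (k h) = htype G h) \<and>
     (\<forall>v \<in> verts G. vindex G' (f v) = vindex G v) \<and>
     (\<forall>C \<in> components G. i' (f ` C) = i C)"

text \<open>Isomorphism classes consist of graphs on natural numbers; every finite graph has an isomorphic
  copy of this kind. Isomorphisms of pairs act simultaneously on both entries.\<close>

type_synonym 'e graph_class = "(nat, nat, 'e) sgraph set"
type_synonym 'e pair_class = "((nat, nat, 'e) sgraph \<times> (nat, nat, 'e) sgraph) set"

definition graph_class :: "('v, 'h, 'e) sgraph \<Rightarrow> 'e graph_class" where
  "graph_class X = {Y. \<exists>f k. sgraph_iso f k X Y}"

definition pair_class :: "('v, 'h, 'e) sgraph \<times> ('v, 'h, 'e) sgraph \<Rightarrow> 'e pair_class" where
  "pair_class p = {q. \<exists>f k. sgraph_iso f k (fst p) (fst q) \<and> sgraph_iso f k (snd p) (snd q)}"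

definition rep :: "'a set \<Rightarrow> 'a" where
  "rep K = (SOME x. x \<in> K)"


section \<open>Free vector spaces\<close>

definition scal :: "'k::field \<Rightarrow> ('b \<Rightarrow>\<^sub>0 'k) \<Rightarrow> ('b \<Rightarrow>\<^sub>0 'k)" where
  "scal c x = Poly_Mapping.map ((*) c) x"

definition free_space :: "'b set \<Rightarrow> ('b \<Rightarrow>\<^sub>0 'k::field) set" where
  "free_space B = {x. Poly_Mapping.keys x \<subseteq> B}"

definition basis_vec :: "'b \<Rightarrow> ('b \<Rightarrow>\<^sub>0 'k::field)" where
  "basis_vec b = Poly_Mapping.single b 1"

definition linear_ext :: "('a \<Rightarrow> ('c \<Rightarrow>\<^sub>0 'k::field)) \<Rightarrow> ('a \<Rightarrow>\<^sub>0 'k) \<Rightarrow> ('c \<Rightarrow>\<^sub>0 'k)" where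
  "linear_ext B x = (\<Sum>a \<in> Poly_Mapping.keys x. scal (Poly_Mapping.lookup x a) (B a))"

definition bilinear_ext ::
  "('a \<Rightarrow> 'b \<Rightarrow> ('c \<Rightarrow>\<^sub>0 'k::field)) \<Rightarrow> ('a \<Rightarrow>\<^sub>0 'k) \<Rightarrow> ('b \<Rightarrow>\<^sub>0 'k) \<Rightarrow> ('c \<Rightarrow>\<^sub>0 'k)" where
  "bilinear_ext B x y = linear_ext (\<lambda>a. linear_ext (\<lambda>b. B a b) y) x"

definition V_space :: "'e field_theory \<Rightarrow> ('e graph_class \<Rightarrow>\<^sub>0 'k::field) set" where
  "V_space T = free_space {graph_class X | X :: (nat, nat, 'e) sgraph. connected_specified_graph T X}"

definition H_space :: "'e field_theory \<Rightarrow> ('e graph_class \<Rightarrow>\<^sub>0 'k::field) set" where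
  "H_space T = free_space {graph_class X | X :: (nat, nat, 'e) sgraph. specified_graph T X}"

definition F_space :: "'e field_theory \<Rightarrow> ('e pair_class \<Rightarrow>\<^sub>0 'k::field) set" where
  "F_space T = free_space
     {pair_class p | p :: (nat, nat, 'e) sgraph \<times> (nat, nat, 'e) sgraph. specified_pair T p}"


section \<open>Insertion\<close>

text \<open>The type-preserving bijections between the star of \<open>v\<close> in \<open>Y\<close> and the external edges of \<open>X\<close>;
  extensionality makes each of them occur exactly once.\<close>

definition gluings :: "('v, 'h, 'e) sgraph \<Rightarrow> 'w \<Rightarrow> ('w, 'l, 'e) sgraph \<Rightarrow> ('l \<Rightarrow> 'h) set" where
  "gluings X v Y = {b \<in> star (fst Y) v \<rightarrow>\<^sub>E externals (fst X).
     bij_betw b (star (fst Y) v) (externals (fst X)) \<and>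
     (\<forall>h \<in> star (fst Y) v. htype (fst X) (b h) = htype (fst Y) h)}"

text \<open>In the result each external edge of the inserted graph is identified with the half-edge in
  the star of \<open>v\<close> corresponding to it under \<open>b\<close>, so only the internal half-edges of the inserted
  graph are added. The components of the result are the preimages of those of the second graph under
  the map that sends every inserted vertex to \<open>v\<close>; the specification is pulled back along this
  map.\<close>

fun insert_at :: "('v, 'h, 'e) sgraph \<Rightarrow> 'w \<Rightarrow> ('l \<Rightarrow> 'h) \<Rightarrow> ('w, 'l, 'e) sgraph \<Rightarrow>
    ('v + 'w, 'h + 'l, 'e) sgraph" where
  "insert_at (G1, i) v b (G2, j) =
     (\<lparr>verts = Inl ` verts G1 \<union> Inr ` (verts G2 - {v}),
       hedges = Inl ` internals G1 \<union> Inr ` hedges G2,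
       bd = case_sum (\<lambda>h. Inl (bd G1 h))
              (\<lambda>h. if bd G2 h = v then Inl (bd G1 (b h)) else Inr (bd G2 h)),
       sigma = map_sum (sigma G1) (sigma G2),
       htype = case_sum (htype G1) (htype G2),
       vindex = case_sum (vindex G1) (vindex G2)\<rparr>,
      \<lambda>C. j (case_sum (\<lambda>_. v) (\<lambda>w. w) ` C))"

definition insert_vertex ::
  "('v, 'h, 'e) sgraph \<Rightarrow> 'w \<Rightarrow> ('w, 'l, 'e) sgraph \<Rightarrow> ('e graph_class \<Rightarrow>\<^sub>0 'k::field)" where
  "insert_vertex X v Y =
     (if vertex_type (fst Y) v = residue_type X
      then \<Sum>b \<in> gluings X v Y. basis_vec (graph_class (insert_at X v b Y)) else 0)"

text \<open>The vertices of a subgraph \<open>g\<close> in a pair, when the components without internal edge are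
  suppressed.\<close>

definition active_verts :: "('v, 'h, 'e) fgraph \<Rightarrow> 'v set" where
  "active_verts g = {v \<in> verts g. \<exists>h \<in> internals g. bd g h \<in> component_of g v}"

text \<open>Insertion in all vertices, and insertion under the convention for subgraphs.\<close>

definition insertion (infixr \<open>\<triangleright>\<close> 70) where
  "insertion = (bilinear_ext (\<lambda>K L. \<Sum>v \<in> verts (fst (rep L)). insert_vertex (rep K) v (rep L)) ::
     ('e graph_class \<Rightarrow>\<^sub>0 'k::field) \<Rightarrow> ('e graph_class \<Rightarrow>\<^sub>0 'k) \<Rightarrow> ('e graph_class \<Rightarrow>\<^sub>0 'k))"

definition sub_insertion (infixr \<open>\<triangleright>\<^sub>s\<close> 70) where
  "sub_insertion =
     (bilinear_ext (\<lambda>K L. \<Sum>v \<in> active_verts (fst (rep L)). insert_vertex (rep K) v (rep L)) ::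
     ('e graph_class \<Rightarrow>\<^sub>0 'k::field) \<Rightarrow> ('e graph_class \<Rightarrow>\<^sub>0 'k) \<Rightarrow> ('e graph_class \<Rightarrow>\<^sub>0 'k))"

definition act_graph :: "('v, 'h, 'e) sgraph \<Rightarrow> ('w, 'l, 'e) sgraph \<times> ('w, 'l, 'e) sgraph \<Rightarrow>
    ('e pair_class \<Rightarrow>\<^sub>0 'k::field)" where
  "act_graph X p =
     (\<Sum>v \<in> {v \<in> active_verts (fst (snd p)). vertex_type (fst (fst p)) v = residue_type X}.
        \<Sum>b \<in> gluings X v (fst p).
          basis_vec (pair_class (insert_at X v b (fst p), insert_at X v b (snd p))))"

definition action (infixr \<open>\<rightarrow>\<^sub>F\<close> 70) where
  "action = (bilinear_ext (\<lambda>K L. act_graph (rep K) (rep L)) ::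
     ('e graph_class \<Rightarrow>\<^sub>0 'k::field) \<Rightarrow> ('e pair_class \<Rightarrow>\<^sub>0 'k) \<Rightarrow> ('e pair_class \<Rightarrow>\<^sub>0 'k))"

definition P2 :: "('e pair_class \<Rightarrow>\<^sub>0 'k::field) \<Rightarrow> ('e graph_class \<Rightarrow>\<^sub>0 'k)" where
  "P2 = linear_ext (\<lambda>L. basis_vec (graph_class (snd (rep L))))"


section \<open>Left pre-Lie algebras and their left modules\<close>

text \<open>Vector spaces are given as subspaces (carriers) of an ambient type.\<close>

definition linear_map ::
  "('k::field \<Rightarrow> 'a::ab_group_add \<Rightarrow> 'a) \<Rightarrow> 'a set \<Rightarrow> ('k \<Rightarrow> 'b::ab_group_add \<Rightarrow> 'b) \<Rightarrow> 'b set \<Rightarrow>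
    ('a \<Rightarrow> 'b) \<Rightarrow> bool" where
  "linear_map s A t B f \<longleftrightarrow> (\<forall>x \<in> A. f x \<in> B) \<and>
     (\<forall>x \<in> A. \<forall>y \<in> A. f (x + y) = f x + f y) \<and> (\<forall>c. \<forall>x \<in> A. f (s c x) = t c (f x))"

locale left_pre_lie_algebra = vector_space scale
  for scale :: "'k::field \<Rightarrow> 'a::ab_group_add \<Rightarrow> 'a" +
  fixes A :: "'a set" and circ :: "'a \<Rightarrow> 'a \<Rightarrow> 'a"
  assumes subspace_A: "subspace A"
    and circ_left: "y \<in> A \<Longrightarrow> linear_map scale A scale A (\<lambda>x. circ x y)"
    and circ_right: "x \<in> A \<Longrightarrow> linear_map scale A scale A (circ x)"
    and pre_lie: "\<lbrakk>a \<in> A; b \<in> A; c \<in> A\<rbrakk> \<Longrightarrow>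
      circ a (circ b c) - circ (circ a b) c = circ b (circ a c) - circ (circ b a) c"

locale left_pre_lie_module = left_pre_lie_algebra scale A circ + M: vector_space scaleM
  for scale :: "'k::field \<Rightarrow> 'a::ab_group_add \<Rightarrow> 'a" and A circ
    and scaleM :: "'k \<Rightarrow> 'm::ab_group_add \<Rightarrow> 'm" +
  fixes M :: "'m set" and act :: "'a \<Rightarrow> 'm \<Rightarrow> 'm"
  assumes subspace_M: "M.subspace M"
    and act_left: "m \<in> M \<Longrightarrow> linear_map scale A scaleM M (\<lambda>x. act x m)"
    and act_right: "x \<in> A \<Longrightarrow> linear_map scaleM M scaleM M (act x)"
    and act_pre_lie: "\<lbrakk>a \<in> A; b \<in> A; m \<in> M\<rbrakk> \<Longrightarrow>
      act a (act b m) - act (circ a b) m = act b (act a m) - act (circ b a) m"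

locale left_pre_lie_module_morphism =
  dom: left_pre_lie_module scale A circ scaleM M actM +
  cod: left_pre_lie_module scale A circ scaleN N actN
  for scale :: "'k::field \<Rightarrow> 'a::ab_group_add \<Rightarrow> 'a" and A circ
    and scaleM :: "'k \<Rightarrow> 'm::ab_group_add \<Rightarrow> 'm" and M actM
    and scaleN :: "'k \<Rightarrow> 'n::ab_group_add \<Rightarrow> 'n" and N actN +
  fixes f :: "'m \<Rightarrow> 'n"
  assumes linear: "linear_map scaleM M scaleN N f"
    and commutes: "\<lbrakk>x \<in> A; m \<in> M\<rbrakk> \<Longrightarrow> f (actM x m) = actN x (f m)"

end

theory Submission
  imports Defs
begin

text \<open>
  The argument rests on one observation: inserting a graph at a vertex of a covering subgraph \<open>g\<close> and
  at the same vertex of the surrounding graph, with the same gluing, is a single operation on the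
  pair. A covering subgraph has the same vertices, the same half-edges at each of them, and hence the
  same vertex types and gluings. Projecting the action to the second entry therefore gives the
  insertion into the subgraph term by term (\<open>P2_graph_action\<close>), once isomorphic representatives are
  known to give equal sums (\<open>insertion_sum_iso\<close>).

  That this is a morphism of modules over a pre-Lie algebra means in addition that the three
  operations are well defined on the respective spaces and satisfy the pre-Lie identity.

  Being well defined amounts to closure under insertion. The vertex map \<open>collapse\<close> shrinks the
  inserted connected graph to the vertex it replaced, and lifting paths along it
  (\<open>reach_insert\<close>) shows that the components of an insertion are the preimages of components.
  Local 1PI-ness is the absence of bridges (\<open>locally_one_PI_iff_bridgeless\<close>), and detours around a
  cut edge lift as well (\<open>bridgeless_insert\<close>). Residues are unchanged, because the external edges
  and the specification are those of the surrounding graph, and so is the contraction of a pair,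
  because the inserted graph lies in the subgraph and is contracted with it (\<open>contract_insert\<close>).

  For the pre-Lie identity, insert \<open>B\<close> at a vertex \<open>v\<close> and then \<open>A\<close> at a vertex of the result. The
  second vertex either belongs to \<open>B\<close>, and then the outcome is the insertion at \<open>v\<close> of a term
  of \<open>A \<triangleright> B\<close> (\<open>insert_assoc_iso\<close>), or it is another vertex of the original graph. So
  the associator is the sum over insertions at two distinct vertices (\<open>nested_insertion_sum\<close>), which
  is symmetric in \<open>A\<close> and \<open>B\<close> because such insertions commute (\<open>insert_swap_iso\<close>). This works verbatim
  when only the active vertices of a subgraph are admitted, because the active vertices after an
  insertion at an active vertex are exactly the inserted ones and the remaining active ones
  (\<open>active_verts_insert\<close>).

  All three operations are instances of one sum over the insertions into a pair, a graph being treated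
  as a pair with itself, so the combinatorics is done once, for pairs.
\<close>

section \<open>Linear maps between free vector spaces\<close>

lemma lookup_scal [simp]: "Poly_Mapping.lookup (scal c x) a = c * Poly_Mapping.lookup x a"
  by (simp add: scal_def Poly_Mapping.map.rep_eq when_def)

interpretation free: vector_space "scal :: 'k::field \<Rightarrow> ('b \<Rightarrow>\<^sub>0 'k) \<Rightarrow> ('b \<Rightarrow>\<^sub>0 'k)"
  by unfold_locales (auto intro!: poly_mapping_eqI simp: lookup_add algebra_simps)

interpretation free_pair: vector_space_pair
  "scal :: 'k::field \<Rightarrow> ('b \<Rightarrow>\<^sub>0 'k) \<Rightarrow> ('b \<Rightarrow>\<^sub>0 'k)"
  "scal :: 'k::field \<Rightarrow> ('c \<Rightarrow>\<^sub>0 'k) \<Rightarrow> ('c \<Rightarrow>\<^sub>0 'k)"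
  by unfold_locales

abbreviation free_linear :: "(('b \<Rightarrow>\<^sub>0 'k::field) \<Rightarrow> ('c \<Rightarrow>\<^sub>0 'k)) \<Rightarrow> bool" where
  "free_linear \<equiv> Vector_Spaces.linear scal scal"

lemma linear_ext_superset:
  assumes "finite S" "Poly_Mapping.keys x \<subseteq> S"
  shows "linear_ext B x = (\<Sum>a\<in>S. scal (Poly_Mapping.lookup x a) (B a))"
  unfolding linear_ext_def using assms
  by (intro sum.mono_neutral_left) (auto simp: in_keys_iff)

lemma linear_ext_add: "linear_ext B (x + y) = linear_ext B x + linear_ext B y"
proof -
  let ?S = "Poly_Mapping.keys x \<union> Poly_Mapping.keys y"
  have "linear_ext B z = (\<Sum>a\<in>?S. scal (Poly_Mapping.lookup z a) (B a))"
    if "Poly_Mapping.keys z \<subseteq> ?S" for z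
    using that by (intro linear_ext_superset) auto
  from this[of x] this[of y] this[of "x + y"] show ?thesis
    using Poly_Mapping.keys_add[of x y]
    by (simp add: lookup_add free.scale_left_distrib sum.distrib)
qed

lemma linear_ext_scal: "linear_ext B (scal c x) = scal c (linear_ext B x)"
proof -
  have "Poly_Mapping.keys (scal c x) \<subseteq> Poly_Mapping.keys x"
    by (auto simp: in_keys_iff)
  then have "linear_ext B (scal c x) =
      (\<Sum>a\<in>Poly_Mapping.keys x. scal (Poly_Mapping.lookup (scal c x) a) (B a))"
    by (intro linear_ext_superset) auto
  then show ?thesis
    by (simp add: linear_ext_def free.scale_sum_right)
qed

lemma linear_linear_ext: "free_linear (linear_ext B)"
  by unfold_locales (simp_all add: linear_ext_add linear_ext_scal)

lemma linear_ext_basis [simp]: "linear_ext B (basis_vec a) = B a"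
  by (simp add: linear_ext_def basis_vec_def)

lemma linear_ext_basis_vec: "linear_ext basis_vec x = x"
proof (rule poly_mapping_eqI)
  fix b
  have "Poly_Mapping.lookup (linear_ext basis_vec x) b =
    (\<Sum>a\<in>Poly_Mapping.keys x. if a = b then Poly_Mapping.lookup x a else 0)"
    unfolding linear_ext_def lookup_sum
    by (intro sum.cong) (auto simp: basis_vec_def lookup_single when_def)
  then show "Poly_Mapping.lookup (linear_ext basis_vec x) b = Poly_Mapping.lookup x b"
    by (simp add: in_keys_iff)
qed

text \<open>This identification makes the library's principle available that linear maps agreeing on a
  spanning set agree on its span, so that identities between multilinear maps need only be checked
  on classes of graphs.\<close>

lemma free_space_eq_span:
  "(free_space B :: ('b \<Rightarrow>\<^sub>0 'k::field) set) = free.span (basis_vec ` B)"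
proof
  show "(free_space B :: ('b \<Rightarrow>\<^sub>0 'k) set) \<subseteq> free.span (basis_vec ` B)"
  proof
    fix x :: "'b \<Rightarrow>\<^sub>0 'k" assume x: "x \<in> free_space B"
    have "linear_ext basis_vec x \<in> free.span (basis_vec ` B)"
      unfolding linear_ext_def using x
      by (intro free.span_sum free.span_scale free.span_base) (auto simp: free_space_def)
    then show "x \<in> free.span (basis_vec ` B)" by (simp add: linear_ext_basis_vec)
  qed
  have "free.subspace (free_space B :: ('b \<Rightarrow>\<^sub>0 'k) set)"
    unfolding free.subspace_def free_space_def
    by (auto simp: in_keys_iff lookup_add subset_iff) (metis add.right_neutral)
  then show "free.span (basis_vec ` B) \<subseteq> (free_space B :: ('b \<Rightarrow>\<^sub>0 'k) set)"
    by (intro free.span_minimal) (auto simp: free_space_def basis_vec_def)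
qed

lemma subspace_free_space: "free.subspace (free_space B)"
  by (simp add: free_space_eq_span)

lemma basis_vec_in_free_space: "b \<in> B \<Longrightarrow> basis_vec b \<in> free_space B"
  by (simp add: free_space_eq_span free.span_base)

lemma linear_ext_in_subspace:
  assumes "free.subspace W" "x \<in> free_space B" "\<And>a. a \<in> B \<Longrightarrow> F a \<in> W"
  shows "linear_ext F x \<in> W"
  using assms unfolding linear_ext_def free_space_def
  by (intro free.subspace_sum free.subspace_scale) auto

lemma linear_eq_on_free_space:
  assumes "free_linear f" "free_linear g" "\<And>b. b \<in> B \<Longrightarrow> f (basis_vec b) = g (basis_vec b)"
    "x \<in> free_space B"
  shows "f x = g x"
  using assms free_pair.linear_eq_on_span[of f g "basis_vec ` B" x]
  by (auto simp: free_space_eq_span)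

lemma bilinear_ext_linear_left: "free_linear (\<lambda>x. bilinear_ext B x y)"
  unfolding bilinear_ext_def by (rule linear_linear_ext)

lemma bilinear_ext_linear_right: "free_linear (bilinear_ext B x)"
  unfolding bilinear_ext_def
  by unfold_locales
    (simp_all only: linear_ext_add linear_ext_scal linear_ext_def[where x = x]
      free.scale_right_distrib sum.distrib free.scale_sum_right free.scale_scale mult.commute)

lemma bilinear_ext_basis [simp]: "bilinear_ext B (basis_vec a) y = linear_ext (B a) y"
  by (simp add: bilinear_ext_def)

lemma bilinear_ext_in_subspace:
  assumes "free.subspace W" "x \<in> free_space A" "y \<in> free_space M"
    "\<And>a m. a \<in> A \<Longrightarrow> m \<in> M \<Longrightarrow> B a m \<in> W"
  shows "bilinear_ext B x y \<in> W"
  unfolding bilinear_ext_def using assms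
  by (intro linear_ext_in_subspace[where B = A] linear_ext_in_subspace[where B = M]) auto

lemma linear_map_free_linear:
  assumes "free_linear f" "\<And>x. x \<in> A \<Longrightarrow> f x \<in> B"
  shows "linear_map scal A scal B f"
  using assms by (auto simp: linear_map_def free_pair.linear_add free_pair.linear_scale)

text \<open>Both sides are trilinear in \<open>x\<close>, \<open>y\<close>, \<open>z\<close>, so the identity extends from basis vectors one
  argument at a time.\<close>

lemma bilinear_ext_pre_lie:
  assumes basis: "\<And>a b m. a \<in> A \<Longrightarrow> b \<in> A \<Longrightarrow> m \<in> M \<Longrightarrow>
      linear_ext (act a) (act b m) - bilinear_ext act (circ a b) (basis_vec m) =
      linear_ext (act b) (act a m) - bilinear_ext act (circ b a) (basis_vec m)"
    and x: "x \<in> free_space A" and y: "y \<in> free_space A" and z: "z \<in> free_space M"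
  shows "bilinear_ext act x (bilinear_ext act y z) - bilinear_ext act (bilinear_ext circ x y) z =
      bilinear_ext act y (bilinear_ext act x z) - bilinear_ext act (bilinear_ext circ y x) z"
proof -
  define J where "J x y z = bilinear_ext act x (bilinear_ext act y z) -
    bilinear_ext act (bilinear_ext circ x y) z" for x y z
  note lin = free_pair.linear_compose_sub bilinear_ext_linear_right bilinear_ext_linear_left
    Vector_Spaces.linear_compose[OF bilinear_ext_linear_left bilinear_ext_linear_left, unfolded comp_def]
    Vector_Spaces.linear_compose[OF bilinear_ext_linear_left bilinear_ext_linear_right, unfolded comp_def]
    Vector_Spaces.linear_compose[OF bilinear_ext_linear_right bilinear_ext_linear_left, unfolded comp_def]
    Vector_Spaces.linear_compose[OF bilinear_ext_linear_right bilinear_ext_linear_right, unfolded comp_def]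
  have l1: "free_linear (\<lambda>x. J x y z)" "free_linear (\<lambda>y. J x y z)" "free_linear (\<lambda>z. J x y z)" for x y z
    unfolding J_def by (intro lin)+
  have "J (basis_vec a) (basis_vec b) (basis_vec m) = J (basis_vec b) (basis_vec a) (basis_vec m)"
    if "a \<in> A" "b \<in> A" "m \<in> M" for a b m
    using basis[OF that] by (simp add: J_def)
  then have "J (basis_vec a) (basis_vec b) z = J (basis_vec b) (basis_vec a) z"
    if "a \<in> A" "b \<in> A" for a b
    by (intro linear_eq_on_free_space[OF l1(3) l1(3) _ z]) (use that in auto)
  then have "J (basis_vec a) y z = J y (basis_vec a) z" if "a \<in> A" for a
    by (intro linear_eq_on_free_space[OF l1(2) l1(1) _ y]) (use that in auto)
  then have "J x y z = J y x z"
    by (intro linear_eq_on_free_space[OF l1(1) l1(2) _ x]) auto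
  then show ?thesis by (simp add: J_def)
qed

lemma left_pre_lie_algebra_bilinear_ext:
  assumes "\<And>a b. a \<in> A \<Longrightarrow> b \<in> A \<Longrightarrow> circ a b \<in> free_space A"
    and "\<And>a b m. a \<in> A \<Longrightarrow> b \<in> A \<Longrightarrow> m \<in> A \<Longrightarrow>
      linear_ext (circ a) (circ b m) - bilinear_ext circ (circ a b) (basis_vec m) =
      linear_ext (circ b) (circ a m) - bilinear_ext circ (circ b a) (basis_vec m)"
  shows "left_pre_lie_algebra scal (free_space A) (bilinear_ext circ)"
  using assms
  by unfold_locales
    (auto intro!: subspace_free_space linear_map_free_linear bilinear_ext_linear_left
      bilinear_ext_linear_right bilinear_ext_in_subspace[OF subspace_free_space]
      bilinear_ext_pre_lie[where A = A and M = A])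

lemma left_pre_lie_module_bilinear_ext:
  assumes "left_pre_lie_algebra scal (free_space A) (bilinear_ext circ)"
    and "\<And>a m. a \<in> A \<Longrightarrow> m \<in> M \<Longrightarrow> act a m \<in> free_space M"
    and "\<And>a b m. a \<in> A \<Longrightarrow> b \<in> A \<Longrightarrow> m \<in> M \<Longrightarrow>
      linear_ext (act a) (act b m) - bilinear_ext act (circ a b) (basis_vec m) =
      linear_ext (act b) (act a m) - bilinear_ext act (circ b a) (basis_vec m)"
  shows "left_pre_lie_module scal (free_space A) (bilinear_ext circ) scal (free_space M)
    (bilinear_ext act)"
  using assms
  by (intro left_pre_lie_module.intro left_pre_lie_module_axioms.intro)
    (auto intro!: free.vector_space_axioms subspace_free_space linear_map_free_linear bilinear_ext_linear_left
      bilinear_ext_linear_right bilinear_ext_in_subspace[OF subspace_free_space]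
      bilinear_ext_pre_lie[where A = A and M = M])

section \<open>Connectedness and bridges\<close>

lemma wf_graphD:
  assumes "wf_graph G"
  shows "finite (verts G)" "finite (hedges G)"
    "\<And>h. h \<in> hedges G \<Longrightarrow> bd G h \<in> verts G"
    "\<And>h. h \<in> hedges G \<Longrightarrow> sigma G h \<in> hedges G"
    "\<And>h. h \<in> hedges G \<Longrightarrow> sigma G (sigma G h) = h"
    "\<And>h. h \<in> hedges G \<Longrightarrow> htype G (sigma G h) = htype G h"
  using assms by (auto simp: wf_graph_def)

lemma linksI: "h \<in> hedges G \<Longrightarrow> (bd G h, bd G (sigma G h)) \<in> links G"
  by (auto simp: links_def)

lemma sym_links: "wf_graph G \<Longrightarrow> sym (links G)"
  unfolding links_def by (rule symI) (fastforce simp: wf_graphD)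

lemma reach_sym: "wf_graph G \<Longrightarrow> (v, w) \<in> (links G)\<^sup>* \<Longrightarrow> (w, v) \<in> (links G)\<^sup>*"
  by (meson sym_links sym_rtrancl symD)

lemma component_of_eq_iff:
  assumes "wf_graph G" "v \<in> verts G" "w \<in> verts G"
  shows "component_of G v = component_of G w \<longleftrightarrow> (v, w) \<in> (links G)\<^sup>*"
  using assms reach_sym[OF assms(1)]
  by (auto simp: component_of_def intro: rtrancl_trans)

lemma component_of_eqI:
  assumes "wf_graph G" "v \<in> verts G" "w \<in> component_of G v"
  shows "component_of G w = component_of G v"
  using assms component_of_eq_iff[of G v w] by (auto simp: component_of_def)

lemma componentsD:
  assumes "wf_graph G" "C \<in> components G" "v \<in> C"
  shows "C = component_of G v" "v \<in> verts G"
proof -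
  obtain u where u: "u \<in> verts G" "C = component_of G u"
    using assms(2) by (auto simp: components_def)
  then show "C = component_of G v" using component_of_eqI[OF assms(1) u(1)] assms(3) by simp
  show "v \<in> verts G" using u assms(3) by (simp add: component_of_def)
qed

lemma component_of_in_components: "v \<in> verts G \<Longrightarrow> component_of G v \<in> components G"
  by (simp add: components_def)

lemma Union_components: "\<Union> (components G) = verts G"
  by (auto simp: components_def component_of_def)

lemma components_subset: "C \<in> components G \<Longrightarrow> C \<subseteq> verts G"
  by (auto simp: components_def component_of_def)

lemma component_nonempty: "C \<in> components G \<Longrightarrow> C \<noteq> {}"
  by (auto simp: components_def component_of_def)

lemma connected_graph_iff:
  assumes "wf_graph G"
  shows "connected_graph G \<longleftrightarrow>
    verts G \<noteq> {} \<and> (\<forall>v\<in>verts G. \<forall>w\<in>verts G. (v, w) \<in> (links G)\<^sup>*)"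
proof
  assume "connected_graph G"
  then obtain C where C: "components G = {C}" by (auto simp: connected_graph_def is_singleton_def)
  then have "component_of G v = C" if "v \<in> verts G" for v
    using that by (auto simp: components_def)
  moreover have "verts G \<noteq> {}" using C by (auto simp: components_def)
  ultimately show "verts G \<noteq> {} \<and> (\<forall>v\<in>verts G. \<forall>w\<in>verts G. (v, w) \<in> (links G)\<^sup>*)"
    using component_of_eq_iff[OF assms] by auto
next
  assume r: "verts G \<noteq> {} \<and> (\<forall>v\<in>verts G. \<forall>w\<in>verts G. (v, w) \<in> (links G)\<^sup>*)"
  then have "components G = {verts G}" by (auto simp: components_def component_of_def)
  then show "connected_graph G" by (simp add: connected_graph_def)
qed

lemma components_connected: "connected_graph G \<Longrightarrow> components G = {verts G}"
  using Union_components[of G] by (auto simp: connected_graph_def is_singleton_def)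

lemma externals_internals:
  "externals G \<union> internals G = hedges G" "externals G \<inter> internals G = {}"
  by (auto simp: externals_def internals_def)

lemma sigma_cut:
  "sigma (cut G h) l = (if l = h \<or> l = sigma G h then l else sigma G l)"
  by (simp add: cut_def)

lemma wf_cut:
  assumes wf: "wf_graph G" and h: "h \<in> hedges G"
  shows "wf_graph (cut G h)"
proof -
  have "sigma G l \<noteq> h \<and> sigma G l \<noteq> sigma G h" if "l \<in> hedges G" "l \<noteq> h" "l \<noteq> sigma G h" for l
    using wf_graphD(5)[OF wf that(1)] wf_graphD(5)[OF wf h] that by metis
  then show ?thesis
    using wf by (auto simp: wf_graph_def sigma_cut) (auto simp: cut_def)
qed

lemma links_cut_subset: "wf_graph G \<Longrightarrow> links (cut G h) \<subseteq> (links G)\<^sup>="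
  by (auto simp: links_def sigma_cut) (auto simp: cut_def)

lemma component_graph_cut: "component_graph (cut G h) C = cut (component_graph G C) h"
  by (simp add: component_graph_def cut_def)

text \<open>A path that starts in a set closed under links never leaves it, hence is a path of the graph
  induced on that set.\<close>

lemma component_graph_reach:
  assumes closed: "\<And>x y. (x, y) \<in> links H \<Longrightarrow> x \<in> C \<Longrightarrow> y \<in> C"
    and "x \<in> C" "(x, y) \<in> (links H)\<^sup>*"
  shows "(x, y) \<in> (links (component_graph H C))\<^sup>* \<and> y \<in> C"
  using assms(3)
proof (induction rule: rtrancl_induct)
  case base
  then show ?case using \<open>x \<in> C\<close> by simp
next
  case (step y z)
  then have "(y, z) \<in> links (component_graph H C)" "z \<in> C"
    using closed[of y z] by (auto simp: links_def component_graph_def)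
  then show ?case using step by auto
qed

lemma links_component_graph: "links (component_graph G C) \<subseteq> links G"
  by (auto simp: links_def component_graph_def)

text \<open>Local 1PI-ness refers to the components, which are cut out of the graph as graphs of their own.
  The equivalent condition that the ends of every internal edge remain linked after cutting the edge
  speaks of paths in the whole graph only, and such paths can be transported through insertions.\<close>

definition bridgeless :: "('v, 'h, 'e) fgraph \<Rightarrow> bool" where
  "bridgeless G \<longleftrightarrow> (\<forall>h\<in>internals G. (bd G h, bd G (sigma G h)) \<in> (links (cut G h))\<^sup>*)"

lemma component_closed:
  assumes "wf_graph G" "C \<in> components G" "(x, y) \<in> links G" "x \<in> C"
  shows "y \<in> C"
proof -
  have "C = component_of G x" using componentsD[OF assms(1,2,4)] by simp
  moreover have "y \<in> verts G" using assms(1,3) by (auto simp: links_def wf_graphD)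
  ultimately show ?thesis using assms(3) by (auto simp: component_of_def)
qed

lemma wf_component_graph:
  assumes "wf_graph G" "C \<in> components G"
  shows "wf_graph (component_graph G C)"
proof -
  have "bd G (sigma G h) \<in> C" if "h \<in> hedges G" "bd G h \<in> C" for h
    using component_closed[OF assms] linksI[OF that(1)] that by blast
  then show ?thesis
    using assms(1) finite_subset[OF components_subset[OF assms(2)]]
    by (auto simp: wf_graph_def component_graph_def)
qed

text \<open>If the ends of the cut edge are still linked by a detour, every path can be rerouted along it, so
  cutting the edge changes no reachability.\<close>

lemma links_reach_cut:
  assumes "wf_graph G" "h \<in> internals G" "(bd G h, bd G (sigma G h)) \<in> (links (cut G h))\<^sup>*"
  shows "links G \<subseteq> (links (cut G h))\<^sup>*"
proof
  fix p assume "p \<in> links G"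
  then obtain l where l: "l \<in> hedges G" "p = (bd G l, bd G (sigma G l))" by (auto simp: links_def)
  have h: "h \<in> hedges G" "sigma G (sigma G h) = h"
    using assms by (auto simp: internals_def wf_graphD)
  \<comment> \<open>The second half of the cut edge contributes the link in the opposite direction.\<close>
  have s: "(bd G (sigma G h), bd G h) \<in> (links (cut G h))\<^sup>*"
    using reach_sym[OF wf_cut[OF assms(1) h(1)] assms(3)] .
  consider "l = h" | "l = sigma G h" | "l \<noteq> h" "l \<noteq> sigma G h" by blast
  then show "p \<in> (links (cut G h))\<^sup>*"
  proof cases
    case 3
    then have "p \<in> links (cut G h)" using l by (auto simp: links_def cut_def)
    then show ?thesis unfolding l(2) by (rule r_into_rtrancl)
  qed (use l h s assms(3) in auto)
qed

text \<open>If the component of an internal edge is 1PI, the cut component still links the ends of the edge.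
  Conversely a detour around the cut edge stays inside its component, since components are closed
  under links.\<close>

lemma locally_one_PI_iff_bridgeless:
  assumes wf: "wf_graph G"
  shows "locally_one_PI G \<longleftrightarrow> bridgeless G"
proof
  assume l: "locally_one_PI G"
  show "bridgeless G" unfolding bridgeless_def
  proof
    fix h assume h: "h \<in> internals G"
    define C where "C = component_of G (bd G h)"
    have hG: "h \<in> hedges G" using h by (simp add: internals_def)
    have C: "C \<in> components G" "bd G h \<in> C" "bd G (sigma G h) \<in> C"
      using component_of_in_components[of "bd G h" G] hG wf linksI[OF hG] unfolding C_def
      by (auto simp: component_of_def wf_graphD)
    have "h \<in> internals (component_graph G C)"
      using h C by (auto simp: internals_def component_graph_def)
    then have "connected_graph (component_graph (cut G h) C)"
      using l C(1) by (auto simp: locally_one_PI_def one_PI_def component_graph_cut)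
    moreover have "wf_graph (component_graph (cut G h) C)"
      unfolding component_graph_cut
      by (rule wf_cut[OF wf_component_graph[OF wf C(1)]]) (use hG C in \<open>simp add: component_graph_def\<close>)
    ultimately have "(bd G h, bd G (sigma G h)) \<in> (links (component_graph (cut G h) C))\<^sup>*"
      using C by (subst (asm) connected_graph_iff) (auto simp: component_graph_def)
    then show "(bd G h, bd G (sigma G h)) \<in> (links (cut G h))\<^sup>*"
      using rtrancl_mono[OF links_component_graph] by blast
  qed
next
  assume b: "bridgeless G"
  show "locally_one_PI G" unfolding locally_one_PI_def
  proof
    fix C assume C: "C \<in> components G"
    let ?GC = "component_graph G C"
    have wfC: "wf_graph ?GC" using wf_component_graph[OF wf C] .
    have ne: "C \<noteq> {}" using component_nonempty[OF C] .
    have reach: "(x, y) \<in> (links G)\<^sup>*" if "x \<in> C" "y \<in> C" for x y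
      using componentsD[OF wf C that(1)] that(2) by (auto simp: component_of_def)
    have "connected_graph ?GC"
      unfolding connected_graph_iff[OF wfC]
    proof (intro conjI ballI)
      fix x y assume "x \<in> verts ?GC" "y \<in> verts ?GC"
      then have "x \<in> C" "y \<in> C" by (simp_all add: component_graph_def)
      then show "(x, y) \<in> (links ?GC)\<^sup>*"
        using component_graph_reach[of G C x y] component_closed[OF wf C] reach by blast
    qed (use ne in \<open>simp add: component_graph_def\<close>)
    moreover have "connected_graph (cut ?GC h)" if h: "h \<in> internals ?GC" for h
    proof -
      have hG: "h \<in> internals G" and hC: "h \<in> hedges ?GC"
        using h by (auto simp: internals_def component_graph_def)
      have "links G \<subseteq> (links (cut G h))\<^sup>*"
        using links_reach_cut[OF wf hG] b hG by (simp add: bridgeless_def)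
      then have r: "(x, y) \<in> (links (cut G h))\<^sup>*" if "x \<in> C" "y \<in> C" for x y
        using reach[OF that] rtrancl_subset_rtrancl by blast
      have closed: "y \<in> C" if "(x, y) \<in> links (cut G h)" "x \<in> C" for x y
        using that links_cut_subset[OF wf] component_closed[OF wf C] by blast
      show ?thesis
        unfolding connected_graph_iff[OF wf_cut[OF wfC hC]]
      proof (intro conjI ballI)
        fix x y assume "x \<in> verts (cut ?GC h)" "y \<in> verts (cut ?GC h)"
        then have "x \<in> C" "y \<in> C" by (simp_all add: component_graph_def cut_def)
        then show "(x, y) \<in> (links (cut ?GC h))\<^sup>*"
          using component_graph_reach[of "cut G h" C x y] closed r
          unfolding component_graph_cut by blast
      qed (use ne in \<open>simp add: component_graph_def cut_def\<close>)
    qed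
    ultimately show "one_PI ?GC" by (simp add: one_PI_def)
  qed
qed

section \<open>Isomorphisms and isomorphism classes\<close>

text \<open>Isomorphisms of specified graphs without the clause on the specification. The graph underlying a
  contraction and the residue types of components are compared in this weaker sense, which leaves
  the specification of the contraction aside.\<close>

definition graph_iso ::
  "('v \<Rightarrow> 'w) \<Rightarrow> ('h \<Rightarrow> 'l) \<Rightarrow> ('v, 'h, 'e) fgraph \<Rightarrow> ('w, 'l, 'e) fgraph \<Rightarrow> bool" where
  "graph_iso f k G G' \<longleftrightarrow>
     bij_betw f (verts G) (verts G') \<and> bij_betw k (hedges G) (hedges G') \<and>
     (\<forall>h \<in> hedges G. bd G' (k h) = f (bd G h) \<and> sigma G' (k h) = k (sigma G h) \<and>
        htype G' (k h) = htype G h) \<and>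
     (\<forall>v \<in> verts G. vindex G' (f v) = vindex G v)"

lemma sgraph_iso_iff:
  "sgraph_iso f k X Y \<longleftrightarrow> graph_iso f k (fst X) (fst Y) \<and>
    (\<forall>C \<in> components (fst X). snd Y (f ` C) = snd X C)"
  by (cases X; cases Y) (simp add: graph_iso_def)

lemma graph_iso_wf:
  assumes iso: "graph_iso f k G G'" and wf: "wf_graph G"
  shows "wf_graph G'"
proof -
  have b: "bij_betw f (verts G) (verts G')" "bij_betw k (hedges G) (hedges G')"
    using iso by (auto simp: graph_iso_def)
  have "finite (verts G')" "finite (hedges G')"
    using b bij_betw_finite wf_graphD(1,2)[OF wf] by blast+
  moreover have "bd G' l \<in> verts G' \<and> sigma G' l \<in> hedges G' \<and>
      sigma G' (sigma G' l) = l \<and> htype G' (sigma G' l) = htype G' l" if l: "l \<in> hedges G'" for l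
  proof -
    obtain h where "h \<in> hedges G" "l = k h" using bij_betw_imp_surj_on[OF b(2)] l by blast
    then show ?thesis using iso wf b bij_betwE[OF b(1)] bij_betwE[OF b(2)]
      by (auto simp: graph_iso_def wf_graphD)
  qed
  ultimately show ?thesis by (simp add: wf_graph_def)
qed

lemma graph_iso_sym:
  assumes iso: "graph_iso f k G G'" and wf: "wf_graph G"
  shows "graph_iso (inv_into (verts G) f) (inv_into (hedges G) k) G' G"
proof -
  have b: "bij_betw f (verts G) (verts G')" "bij_betw k (hedges G) (hedges G')"
    using iso by (auto simp: graph_iso_def)
  note inv = bij_betw_inv_into_left[OF b(1)] bij_betw_inv_into_left[OF b(2)]
  have "bd G (inv_into (hedges G) k l) = inv_into (verts G) f (bd G' l) \<and>
      sigma G (inv_into (hedges G) k l) = inv_into (hedges G) k (sigma G' l) \<and>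
      htype G (inv_into (hedges G) k l) = htype G' l" if l: "l \<in> hedges G'" for l
  proof -
    obtain h where "h \<in> hedges G" "l = k h" using bij_betw_imp_surj_on[OF b(2)] l by blast
    then show ?thesis using iso wf inv by (auto simp: graph_iso_def wf_graphD)
  qed
  moreover have "vindex G (inv_into (verts G) f w) = vindex G' w" if w: "w \<in> verts G'" for w
  proof -
    obtain v where "v \<in> verts G" "w = f v" using bij_betw_imp_surj_on[OF b(1)] w by blast
    then show ?thesis using iso inv by (auto simp: graph_iso_def)
  qed
  ultimately show ?thesis
    using bij_betw_inv_into[OF b(1)] bij_betw_inv_into[OF b(2)] by (simp add: graph_iso_def)
qed

lemma graph_iso_trans:
  assumes "graph_iso f k G G'" "graph_iso f' k' G' G''"
  shows "graph_iso (f' \<circ> f) (k' \<circ> k) G G''"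
  using assms unfolding graph_iso_def
  by (auto intro: bij_betw_trans dest: bij_betwE)

lemma graph_iso_reach_forward:
  assumes iso: "graph_iso f k G G'" and wf: "wf_graph G" and "(v, w) \<in> (links G)\<^sup>*"
  shows "(f v, f w) \<in> (links G')\<^sup>*"
proof -
  have step: "(f x, f y) \<in> links G'" if xy: "(x, y) \<in> links G" for x y
  proof -
    from xy obtain h where h: "h \<in> hedges G" "x = bd G h" "y = bd G (sigma G h)"
      by (auto simp: links_def)
    then have "k h \<in> hedges G'" "f x = bd G' (k h)" "f y = bd G' (sigma G' (k h))"
      using iso wf by (auto simp: graph_iso_def wf_graphD dest: bij_betwE)
    then show ?thesis using linksI by metis
  qed
  show ?thesis using assms(3)
    by (induction rule: rtrancl_induct) (auto intro: rtrancl_into_rtrancl step)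
qed

lemma graph_isoD:
  assumes "graph_iso f k G G'"
  shows "bij_betw f (verts G) (verts G')" "bij_betw k (hedges G) (hedges G')"
    "\<And>h. h \<in> hedges G \<Longrightarrow> bd G' (k h) = f (bd G h)"
    "\<And>h. h \<in> hedges G \<Longrightarrow> sigma G' (k h) = k (sigma G h)"
    "\<And>h. h \<in> hedges G \<Longrightarrow> htype G' (k h) = htype G h"
    "\<And>v. v \<in> verts G \<Longrightarrow> vindex G' (f v) = vindex G v"
    "\<And>v. v \<in> verts G \<Longrightarrow> f v \<in> verts G'" "\<And>h. h \<in> hedges G \<Longrightarrow> k h \<in> hedges G'"
    "inj_on f (verts G)" "inj_on k (hedges G)" "f ` verts G = verts G'" "k ` hedges G = hedges G'"
  using assms by (auto simp: graph_iso_def bij_betw_def)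

context
  fixes f :: "'v \<Rightarrow> 'w" and k :: "'h \<Rightarrow> 'l" and G :: "('v, 'h, 'e) fgraph" and G'
  assumes iso: "graph_iso f k G G'" and wf: "wf_graph G"
begin

private lemmas D = graph_isoD[OF iso]

lemma graph_iso_reach:
  assumes "v \<in> verts G" "w \<in> verts G"
  shows "(f v, f w) \<in> (links G')\<^sup>* \<longleftrightarrow> (v, w) \<in> (links G)\<^sup>*"
  using graph_iso_reach_forward[OF iso wf, of v w]
    graph_iso_reach_forward[OF graph_iso_sym[OF iso wf] graph_iso_wf[OF iso wf], of "f v" "f w"]
    assms by (auto simp: inv_into_f_f[OF D(9)])

lemma graph_iso_component_of: "v \<in> verts G \<Longrightarrow> component_of G' (f v) = f ` component_of G v"
  using graph_iso_reach by (auto simp: component_of_def D(11)[symmetric])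

lemma graph_iso_components: "components G' = image f ` components G"
  using graph_iso_component_of by (force simp: components_def D(11)[symmetric] image_image)

lemma graph_iso_sigma_eq_iff:
  assumes "h \<in> hedges G" shows "sigma G' (k h) = k h \<longleftrightarrow> sigma G h = h"
  using D(4)[OF assms] D(10) wf_graphD(4)[OF wf assms] assms by (auto dest: inj_onD)

lemma graph_iso_externals: "externals G' = k ` externals G"
  using graph_iso_sigma_eq_iff by (auto simp: externals_def D(12)[symmetric])

lemma graph_iso_internals: "internals G' = k ` internals G"
  using graph_iso_sigma_eq_iff by (auto simp: internals_def D(12)[symmetric])

lemma graph_iso_star:
  assumes "v \<in> verts G" shows "star G' (f v) = k ` star G v"
proof -
  have "bd G' (k h) = f v \<longleftrightarrow> bd G h = v" if "h \<in> hedges G" for h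
    using D(3)[OF that] D(9) wf_graphD(3)[OF wf that] assms by (auto dest: inj_onD)
  then show ?thesis by (auto simp: star_def D(12)[symmetric])
qed

lemma graph_iso_connected: "connected_graph G' \<longleftrightarrow> connected_graph G"
  unfolding connected_graph_iff[OF wf] connected_graph_iff[OF graph_iso_wf[OF iso wf]]
  using graph_iso_reach by (auto simp: D(11)[symmetric])

lemma graph_iso_cut:
  assumes h: "h \<in> hedges G" shows "graph_iso f k (cut G h) (cut G' (k h))"
proof -
  have "sigma (cut G' (k h)) (k l) = k (sigma (cut G h) l)" if "l \<in> hedges G" for l
    using D(4)[OF that] D(4)[OF h] D(10) h that wf_graphD(4)[OF wf h]
    by (auto simp: sigma_cut dest: inj_onD)
  then show ?thesis using iso by (simp add: graph_iso_def) (simp add: cut_def)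
qed

end

lemma image_mset_mset_set_bij:
  assumes "bij_betw e S S'" "\<And>x. x \<in> S \<Longrightarrow> t' (e x) = t x"
  shows "image_mset t' (mset_set S') = image_mset t (mset_set S)"
proof -
  have "mset_set S' = image_mset e (mset_set S)"
    using assms(1) by (metis bij_betw_def image_mset_mset_set)
  then show ?thesis using assms(2)
    by (cases "finite S") (auto simp: image_mset.compositionality intro!: image_mset_cong)
qed

lemma vertex_type_bij:
  assumes "bij_betw e (star G v) (star G' v')" "\<And>h. h \<in> star G v \<Longrightarrow> htype G' (e h) = htype G h"
    "vindex G' v' = vindex G v"
  shows "vertex_type G' v' = vertex_type G v"
  using image_mset_mset_set_bij[OF assms(1), of "htype G'" "htype G"] assms(2,3)
  by (simp add: vertex_type_def)

lemma graph_iso_vertex_type: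
  assumes iso: "graph_iso f k G G'" and wf: "wf_graph G" and "v \<in> verts G"
  shows "vertex_type G' (f v) = vertex_type G v"
proof (rule vertex_type_bij[where e = k])
  have "inj_on k (star G v)"
    using graph_isoD(10)[OF iso] by (rule inj_on_subset) (auto simp: star_def)
  then show "bij_betw k (star G v) (star G' (f v))"
    by (simp add: bij_betw_def graph_iso_star[OF iso wf assms(3)])
qed (use graph_isoD[OF iso] assms(3) in \<open>auto simp: star_def\<close>)

lemma graph_iso_active_verts:
  assumes iso: "graph_iso f k G G'" and wf: "wf_graph G"
  shows "active_verts G' = f ` active_verts G"
proof -
  note D = graph_isoD[OF iso]
  have act: "(\<exists>l\<in>internals G'. bd G' l \<in> component_of G' (f v)) \<longleftrightarrow>
      (\<exists>h\<in>internals G. bd G h \<in> component_of G v)" if v: "v \<in> verts G" for v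
  proof -
    have "bd G' (k h) \<in> component_of G' (f v) \<longleftrightarrow> bd G h \<in> component_of G v"
      if "h \<in> internals G" for h
    proof -
      have h: "h \<in> hedges G" using that by (simp add: internals_def)
      show ?thesis unfolding graph_iso_component_of[OF iso wf v] D(3)[OF h]
        by (rule inj_on_image_mem_iff[OF D(9) wf_graphD(3)[OF wf h]]) (auto simp: component_of_def)
    qed
    then show ?thesis by (simp add: graph_iso_internals[OF iso wf])
  qed
  have "active_verts G' = f ` {v \<in> verts G. \<exists>l\<in>internals G'. bd G' l \<in> component_of G' (f v)}"
    unfolding active_verts_def D(11)[symmetric] by blast
  also have "\<dots> = f ` active_verts G" unfolding active_verts_def using act by (auto cong: conj_cong)
  finally show ?thesis .
qed

lemma graph_iso_bridgeless:
  assumes iso: "graph_iso f k G G'" and wf: "wf_graph G" and "bridgeless G"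
  shows "bridgeless G'"
  unfolding bridgeless_def graph_iso_internals[OF iso wf]
proof safe
  fix h assume h: "h \<in> internals G"
  then have hG: "h \<in> hedges G" by (simp add: internals_def)
  have "(f (bd G h), f (bd G (sigma G h))) \<in> (links (cut G' (k h)))\<^sup>*"
    using assms(3) h hG
    by (intro graph_iso_reach_forward[OF graph_iso_cut[OF iso wf] wf_cut[OF wf]])
      (auto simp: bridgeless_def)
  then show "(bd G' (k h), bd G' (sigma G' (k h))) \<in> (links (cut G' (k h)))\<^sup>*"
    using graph_isoD[OF iso] hG wf_graphD(4)[OF wf hG] by auto
qed

lemma sgraph_iso_sym:
  assumes iso: "sgraph_iso f k X Y" and wf: "wf_graph (fst X)"
  shows "sgraph_iso (inv_into (verts (fst X)) f) (inv_into (hedges (fst X)) k) Y X"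
proof -
  have g: "graph_iso f k (fst X) (fst Y)" using iso by (simp add: sgraph_iso_iff)
  have "snd X (inv_into (verts (fst X)) f ` C') = snd Y C'" if "C' \<in> components (fst Y)" for C'
  proof -
    obtain C where C: "C \<in> components (fst X)" "C' = f ` C"
      using \<open>C' \<in> components (fst Y)\<close> by (auto simp: graph_iso_components[OF g wf])
    then have "inv_into (verts (fst X)) f ` C' = C"
      using components_subset[OF C(1)] graph_isoD(9)[OF g] by (simp add: inv_into_image_cancel)
    then show ?thesis using C iso by (simp add: sgraph_iso_iff)
  qed
  then show ?thesis using graph_iso_sym[OF g wf] by (simp add: sgraph_iso_iff)
qed

lemma sgraph_iso_trans:
  assumes iso: "sgraph_iso f k X Y" "sgraph_iso f' k' Y Z" and wf: "wf_graph (fst X)"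
  shows "sgraph_iso (f' \<circ> f) (k' \<circ> k) X Z"
proof -
  have g: "graph_iso f k (fst X) (fst Y)" using iso by (simp add: sgraph_iso_iff)
  have "snd Z ((f' \<circ> f) ` C) = snd X C" if "C \<in> components (fst X)" for C
  proof -
    have "f ` C \<in> components (fst Y)" using that by (simp add: graph_iso_components[OF g wf])
    then have "snd Z (f' ` f ` C) = snd X C" using iso that by (simp add: sgraph_iso_iff)
    then show ?thesis by (simp add: image_comp)
  qed
  then show ?thesis using iso by (auto simp: sgraph_iso_iff intro: graph_iso_trans)
qed

text \<open>Classes of graphs are images of classes of diagonal pairs. Hence a sum of classes of graphs is the
  image of a sum of classes of pairs, and the three operations on graphs, subgraphs and pairs can be
  treated at once.\<close>

lemma graph_class_eq_image: "graph_class X = fst ` pair_class (X, X)"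
proof (intro equalityI subsetI)
  fix Y assume "Y \<in> graph_class X"
  then have "(Y, Y) \<in> pair_class (X, X)" by (simp add: graph_class_def pair_class_def)
  then show "Y \<in> fst ` pair_class (X, X)" by force
qed (fastforce simp: graph_class_def pair_class_def simp del: sgraph_iso.simps)

lemma contract_simps [simp]:
  "verts (fst (contract X g)) = components (fst g)"
  "hedges (fst (contract X g)) = externals (fst g)"
  "bd (fst (contract X g)) h = component_of (fst g) (bd (fst g) h)"
  "sigma (fst (contract X g)) = sigma (fst X)"
  "htype (fst (contract X g)) = htype (fst X)"
  "vindex (fst (contract X g)) = snd g"
  "snd (contract X g) D = snd X (\<Union>D)"
  by (cases X; cases g; simp)+

lemma covering_refl: "wf_graph G \<Longrightarrow> covering_subgraph G G"
  by (simp add: covering_subgraph_def)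

lemma coveringD:
  assumes "covering_subgraph g G"
  shows "wf_graph g" "wf_graph G" "verts g = verts G" "hedges g = hedges G"
    "\<And>v. v \<in> verts G \<Longrightarrow> vindex g v = vindex G v"
    "\<And>h. h \<in> hedges G \<Longrightarrow> bd g h = bd G h" "\<And>h. h \<in> hedges G \<Longrightarrow> htype g h = htype G h"
    "\<And>h. h \<in> hedges G \<Longrightarrow> sigma g h = h \<or> sigma g h = sigma G h"
  using assms by (auto simp: covering_subgraph_def)

text \<open>The half-edges of a contraction are the external ones of \<open>g\<close> while its involution is that of
  \<open>G\<close>. This is consistent because an external edge of \<open>g\<close> either is external in \<open>G\<close> or belongs to an
  edge of \<open>G\<close> that \<open>g\<close> cuts, and cutting an edge frees both of its halves.\<close>

lemma covering_externals_sigma: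
  assumes c: "covering_subgraph g G" and h: "h \<in> externals g"
  shows "sigma G h \<in> externals g"
proof -
  have hg: "h \<in> hedges G" "h \<in> hedges g" "sigma g h = h"
    using h coveringD[OF c] by (auto simp: externals_def)
  have s: "sigma G h \<in> hedges G" using wf_graphD(4)[OF coveringD(2)[OF c]] hg by simp
  have "sigma g (sigma G h) = sigma G h"
    using coveringD(8)[OF c s] wf_graphD(5)[OF coveringD(1)[OF c], of "sigma G h"]
      wf_graphD(5)[OF coveringD(2)[OF c] hg(1)] hg s coveringD(4)[OF c] by auto
  then show ?thesis using s coveringD(4)[OF c] by (simp add: externals_def)
qed

lemma wf_contract:
  assumes c: "covering_subgraph (fst g) (fst X)"
  shows "wf_graph (fst (contract X g))"
proof -
  note D = coveringD[OF c]
  show ?thesis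
    using wf_graphD[OF D(1)] wf_graphD[OF D(2)] covering_externals_sigma[OF c] D(4)
    by (auto simp: wf_graph_def components_def) (auto simp: externals_def)
qed

lemma contract_graph_iso:
  assumes c: "covering_subgraph (fst g) (fst X)"
    and isoX: "graph_iso f k (fst X) (fst X')" and isog: "sgraph_iso f k g g'"
  shows "graph_iso (image f) k (fst (contract X g)) (fst (contract X' g'))"
proof -
  note D = coveringD[OF c]
  have ig: "graph_iso f k (fst g) (fst g')" using isog by (simp add: sgraph_iso_iff)
  have inj_f: "inj_on (image f) (components (fst g))"
    using inj_on_image_Pow[OF graph_isoD(9)[OF ig]] components_subset by (blast intro: inj_on_subset)
  have inj_k: "inj_on k (externals (fst g))"
    using graph_isoD(10)[OF ig] by (rule inj_on_subset) (auto simp: externals_def)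
  have comp: "component_of (fst g') (f (bd (fst g) h)) = f ` component_of (fst g) (bd (fst g) h)"
    if "h \<in> hedges (fst g)" for h
    using graph_iso_component_of[OF ig D(1)] wf_graphD(3)[OF D(1) that] by simp
  have ext: "h \<in> hedges (fst g) \<and> h \<in> hedges (fst X)" if "h \<in> externals (fst g)" for h
    using that D(4) by (simp add: externals_def)
  show ?thesis
    unfolding graph_iso_def[of "image f"] contract_simps bij_betw_def
      graph_iso_components[OF ig D(1)] graph_iso_externals[OF ig D(1)]
    using inj_f inj_k comp ext isog graph_isoD(3-5)[OF isoX] graph_isoD(3)[OF ig]
    by (simp add: sgraph_iso_iff)
qed

text \<open>The contracted graph being connected, its only component is the set of all components of \<open>g\<close>,
  whose union is the set of all vertices. So the specifications of the two contractions are only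
  compared on the full vertex set.\<close>

lemma contract_sgraph_iso:
  assumes c: "covering_subgraph (fst g) (fst X)"
    and isoX: "sgraph_iso f k X X'" and isog: "sgraph_iso f k g g'"
    and con: "connected_graph (fst X)" "connected_graph (fst (contract X g))"
  shows "sgraph_iso (image f) k (contract X g) (contract X' g')"
proof -
  note D = coveringD[OF c]
  have "components (fst (contract X g)) = {components (fst g)}"
    using components_connected[OF con(2)] by simp
  moreover have "\<Union>(components (fst g)) = verts (fst X)" by (simp add: Union_components D(3))
  moreover have "verts (fst X) \<in> components (fst X)" using components_connected[OF con(1)] by simp
  ultimately show ?thesis
    using isoX contract_graph_iso[OF c _ isog] by (simp add: sgraph_iso_iff image_Union[symmetric])
qed

lemma sgraph_iso_residue_vertex_type:
  assumes iso: "sgraph_iso f k X Y" and wf: "wf_graph (fst X)" and C: "C \<in> components (fst X)"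
  shows "vertex_type (fst (residue Y)) (f ` C) = vertex_type (fst (residue X)) C"
  unfolding residue_def using iso C
  by (intro graph_iso_vertex_type[OF contract_graph_iso[OF covering_refl[OF wf]]]
      wf_contract covering_refl wf) (auto simp: sgraph_iso_iff)

lemma sgraph_iso_residue_type:
  assumes iso: "sgraph_iso f k X Y" and wf: "wf_graph (fst X)" and "connected_graph (fst X)"
  shows "residue_type Y = residue_type X"
  unfolding residue_type_def
  using sgraph_iso_residue_vertex_type[OF iso wf, of "verts (fst X)"] components_connected[OF assms(3)]
    graph_isoD(11)[of f k "fst X" "fst Y"] iso by (simp add: sgraph_iso_iff)

text \<open>The form in which the closure of specified graphs under isomorphism and insertion is proved.\<close>

lemma specified_graph_iff:
  "specified_graph T X \<longleftrightarrow> wf_graph (fst X) \<and> bridgeless (fst X) \<and>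
     (\<forall>h\<in>hedges (fst X). htype (fst X) h \<in> half_edge_types T) \<and>
     (\<forall>v\<in>verts (fst X). vertex_type (fst X) v \<in> vertex_types T) \<and>
     (\<forall>C \<in> components (fst X). vertex_type (fst (residue X)) C \<in> vertex_types T)"
  using locally_one_PI_iff_bridgeless by (auto simp: specified_graph_def)

lemma specified_graph_iso:
  assumes iso: "sgraph_iso f k X Y" and X: "specified_graph T X"
  shows "specified_graph T Y"
proof -
  have wf: "wf_graph (fst X)" using X by (simp add: specified_graph_iff)
  have g: "graph_iso f k (fst X) (fst Y)" using iso by (simp add: sgraph_iso_iff)
  show ?thesis
    using X graph_iso_wf[OF g wf] graph_iso_bridgeless[OF g wf] graph_isoD(5)[OF g]
      graph_iso_vertex_type[OF g wf] sgraph_iso_residue_vertex_type[OF iso wf]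
    by (auto simp: specified_graph_iff graph_iso_components[OF g wf]
        graph_isoD(11,12)[OF g, symmetric])
qed

lemma connected_specified_graph_iso:
  assumes "sgraph_iso f k X Y" "connected_specified_graph T X"
  shows "connected_specified_graph T Y"
  using assms specified_graph_iso[OF assms(1)] graph_iso_connected[of f k "fst X" "fst Y"]
  by (auto simp: connected_specified_graph_def sgraph_iso_iff specified_graph_iff)

lemma specified_covering_subgraph_iff:
  "specified_covering_subgraph T g X \<longleftrightarrow>
     specified_graph T g \<and> specified_graph T X \<and> covering_subgraph (fst g) (fst X) \<and>
     (\<forall>C \<in> components (fst g) \<inter> components (fst X).
        (\<forall>h \<in> hedges (fst X). bd (fst X) h \<in> C \<longrightarrow> sigma (fst g) h = sigma (fst X) h) \<longrightarrow>
        snd g C = snd X C)"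
  by (cases g; cases X) simp

lemma covering_subgraph_iso:
  assumes c: "covering_subgraph g G" and isog: "graph_iso f k g g'" and isoG: "graph_iso f k G G'"
  shows "covering_subgraph g' G'"
proof -
  note D = coveringD[OF c] and g = graph_isoD[OF isog] and G = graph_isoD[OF isoG]
  have "wf_graph g'" "wf_graph G'" "verts g' = verts G'" "hedges g' = hedges G'"
    using graph_iso_wf[OF isog D(1)] graph_iso_wf[OF isoG D(2)] D(3,4) g(11,12) G(11,12) by auto
  moreover have "vindex g' w = vindex G' w" if "w \<in> f ` verts G" for w
    using that D(3,5) g(6) G(6) by auto
  moreover have "bd g' l = bd G' l \<and> htype g' l = htype G' l \<and> sigma g' l \<in> {l, sigma G' l}"
    if l: "l \<in> k ` hedges G" for l
  proof -
    obtain h where h: "h \<in> hedges G" "l = k h" using l by blast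
    then show ?thesis using D(4) D(6-8)[OF h(1)] g(3-5)[of h] G(3-5)[OF h(1)] by auto
  qed
  ultimately show ?thesis by (simp add: covering_subgraph_def G(11,12))
qed

abbreviation covering_pair ::
  "('v, 'h, 'e) sgraph \<times> ('v, 'h, 'e) sgraph \<Rightarrow> bool" where
  "covering_pair p \<equiv> covering_subgraph (fst (snd p)) (fst (fst p))"

definition pair_iso where
  "pair_iso f k p q \<longleftrightarrow> sgraph_iso f k (fst p) (fst q) \<and> sgraph_iso f k (snd p) (snd q)"

lemma covering_pair_iso: "pair_iso f k p q \<Longrightarrow> covering_pair p \<Longrightarrow> covering_pair q"
  by (auto simp: pair_iso_def sgraph_iso_iff intro: covering_subgraph_iso)

lemma pair_iso_trans: "pair_iso f k p q \<Longrightarrow> pair_iso f' k' q r \<Longrightarrow> covering_pair p \<Longrightarrow>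
    pair_iso (f' \<circ> f) (k' \<circ> k) p r"
  by (auto simp: pair_iso_def intro: sgraph_iso_trans dest: coveringD(1,2))

lemma pair_iso_sym:
  assumes "pair_iso f k p q" and c: "covering_pair p"
  shows "pair_iso (inv_into (verts (fst (fst p))) f) (inv_into (hedges (fst (fst p))) k) q p"
  using assms(1) sgraph_iso_sym[of f k "fst p" "fst q"] sgraph_iso_sym[of f k "snd p" "snd q"]
    coveringD(1-4)[OF c] by (simp add: pair_iso_def)

text \<open>An isomorphism can be inverted because the source is well formed. The class consists of the
  copies on natural numbers, so it may be compared for graphs of different vertex types.\<close>

lemma pair_class_eqI:
  assumes "pair_iso f k p q" "covering_pair p"
  shows "pair_class p = pair_class q"
  using pair_iso_trans[OF pair_iso_sym[OF assms] _ covering_pair_iso[OF assms]]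
    pair_iso_trans[OF assms(1) _ assms(2)]
  unfolding pair_class_def pair_iso_def by blast

lemma graph_class_eqI:
  assumes "sgraph_iso f k X Y" "wf_graph (fst X)"
  shows "graph_class X = graph_class Y"
  using pair_class_eqI[of f k "(X, X)" "(Y, Y)"] assms
  by (simp add: pair_iso_def covering_refl graph_class_eq_image)

lemma specified_pair_iso:
  assumes iso: "pair_iso f k p q" and p: "specified_pair T p"
  shows "specified_pair T q"
proof -
  obtain X g X' g' where pq: "p = (X, g)" "q = (X', g')" by (cases p; cases q) blast
  have isoX: "sgraph_iso f k X X'" and isog: "sgraph_iso f k g g'"
    using iso by (simp_all add: pair_iso_def pq)
  have gX: "graph_iso f k (fst X) (fst X')" and gg: "graph_iso f k (fst g) (fst g')"
    using isoX isog by (simp_all add: sgraph_iso_iff)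
  have sp: "connected_specified_graph T X" "specified_covering_subgraph T g X"
    "connected_specified_graph T (contract X g)"
    using p by (simp_all add: specified_pair_def pq)
  have c: "covering_subgraph (fst g) (fst X)" using sp by (simp add: specified_covering_subgraph_iff)
  note D = coveringD[OF c]
  have "snd g' C' = snd X' C'"
    if C': "C' \<in> components (fst g')" "C' \<in> components (fst X')"
      and eq: "\<And>h. h \<in> hedges (fst X') \<Longrightarrow> bd (fst X') h \<in> C' \<Longrightarrow> sigma (fst g') h = sigma (fst X') h"
    for C'
  proof -
    obtain C where C: "C \<in> components (fst g)" "C' = f ` C"
      using C'(1) by (auto simp: graph_iso_components[OF gg D(1)])
    obtain B where B: "B \<in> components (fst X)" "C' = f ` B"
      using C'(2) by (auto simp: graph_iso_components[OF gX D(2)])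
    have "B = C"
      using inj_on_image_eq_iff[OF graph_isoD(9)[OF gX], of B C] C B
        components_subset[OF C(1)] components_subset[OF B(1)] D(3) by simp
    have "sigma (fst g) h = sigma (fst X) h" if h: "h \<in> hedges (fst X)" "bd (fst X) h \<in> C" for h
    proof -
      have "k (sigma (fst g) h) = k (sigma (fst X) h)"
        using eq[of "k h"] h C(2) graph_isoD[OF gX] graph_isoD(4)[OF gg] D(4) by auto
      then show ?thesis
        using inj_onD[OF graph_isoD(10)[OF gX], of "sigma (fst g) h" "sigma (fst X) h"]
          wf_graphD(4)[OF D(1), of h] wf_graphD(4)[OF D(2), of h] h D(4) by simp
    qed
    then have "snd g C = snd X C"
      using sp(2) C(1) B(1) \<open>B = C\<close> by (auto simp: specified_covering_subgraph_iff)
    then show ?thesis using C B isoX isog \<open>B = C\<close> by (simp add: sgraph_iso_iff)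
  qed
  moreover have "connected_specified_graph T (contract X' g')"
    using sp by (intro connected_specified_graph_iso[OF contract_sgraph_iso[OF c isoX isog]])
      (simp_all add: connected_specified_graph_def)
  ultimately show ?thesis
    using sp specified_graph_iso[OF isog] connected_specified_graph_iso[OF isoX]
      covering_subgraph_iso[OF c gg gX]
    by (auto simp: pq specified_pair_def specified_covering_subgraph_iff connected_specified_graph_def)
qed

text \<open>Classes only contain graphs on natural numbers, whereas insertion and contraction produce graphs on
  sum types and on sets. Finite graphs have copies on natural numbers, so classes are nonempty and
  the choice of a representative makes sense for them.\<close>

lemma pair_iso_nat_copy:
  fixes p :: "('v, 'h, 'e) sgraph \<times> ('v, 'h, 'e) sgraph"
  assumes c: "covering_pair p"
  obtains q :: "(nat, nat, 'e) sgraph \<times> (nat, nat, 'e) sgraph" and f k where "pair_iso f k p q"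
proof -
  note D = coveringD[OF c]
  obtain f :: "'v \<Rightarrow> nat" where f: "inj_on f (verts (fst (fst p)))"
    using finite_imp_inj_to_nat_seg[OF wf_graphD(1)[OF D(2)]] by blast
  obtain k :: "'h \<Rightarrow> nat" where k: "inj_on k (hedges (fst (fst p)))"
    using finite_imp_inj_to_nat_seg[OF wf_graphD(2)[OF D(2)]] by blast
  define f' where "f' = inv_into (verts (fst (fst p))) f"
  define k' where "k' = inv_into (hedges (fst (fst p))) k"
  define copy :: "('v, 'h, 'e) sgraph \<Rightarrow> (nat, nat, 'e) sgraph" where
    "copy X = (\<lparr>verts = f ` verts (fst X), hedges = k ` hedges (fst X),
       bd = (\<lambda>h. f (bd (fst X) (k' h))), sigma = (\<lambda>h. k (sigma (fst X) (k' h))),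
       htype = (\<lambda>h. htype (fst X) (k' h)), vindex = (\<lambda>v. vindex (fst X) (f' v))\<rparr>,
       (\<lambda>C. snd X (f' ` C)))" for X
  have "sgraph_iso f k X (copy X)"
    if "verts (fst X) = verts (fst (fst p))" "hedges (fst X) = hedges (fst (fst p))" for X
  proof -
    have "f' ` f ` C = C" if "C \<in> components (fst X)" for C
      using components_subset[OF that] \<open>verts (fst X) = _\<close> f unfolding f'_def
      by (simp add: inv_into_image_cancel)
    then show ?thesis
      using that f k
      by (auto simp: sgraph_iso_iff graph_iso_def copy_def f'_def k'_def bij_betw_def inv_into_f_f)
  qed
  then have "pair_iso f k p (copy (fst p), copy (snd p))"
    using D by (simp add: pair_iso_def)
  then show ?thesis by (rule that)
qed

lemma rep_graph_class:
  fixes X :: "('v, 'h, 'e) sgraph"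
  assumes "wf_graph (fst X)"
  obtains f k where "sgraph_iso f k X (rep (graph_class X))"
proof -
  obtain q :: "(nat, nat, 'e) sgraph \<times> (nat, nat, 'e) sgraph" and f k where "pair_iso f k (X, X) q"
    using pair_iso_nat_copy[of "(X, X)"] covering_refl[OF assms] unfolding fst_conv snd_conv by metis
  then have "fst q \<in> graph_class X" by (auto simp: graph_class_def pair_iso_def)
  then have "rep (graph_class X) \<in> graph_class X" unfolding rep_def by (rule someI)
  then show ?thesis using that by (auto simp: graph_class_def)
qed

lemma rep_pair_class:
  fixes p :: "('v, 'h, 'e) sgraph \<times> ('v, 'h, 'e) sgraph"
  assumes "covering_pair p"
  obtains f k where "pair_iso f k p (rep (pair_class p))"
proof -
  obtain q :: "(nat, nat, 'e) sgraph \<times> (nat, nat, 'e) sgraph" and f k where "pair_iso f k p q"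
    by (rule pair_iso_nat_copy[OF assms])
  then have "q \<in> pair_class p" by (auto simp: pair_class_def pair_iso_def)
  then have "rep (pair_class p) \<in> pair_class p" unfolding rep_def by (rule someI)
  then show ?thesis using that by (auto simp: pair_class_def pair_iso_def)
qed

section \<open>Connectivity of an insertion\<close>

text \<open>The map of vertices that undoes an insertion by shrinking the inserted graph back to \<open>v\<close>. Insertion
  pulls the specification back along it.\<close>

definition collapse :: "'w \<Rightarrow> 'v + 'w \<Rightarrow> 'w" where
  "collapse v = case_sum (\<lambda>_. v) (\<lambda>w. w)"

lemma collapse_simps [simp]: "collapse v (Inl a) = v" "collapse v (Inr w) = w"
  by (simp_all add: collapse_def)

lemma insert_simps [simp]:
  "verts (fst (insert_at X v b Y)) = Inl ` verts (fst X) \<union> Inr ` (verts (fst Y) - {v})"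
  "hedges (fst (insert_at X v b Y)) = Inl ` internals (fst X) \<union> Inr ` hedges (fst Y)"
  "bd (fst (insert_at X v b Y)) (Inl h) = Inl (bd (fst X) h)"
  "bd (fst (insert_at X v b Y)) (Inr l) =
     (if bd (fst Y) l = v then Inl (bd (fst X) (b l)) else Inr (bd (fst Y) l))"
  "sigma (fst (insert_at X v b Y)) (Inl h) = Inl (sigma (fst X) h)"
  "sigma (fst (insert_at X v b Y)) (Inr l) = Inr (sigma (fst Y) l)"
  "htype (fst (insert_at X v b Y)) (Inl h) = htype (fst X) h"
  "htype (fst (insert_at X v b Y)) (Inr l) = htype (fst Y) l"
  "vindex (fst (insert_at X v b Y)) (Inl u) = vindex (fst X) u"
  "vindex (fst (insert_at X v b Y)) (Inr w) = vindex (fst Y) w"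
  "snd (insert_at X v b Y) C = snd Y (collapse v ` C)"
  by (cases X; cases Y; simp add: collapse_def)+

lemma internals_insert:
  "internals (fst (insert_at X v b Y)) = Inl ` internals (fst X) \<union> Inr ` internals (fst Y)"
  by (auto simp: internals_def)

lemma externals_insert: "externals (fst (insert_at X v b Y)) = Inr ` externals (fst Y)"
  by (auto simp: internals_def externals_def)

text \<open>Gluings in terms of the half-edges and their types alone. All bijections between sets of gluings
  arise by composing with bijections of the half-edges on either side.\<close>

definition typed_bijections ::
  "('a \<Rightarrow> 'e) \<Rightarrow> 'a set \<Rightarrow> ('b \<Rightarrow> 'e) \<Rightarrow> 'b set \<Rightarrow> ('a \<Rightarrow> 'b) set" where
  "typed_bijections t S t' S' = {b \<in> S \<rightarrow>\<^sub>E S'. bij_betw b S S' \<and> (\<forall>h \<in> S. t' (b h) = t h)}"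

lemma gluings_eq:
  "gluings X v Y = typed_bijections (htype (fst Y)) (star (fst Y) v) (htype (fst X)) (externals (fst X))"
  by (simp add: gluings_def typed_bijections_def)

lemma gluingD:
  assumes "b \<in> gluings X v Y"
  shows "bij_betw b (star (fst Y) v) (externals (fst X))"
    "\<And>h. h \<in> star (fst Y) v \<Longrightarrow> htype (fst X) (b h) = htype (fst Y) h"
    "\<And>h. h \<in> hedges (fst Y) \<Longrightarrow> bd (fst Y) h = v \<Longrightarrow> b h \<in> externals (fst X)"
  using assms by (auto simp: gluings_def star_def)

text \<open>A covering subgraph has the same half-edges at a vertex, so a gluing for the graph is one for the
  subgraph: this is what performing an insertion simultaneously in both means.\<close>

lemma gluings_covering:
  assumes c: "covering_subgraph (fst g) (fst Y)"
  shows "gluings X v g = gluings X v Y"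
proof -
  have "star (fst g) v = star (fst Y) v" using coveringD[OF c] by (auto simp: star_def)
  then show ?thesis using coveringD(7)[OF c] by (auto simp: gluings_def star_def)
qed

lemma vertex_type_covering:
  assumes c: "covering_subgraph g G" and v: "v \<in> verts G"
  shows "vertex_type g v = vertex_type G v"
proof -
  have "star g v = star G v" using coveringD[OF c] by (auto simp: star_def)
  then show ?thesis using coveringD[OF c] v
    by (intro vertex_type_bij[where e = id]) (auto simp: star_def)
qed

lemma typed_bijections_comp:
  assumes e: "bij_betw e S2 S1" "\<And>h. h \<in> S2 \<Longrightarrow> t1 (e h) = t2 h"
    and k: "bij_betw k E1 E2" "\<And>x. x \<in> E1 \<Longrightarrow> t2' (k x) = t1' x"
    and b: "b \<in> typed_bijections t1 S1 t1' E1"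
  shows "restrict (k \<circ> b \<circ> e) S2 \<in> typed_bijections t2 S2 t2' E2"
proof -
  have b': "bij_betw b S1 E1" "\<And>h. h \<in> S1 \<Longrightarrow> t1' (b h) = t1 h"
    using b by (auto simp: typed_bijections_def)
  have "bij_betw (k \<circ> b \<circ> e) S2 E2"
    using bij_betw_trans[OF e(1) bij_betw_trans[OF b'(1) k(1)]] by (simp add: comp_assoc)
  then have r: "bij_betw (restrict (k \<circ> b \<circ> e) S2) S2 E2"
    by (rule bij_betw_cong[THEN iffD1, rotated]) simp
  have "t2' (k (b (e h))) = t2 h" if "h \<in> S2" for h
    using bij_betwE[OF e(1)] bij_betwE[OF b'(1)] that b'(2) k(2) e(2) by simp
  then show ?thesis using r bij_betwE[OF r] by (auto simp: typed_bijections_def)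
qed

text \<open>Composition with the inverses of \<open>k\<close> and \<open>e\<close> is inverse to composition with \<open>k\<close> and \<open>e\<close>;
  restricting to the source keeps the results extensional.\<close>

lemma bij_betw_typed_bijections:
  assumes e: "bij_betw e S2 S1" "\<And>h. h \<in> S2 \<Longrightarrow> t1 (e h) = t2 h"
    and k: "bij_betw k E1 E2" "\<And>x. x \<in> E1 \<Longrightarrow> t2' (k x) = t1' x"
  shows "bij_betw (\<lambda>b. restrict (k \<circ> b \<circ> e) S2)
    (typed_bijections t1 S1 t1' E1) (typed_bijections t2 S2 t2' E2)"
proof -
  define e' where "e' = inv_into S2 e"
  define k' where "k' = inv_into E1 k"
  have e': "bij_betw e' S1 S2" "\<And>h. h \<in> S1 \<Longrightarrow> e (e' h) = h" "\<And>h. h \<in> S2 \<Longrightarrow> e' (e h) = h"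
    using e(1) unfolding e'_def
    by (auto simp: bij_betw_inv_into bij_betw_inv_into_right bij_betw_inv_into_left)
  have k': "bij_betw k' E2 E1" "\<And>h. h \<in> E2 \<Longrightarrow> k (k' h) = h" "\<And>h. h \<in> E1 \<Longrightarrow> k' (k h) = h"
    using k(1) unfolding k'_def
    by (auto simp: bij_betw_inv_into bij_betw_inv_into_right bij_betw_inv_into_left)
  have t: "\<And>h. h \<in> S1 \<Longrightarrow> t2 (e' h) = t1 h" "\<And>x. x \<in> E2 \<Longrightarrow> t1' (k' x) = t2' x"
    using e(2) k(2) e' k' by (metis bij_betwE)+
  show ?thesis
  proof (rule bij_betw_byWitness[where f' = "\<lambda>b. restrict (k' \<circ> b \<circ> e') S1"])
    show "\<forall>b\<in>typed_bijections t1 S1 t1' E1.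
        restrict (k' \<circ> restrict (k \<circ> b \<circ> e) S2 \<circ> e') S1 = b"
    proof
      fix b assume "b \<in> typed_bijections t1 S1 t1' E1"
      then have "b \<in> S1 \<rightarrow>\<^sub>E E1" by (simp add: typed_bijections_def)
      then show "restrict (k' \<circ> restrict (k \<circ> b \<circ> e) S2 \<circ> e') S1 = b"
        using e' k' bij_betwE[OF e'(1)] by (auto simp: fun_eq_iff PiE_iff extensional_def)
    qed
    show "\<forall>b\<in>typed_bijections t2 S2 t2' E2.
        restrict (k \<circ> restrict (k' \<circ> b \<circ> e') S1 \<circ> e) S2 = b"
    proof
      fix b assume "b \<in> typed_bijections t2 S2 t2' E2"
      then have "b \<in> S2 \<rightarrow>\<^sub>E E2" by (simp add: typed_bijections_def)
      then show "restrict (k \<circ> restrict (k' \<circ> b \<circ> e') S1 \<circ> e) S2 = b"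
        using e' k' bij_betwE[OF e(1)] by (auto simp: fun_eq_iff PiE_iff extensional_def)
    qed
    show "(\<lambda>b. restrict (k \<circ> b \<circ> e) S2) ` typed_bijections t1 S1 t1' E1
        \<subseteq> typed_bijections t2 S2 t2' E2"
      by (rule image_subsetI, erule typed_bijections_comp[rotated 4]) (fact e k)+
    show "(\<lambda>b. restrict (k' \<circ> b \<circ> e') S1) ` typed_bijections t2 S2 t2' E2
        \<subseteq> typed_bijections t1 S1 t1' E1"
      by (rule image_subsetI, erule typed_bijections_comp[rotated 4]) (fact e'(1) k'(1) t)+
  qed
qed

lemma links_cut: "links (cut G h) = {(bd G l, bd G (sigma (cut G h) l)) | l. l \<in> hedges G}"
  by (simp add: links_def cut_def)

text \<open>A path downstairs lifts to a path upstairs as soon as each link has some lift: the end of one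
  lifted link and the start of the next lie over the same vertex, and the only fibre that can
  have more than one vertex, the inserted graph, is connected.\<close>

lemma lift_reach:
  fixes R :: "('v + 'w) rel"
  defines "V A W v \<equiv> Inl ` A \<union> Inr ` (W - {v})"
  assumes fib: "\<And>a a'. a \<in> A \<Longrightarrow> a' \<in> A \<Longrightarrow> (Inl a, Inl a') \<in> R\<^sup>*"
    and S: "\<And>c d. (c, d) \<in> S \<Longrightarrow>
      \<exists>x\<in>V A W v. \<exists>y\<in>V A W v. (x, y) \<in> R\<^sup>* \<and> collapse v x = c \<and> collapse v y = d"
    and x: "x \<in> V A W v" and "y \<in> V A W v" and "(collapse v x, collapse v y) \<in> S\<^sup>*"
  shows "(x, y) \<in> R\<^sup>*"
proof -
  have eq: "(y, z) \<in> R\<^sup>*" if "y \<in> V A W v" "z \<in> V A W v" "collapse v y = collapse v z" for y z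
    using that fib by (auto simp: V_def)
  have "\<forall>y\<in>V A W v. collapse v y = d \<longrightarrow> (x, y) \<in> R\<^sup>*" if "(collapse v x, d) \<in> S\<^sup>*" for d
    using that
  proof (induction rule: rtrancl_induct)
    case base
    then show ?case using eq[OF x] by simp
  next
    case (step c d)
    obtain x' y' where "x' \<in> V A W v" "y' \<in> V A W v" "(x', y') \<in> R\<^sup>*"
      "collapse v x' = c" "collapse v y' = d"
      using S[OF step.hyps(2)] by blast
    then have "(x, y') \<in> R\<^sup>*" using step.IH by (blast intro: rtrancl_trans)
    then show ?case using eq[OF \<open>y' \<in> V A W v\<close>] \<open>collapse v y' = d\<close> by (blast intro: rtrancl_trans)
  qed
  then show ?thesis using assms by blast
qed

lemma inj_on_case_sum:
  assumes "inj_on f A" "inj_on g B" "f ` A \<inter> g ` B = {}"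
  shows "inj_on (case_sum f g) (Inl ` A \<union> Inr ` B)"
proof (rule inj_onI)
  fix x y assume "x \<in> Inl ` A \<union> Inr ` B" "y \<in> Inl ` A \<union> Inr ` B" "case_sum f g x = case_sum f g y"
  then show "x = y" using assms by (cases x; cases y) (auto dest: inj_onD)
qed

text \<open>The preimage of \<open>C\<close> under \<open>collapse v\<close>. It depends on \<open>G\<close> through the vertices only, hence is the
  same for a graph and its covering subgraphs.\<close>

definition inserted_component ::
  "('v, 'h, 'e) sgraph \<Rightarrow> 'w \<Rightarrow> ('w, 'l, 'e) fgraph \<Rightarrow> 'w set \<Rightarrow> ('v + 'w) set" where
  "inserted_component X v G C = {z \<in> Inl ` verts (fst X) \<union> Inr ` (verts G - {v}). collapse v z \<in> C}"

context
  fixes X :: "('v, 'h, 'e) sgraph" and v :: 'w and b :: "'l \<Rightarrow> 'h" and Y :: "('w, 'l, 'e) sgraph"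
  assumes wfX: "wf_graph (fst X)" and conX: "connected_graph (fst X)"
    and wfY: "wf_graph (fst Y)" and v: "v \<in> verts (fst Y)" and b: "b \<in> gluings X v Y"
begin

private abbreviation "I \<equiv> insert_at X v b Y"

lemma wf_insert: "wf_graph (fst I)"
proof -
  have 1: "b h \<in> hedges (fst X)" if "h \<in> hedges (fst Y)" "bd (fst Y) h = v" for h
    using gluingD(3)[OF b that] by (simp add: externals_def)
  have 2: "h \<in> hedges (fst X) \<and> sigma (fst X) h \<in> internals (fst X)" if "h \<in> internals (fst X)" for h
    using that wf_graphD(4,5)[OF wfX] by (auto simp: internals_def)
  have "finite (internals (fst X))"
    using wf_graphD(2)[OF wfX] by (rule rev_finite_subset) (auto simp: internals_def)
  then show ?thesis
    unfolding wf_graph_def using 1 2 wf_graphD[OF wfX] wf_graphD[OF wfY]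
    by auto
qed

lemma collapse_verts_insert: "collapse v ` verts (fst I) = verts (fst Y)"
proof -
  have "verts (fst X) \<noteq> {}" using conX wfX by (simp add: connected_graph_iff)
  then show ?thesis using v by (auto simp: image_Un image_image)
qed

lemma collapse_in_verts: "x \<in> verts (fst I) \<Longrightarrow> collapse v x \<in> verts (fst Y)"
  using collapse_verts_insert by blast

lemma collapse_bd: "collapse v (bd (fst I) (Inr h)) = bd (fst Y) h"
  by simp

lemma bd_insert_in_verts: "h \<in> hedges (fst Y) \<Longrightarrow> bd (fst I) (Inr h) \<in> verts (fst I)"
  using wf_graphD(3)[OF wf_insert, of "Inr h"] by simp

text \<open>The external edges of the inserted graph contribute loops at most, so its internal edges suffice to
  connect it. Stated for any relation whose closure contains these, in order to apply after an edge of the other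
  graph has been cut.\<close>

lemma fibre_reach:
  assumes R: "\<And>h. h \<in> internals (fst X) \<Longrightarrow>
      (Inl (bd (fst X) h), Inl (bd (fst X) (sigma (fst X) h))) \<in> R\<^sup>*"
    and "a \<in> verts (fst X)" "a' \<in> verts (fst X)"
  shows "(Inl a, Inl a') \<in> R\<^sup>*"
proof -
  have "(a, a') \<in> (links (fst X))\<^sup>*" using conX wfX assms(2,3) by (simp add: connected_graph_iff)
  then show ?thesis
  proof (induction rule: rtrancl_induct)
    case (step y z)
    then obtain h where h: "h \<in> hedges (fst X)" "y = bd (fst X) h" "z = bd (fst X) (sigma (fst X) h)"
      by (auto simp: links_def)
    then have "(Inl y, Inl z) \<in> R\<^sup>*"
      using R[of h] by (cases "sigma (fst X) h = h") (auto simp: internals_def)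
    with step.IH show ?case by (rule rtrancl_trans)
  qed simp
qed

lemma insert_link_left:
  "h \<in> internals (fst X) \<Longrightarrow> (Inl (bd (fst X) h), Inl (bd (fst X) (sigma (fst X) h))) \<in> links (fst I)"
  using linksI[of "Inl h" "fst I"] by simp

text \<open>Collapsing maps links to links or to points; the converse is lifting of paths.\<close>

lemma reach_insert:
  assumes x: "x \<in> verts (fst I)" and y: "y \<in> verts (fst I)"
  shows "(x, y) \<in> (links (fst I))\<^sup>* \<longleftrightarrow> (collapse v x, collapse v y) \<in> (links (fst Y))\<^sup>*"
proof
  have step: "(collapse v x, collapse v y) \<in> (links (fst Y))\<^sup>*" if "(x, y) \<in> links (fst I)" for x y
    using that r_into_rtrancl[OF linksI[of _ "fst Y"]] unfolding links_def[of "fst I"]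
    by auto
  assume "(x, y) \<in> (links (fst I))\<^sup>*"
  then show "(collapse v x, collapse v y) \<in> (links (fst Y))\<^sup>*"
    by (induction rule: rtrancl_induct) (auto intro: rtrancl_trans step)
next
  assume r: "(collapse v x, collapse v y) \<in> (links (fst Y))\<^sup>*"
  have S: "\<exists>x\<in>verts (fst I). \<exists>y\<in>verts (fst I).
      (x, y) \<in> (links (fst I))\<^sup>* \<and> collapse v x = c \<and> collapse v y = d"
    if "(c, d) \<in> links (fst Y)" for c d
  proof -
    obtain h where h: "h \<in> hedges (fst Y)" "c = bd (fst Y) h" "d = bd (fst Y) (sigma (fst Y) h)"
      using \<open>(c, d) \<in> links (fst Y)\<close> by (auto simp: links_def)
    have "(bd (fst I) (Inr h), bd (fst I) (Inr (sigma (fst Y) h))) \<in> links (fst I)"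
      using linksI[of "Inr h" "fst I"] h(1) by simp
    moreover have "sigma (fst Y) h \<in> hedges (fst Y)" using wf_graphD(4)[OF wfY h(1)] .
    ultimately show ?thesis
      using bd_insert_in_verts h collapse_bd by (meson r_into_rtrancl)
  qed
  have fib: "(Inl a, Inl a') \<in> (links (fst I))\<^sup>*"
    if "a \<in> verts (fst X)" "a' \<in> verts (fst X)" for a a'
    using fibre_reach[OF r_into_rtrancl[OF insert_link_left] that] .
  show "(x, y) \<in> (links (fst I))\<^sup>*"
    by (rule lift_reach[OF fib S[unfolded insert_simps(1)] x[unfolded insert_simps(1)]
          y[unfolded insert_simps(1)] r])
qed

text \<open>A detour around a cut edge of \<open>X\<close> lies in \<open>X\<close>, so it is available after insertion. A detour around a
  cut edge of \<open>Y\<close> lifts, since the inserted graph is untouched and still connected.\<close>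

lemma bridgeless_insert:
  assumes "bridgeless (fst X)" "bridgeless (fst Y)"
  shows "bridgeless (fst I)"
  unfolding bridgeless_def
proof
  fix l assume "l \<in> internals (fst I)"
  then consider h where "h \<in> internals (fst X)" "l = Inl h" | h where "h \<in> internals (fst Y)" "l = Inr h"
    unfolding internals_insert by blast
  then show "(bd (fst I) l, bd (fst I) (sigma (fst I) l)) \<in> (links (cut (fst I) l))\<^sup>*"
  proof cases
    case (1 h)
    have "(Inl x, Inl y) \<in> (links (cut (fst I) l))\<^sup>*" if xy: "(x, y) \<in> links (cut (fst X) h)" for x y
    proof -
      obtain h' where h': "h' \<in> hedges (fst X)" "x = bd (fst X) h'" "y = bd (fst X) (sigma (cut (fst X) h) h')"
        using xy by (auto simp: links_cut)
      show ?thesis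
      proof (cases "h' \<in> internals (fst X)")
        case True
        then have "Inl h' \<in> hedges (cut (fst I) l)" by (simp add: cut_def)
        moreover have "sigma (cut (fst I) l) (Inl h') = Inl (sigma (cut (fst X) h) h')"
          by (simp add: sigma_cut 1)
        moreover have "bd (cut (fst I) l) (Inl z) = Inl (bd (fst X) z)" for z by (simp add: cut_def)
        ultimately have "(Inl x, Inl y) \<in> links (cut (fst I) l)"
          using linksI[of "Inl h'" "cut (fst I) l"] h' by simp
        then show ?thesis by simp
      next
        case False
        then have "x = y" using h' by (auto simp: internals_def sigma_cut)
        then show ?thesis by simp
      qed
    qed
    note step = this
    have "(Inl x, Inl y) \<in> (links (cut (fst I) l))\<^sup>*" if "(x, y) \<in> (links (cut (fst X) h))\<^sup>*" for x y
      using that by (induction rule: rtrancl_induct) (auto intro: rtrancl_trans step)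
    then show ?thesis using assms(1) 1 by (simp add: bridgeless_def)
  next
    case (2 h)
    have h: "h \<in> hedges (fst Y)" using 2 by (simp add: internals_def)
    have bd: "bd (cut (fst I) l) = bd (fst I)" "hedges (cut (fst I) l) = hedges (fst I)"
      by (simp_all add: cut_def)
    have "(Inl (bd (fst X) h'), Inl (bd (fst X) (sigma (fst X) h'))) \<in> links (cut (fst I) l)"
      if "h' \<in> internals (fst X)" for h'
      using linksI[of "Inl h'" "cut (fst I) l"] that by (simp add: bd[unfolded 2] sigma_cut 2)
    then have fib: "(Inl a, Inl a') \<in> (links (cut (fst I) l))\<^sup>*"
      if "a \<in> verts (fst X)" "a' \<in> verts (fst X)" for a a'
      using fibre_reach[OF r_into_rtrancl that] by blast
    have S: "\<exists>x\<in>verts (fst I). \<exists>y\<in>verts (fst I).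
        (x, y) \<in> (links (cut (fst I) l))\<^sup>* \<and> collapse v x = c \<and> collapse v y = d"
      if "(c, d) \<in> links (cut (fst Y) h)" for c d
    proof -
      obtain h' where h': "h' \<in> hedges (fst Y)" "c = bd (fst Y) h'"
          "d = bd (fst Y) (sigma (cut (fst Y) h) h')"
        using \<open>(c, d) \<in> links (cut (fst Y) h)\<close> by (auto simp: links_cut)
      have "sigma (cut (fst I) l) (Inr h') = Inr (sigma (cut (fst Y) h) h')"
        by (simp add: sigma_cut 2)
      then have "(bd (fst I) (Inr h'), bd (fst I) (Inr (sigma (cut (fst Y) h) h'))) \<in> links (cut (fst I) l)"
        using linksI[of "Inr h'" "cut (fst I) l"] h'(1) by (simp add: bd del: insert_simps(4))
      moreover have "sigma (cut (fst Y) h) h' \<in> hedges (fst Y)"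
        using wf_graphD(4)[OF wfY h'(1)] h'(1) by (simp add: sigma_cut)
      ultimately show ?thesis
        using bd_insert_in_verts h' collapse_bd by (meson r_into_rtrancl)
    qed
    have "sigma (fst Y) h \<in> hedges (fst Y)" using wf_graphD(4)[OF wfY h] .
    note V = bd_insert_in_verts[OF h, unfolded insert_simps(1)]
      bd_insert_in_verts[OF this, unfolded insert_simps(1)]
    have r: "(collapse v (bd (fst I) (Inr h)), collapse v (bd (fst I) (Inr (sigma (fst Y) h))))
        \<in> (links (cut (fst Y) h))\<^sup>*"
      unfolding collapse_bd using assms(2) 2(1) by (simp add: bridgeless_def)
    have "(bd (fst I) (Inr h), bd (fst I) (Inr (sigma (fst Y) h))) \<in> (links (cut (fst I) l))\<^sup>*"
      by (rule lift_reach[OF fib S[unfolded insert_simps(1)] V r])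
    then show ?thesis using 2(2) by simp
  qed
qed

private abbreviation "F \<equiv> inserted_component X v (fst Y)"

lemma component_of_insert:
  assumes x: "x \<in> verts (fst I)"
  shows "component_of (fst I) x = F (component_of (fst Y) (collapse v x))"
proof -
  have "z \<in> component_of (fst I) x \<longleftrightarrow>
      z \<in> verts (fst I) \<and> collapse v z \<in> component_of (fst Y) (collapse v x)" for z
    using reach_insert[OF x, of z] collapse_in_verts[of z] unfolding component_of_def by blast
  then show ?thesis by (auto simp: inserted_component_def)
qed

lemma components_insert: "components (fst I) = F ` components (fst Y)"
proof -
  have "components (fst I) = (\<lambda>x. F (component_of (fst Y) (collapse v x))) ` verts (fst I)"
    unfolding components_def using component_of_insert by (rule image_cong[OF refl])
  also have "\<dots> = F ` component_of (fst Y) ` collapse v ` verts (fst I)"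
    by (simp only: image_image)
  finally show ?thesis by (simp only: collapse_verts_insert components_def)
qed

lemma collapse_inserted_component:
  assumes "C \<subseteq> verts (fst Y)"
  shows "collapse v ` F C = C"
proof -
  have "\<exists>z\<in>F C. collapse v z = c" if "c \<in> C" for c
  proof -
    have "c \<in> collapse v ` verts (fst I)" using collapse_verts_insert assms \<open>c \<in> C\<close> by blast
    then obtain z where "z \<in> verts (fst I)" "collapse v z = c" by blast
    then show ?thesis using \<open>c \<in> C\<close> by (auto simp: inserted_component_def)
  qed
  then have "C \<subseteq> collapse v ` F C" by blast
  moreover have "collapse v ` F C \<subseteq> C" by (auto simp: inserted_component_def)
  ultimately show ?thesis by (rule equalityI[rotated])
qed

lemma inserted_component_verts: "F (verts (fst Y)) = verts (fst I)"
  using v by (auto simp: inserted_component_def)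

lemma inj_on_inserted_component: "inj_on F (components (fst Y))"
proof (rule inj_onI)
  fix C D assume "C \<in> components (fst Y)" "D \<in> components (fst Y)" "F C = F D"
  then have "collapse v ` F C = C" "collapse v ` F C = D"
    using collapse_inserted_component[OF components_subset] by blast+
  then show "C = D" by (rule subst)
qed

lemma connected_insert:
  assumes "connected_graph (fst Y)"
  shows "connected_graph (fst I)"
  using components_insert components_connected[OF assms] by (simp add: connected_graph_def)

text \<open>An inserted vertex keeps its internal half-edges, and each external one is replaced by the
  half-edge of \<open>Y\<close> glued to it; undoing the replacement preserves types.\<close>

lemma star_insert_left:
  shows "bij_betw (case_sum id b) (star (fst I) (Inl u)) (star (fst X) u)"
    and "\<And>h. h \<in> star (fst I) (Inl u) \<Longrightarrow> htype (fst X) (case_sum id b h) = htype (fst I) h"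
proof -
  let ?e = "case_sum id b"
  let ?S = "star (fst I) (Inl u)"
  have bb: "bij_betw b (star (fst Y) v) (externals (fst X))" by (rule gluingD(1)[OF b])
  have S: "?S = Inl ` {h \<in> internals (fst X). bd (fst X) h = u} \<union>
      Inr ` {h \<in> star (fst Y) v. bd (fst X) (b h) = u}"
    by (auto simp: star_def split: if_splits)
  have "inj_on ?e ?S"
    unfolding S
  proof (rule inj_on_case_sum)
    show "inj_on b {h \<in> star (fst Y) v. bd (fst X) (b h) = u}"
      using bij_betw_imp_inj_on[OF bb] by (rule inj_on_subset) auto
    show "id ` {h \<in> internals (fst X). bd (fst X) h = u} \<inter>
        b ` {h \<in> star (fst Y) v. bd (fst X) (b h) = u} = {}"
      using bij_betwE[OF bb] externals_internals(2)[of "fst X"] by auto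
  qed simp
  moreover have "?e ` ?S = star (fst X) u"
  proof -
    have "b ` {h \<in> star (fst Y) v. bd (fst X) (b h) = u} = {h \<in> externals (fst X). bd (fst X) h = u}"
      using bij_betw_imp_surj_on[OF bb] by auto
    then show ?thesis
      unfolding S image_Un image_image using externals_internals(1)[of "fst X"]
      by (auto simp: star_def)
  qed
  ultimately show "bij_betw ?e ?S (star (fst X) u)" by (simp add: bij_betw_def)
  show "htype (fst X) (?e h) = htype (fst I) h" if "h \<in> ?S" for h
    using that gluingD(2)[OF b] unfolding S by auto
qed

lemma vertex_type_insert_left:
  "vertex_type (fst I) (Inl u) = vertex_type (fst X) u"
  by (rule sym, rule vertex_type_bij[OF star_insert_left]) simp_all
end

section \<open>Closure under insertion\<close>

context
  fixes X :: "('v, 'h, 'e) sgraph" and v :: 'w and b :: "'l \<Rightarrow> 'h" and Y :: "('w, 'l, 'e) sgraph"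
  assumes wfX: "wf_graph (fst X)" and conX: "connected_graph (fst X)"
    and wfY: "wf_graph (fst Y)" and v: "v \<in> verts (fst Y)" and b: "b \<in> gluings X v Y"
begin

private lemmas I = wfX conX wfY v b

lemma vertex_type_insert_right:
  assumes "w \<noteq> v"
  shows "vertex_type (fst (insert_at X v b Y)) (Inr w) = vertex_type (fst Y) w"
proof (rule vertex_type_bij)
  have "star (fst (insert_at X v b Y)) (Inr w) = Inr ` star (fst Y) w"
    using assms by (auto simp: star_def split: if_splits)
  then show "bij_betw Inr (star (fst Y) w) (star (fst (insert_at X v b Y)) (Inr w))" by (simp add: bij_betw_def)
qed simp_all

text \<open>Components of the insertion are preimages of components, so internal edges of \<open>Y\<close> witness the same
  activity before and after. Only an internal edge of the inserted graph could make a component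
  active that was not, but its component contains \<open>v\<close>, which is active already. Thus the suppression
  of trivial components is compatible with inserting at vertices that are not suppressed.\<close>

lemma active_verts_insert:
  assumes act: "v \<in> active_verts (fst Y)"
  shows "active_verts (fst (insert_at X v b Y)) = Inl ` verts (fst X) \<union> Inr ` (active_verts (fst Y) - {v})"
proof -
  let ?I = "insert_at X v b Y"
  have act_iff: "x \<in> active_verts (fst ?I) \<longleftrightarrow> collapse v x \<in> active_verts (fst Y)"
    if x: "x \<in> verts (fst ?I)" for x
  proof
    note comp = component_of_insert[OF I x]
    assume "x \<in> active_verts (fst ?I)"
    then obtain l where l: "l \<in> internals (fst ?I)" "bd (fst ?I) l \<in> component_of (fst ?I) x"
      by (auto simp: active_verts_def simp del: insert_simps)
    then have c: "collapse v (bd (fst ?I) l) \<in> component_of (fst Y) (collapse v x)"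
      unfolding comp by (simp add: inserted_component_def)
    have x': "collapse v x \<in> verts (fst Y)" using collapse_in_verts[OF I x] .
    from l(1) consider h where "h \<in> internals (fst Y)" "l = Inr h" | h where "l = Inl h"
      unfolding internals_insert by blast
    then show "collapse v x \<in> active_verts (fst Y)"
    proof cases
      case (1 h)
      then have "bd (fst Y) h \<in> component_of (fst Y) (collapse v x)"
        using c by (simp split: if_splits)
      then show ?thesis using 1 x' by (auto simp: active_verts_def)
    next
      case (2 h)
      then have "component_of (fst Y) v = component_of (fst Y) (collapse v x)"
        using c by (intro component_of_eqI[OF wfY x']) simp
      then show ?thesis using act x' by (simp add: active_verts_def)
    qed
  next
    assume "collapse v x \<in> active_verts (fst Y)"
    then obtain h where h: "h \<in> internals (fst Y)" "bd (fst Y) h \<in> component_of (fst Y) (collapse v x)"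
      by (auto simp: active_verts_def)
    have "h \<in> hedges (fst Y)" using h(1) by (simp add: internals_def)
    then have "bd (fst ?I) (Inr h) \<in> component_of (fst ?I) x"
      using bd_insert_in_verts[OF I] h(2)
      unfolding component_of_insert[OF I x] inserted_component_def insert_simps(1)[symmetric, where b = b]
        mem_Collect_eq collapse_bd[OF I] by simp
    moreover have "Inr h \<in> internals (fst ?I)" using h(1) by (simp add: internals_insert)
    ultimately show "x \<in> active_verts (fst ?I)"
      using x unfolding active_verts_def by blast
  qed
  have "x \<in> active_verts (fst ?I) \<longleftrightarrow> x \<in> Inl ` verts (fst X) \<union> Inr ` (active_verts (fst Y) - {v})" for x
  proof (cases "x \<in> verts (fst ?I)")
    case True
    then show ?thesis using act by (cases x) (auto simp: act_iff)
  next
    case False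
    then show ?thesis by (auto simp: active_verts_def)
  qed
  then show ?thesis by blast
qed

text \<open>Inserting \<open>X\<close> into both entries of a pair does not change the contraction: the internal edges of \<open>X\<close>
  belong to the subgraph and are shrunk again, the components of the subgraph correspond to their
  preimages, and the specifications are pulled back.\<close>

lemma contract_insert:
  fixes g :: "('w, 'l, 'e) sgraph"
  assumes c: "covering_subgraph (fst g) (fst Y)"
  shows "sgraph_iso (inserted_component X v (fst g)) Inr (contract Y g)
    (contract (insert_at X v b Y) (insert_at X v b g))"
proof -
  note D = coveringD[OF c]
  have vg: "v \<in> verts (fst g)" using v D(3) by simp
  have bg: "b \<in> gluings X v g" using b by (simp add: gluings_covering[OF c])
  note g = wfX conX D(1) vg bg
  let ?F = "inserted_component X v (fst g)" and ?J = "insert_at X v b g"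
  have ext: "h \<in> hedges (fst g)" if "h \<in> externals (fst g)" for h
    using that by (simp add: externals_def)
  have "component_of (fst ?J) (bd (fst ?J) (Inr h)) = ?F (component_of (fst g) (bd (fst g) h))"
    if "h \<in> hedges (fst g)" for h
    using component_of_insert[OF g bd_insert_in_verts[OF g that]] unfolding collapse_bd[OF g] .
  note comp = this
  have col: "collapse v ` ?F C = C" if "C \<in> components (fst g)" for C
    using collapse_inserted_component[OF g components_subset[OF that]] .
  have "graph_iso ?F Inr (fst (contract Y g)) (fst (contract (insert_at X v b Y) ?J))"
    unfolding graph_iso_def contract_simps bij_betw_def components_insert[OF g] externals_insert
      insert_simps(11)
    using inj_on_inserted_component[OF g] ext comp col by (simp del: insert_simps(4))
  moreover have "snd (contract (insert_at X v b Y) ?J) (?F ` D) = snd (contract Y g) D"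
    if "D \<in> components (fst (contract Y g))" for D
  proof -
    have "C \<in> components (fst g)" if "C \<in> D" for C
      using components_subset[OF \<open>D \<in> _\<close>] that by auto
    then have "collapse v ` \<Union> (?F ` D) = \<Union> D"
      using col by (auto simp: image_Union image_image)
    then show ?thesis by simp
  qed
  ultimately show ?thesis by (simp add: sgraph_iso_iff)
qed

lemma residue_vertex_type_insert:
  assumes "C \<in> components (fst Y)"
  shows "vertex_type (fst (residue (insert_at X v b Y))) (inserted_component X v (fst Y) C) =
    vertex_type (fst (residue Y)) C"
  using contract_insert[OF covering_refl[OF wfY]] assms unfolding residue_def
  by (intro graph_iso_vertex_type wf_contract covering_refl wfY) (auto simp: sgraph_iso_iff)

text \<open>An insertion leaves the external edges and the specification of the surrounding graph as they are.
  This is why \<open>insert_at X v b Y\<close> may be inserted exactly where \<open>Y\<close> may.\<close>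

lemma residue_type_insert:
  assumes "connected_graph (fst Y)"
  shows "residue_type (insert_at X v b Y) = residue_type Y"
  using residue_vertex_type_insert[of "verts (fst Y)"] components_connected[OF assms]
    inserted_component_verts[OF I] by (simp add: residue_type_def)

lemma specified_insert:
  assumes X: "specified_graph T X" and Y: "specified_graph T Y"
  shows "specified_graph T (insert_at X v b Y)"
proof -
  let ?I = "insert_at X v b Y"
  have "bridgeless (fst ?I)"
    using X Y by (intro bridgeless_insert[OF I]) (simp_all add: specified_graph_iff)
  moreover have "htype (fst ?I) l \<in> half_edge_types T" if "l \<in> hedges (fst ?I)" for l
    using that X Y by (auto simp: specified_graph_iff internals_def)
  moreover have "vertex_type (fst ?I) x \<in> vertex_types T" if "x \<in> verts (fst ?I)" for x
  proof (cases x)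
    case (Inl u)
    then show ?thesis using that X vertex_type_insert_left[OF I, of u]
      by (auto simp: specified_graph_iff)
  next
    case (Inr w)
    then have "w \<in> verts (fst Y)" "w \<noteq> v" using that by auto
    then show ?thesis using Inr Y by (simp add: vertex_type_insert_right specified_graph_iff)
  qed
  moreover have "vertex_type (fst (residue ?I)) C \<in> vertex_types T" if "C \<in> components (fst ?I)" for C
    using that Y residue_vertex_type_insert unfolding components_insert[OF I]
    by (auto simp: specified_graph_iff)
  ultimately show ?thesis using wf_insert[OF I] by (simp add: specified_graph_iff del: insert_simps)
qed

lemma connected_specified_insert:
  assumes X: "specified_graph T X" and Y: "connected_specified_graph T Y"
  shows "connected_specified_graph T (insert_at X v b Y)"
  using specified_insert[OF X] connected_insert[OF I] Y
  by (simp add: connected_specified_graph_def)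

lemma covering_insert:
  fixes g :: "('w, 'l, 'e) sgraph"
  assumes c: "covering_subgraph (fst g) (fst Y)"
  shows "covering_subgraph (fst (insert_at X v b g)) (fst (insert_at X v b Y))"
proof -
  let ?I = "insert_at X v b Y"
  note D = coveringD[OF c]
  have vg: "v \<in> verts (fst g)" using v D(3) by simp
  have bg: "b \<in> gluings X v g" using b by (simp add: gluings_covering[OF c])
  have "bd (fst (insert_at X v b g)) l = bd (fst ?I) l \<and>
    htype (fst (insert_at X v b g)) l = htype (fst ?I) l \<and>
    sigma (fst (insert_at X v b g)) l \<in> {l, sigma (fst ?I) l}" if "l \<in> hedges (fst ?I)" for l
    using that D(6-8) by (cases l) auto
  moreover have "vindex (fst (insert_at X v b g)) x = vindex (fst ?I) x" if "x \<in> verts (fst ?I)" for x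
    using that D(5) by (cases x) auto
  moreover have "verts (fst (insert_at X v b g)) = verts (fst ?I)"
    "hedges (fst (insert_at X v b g)) = hedges (fst ?I)" using D(3,4) by simp_all
  ultimately show ?thesis
    using wf_insert[OF wfX conX D(1) vg bg] wf_insert[OF I]
    unfolding covering_subgraph_def by blast
qed

end

definition insert_pair ::
  "('v, 'h, 'e) sgraph \<Rightarrow> 'w \<Rightarrow> ('l \<Rightarrow> 'h) \<Rightarrow> ('w, 'l, 'e) sgraph \<times> ('w, 'l, 'e) sgraph \<Rightarrow>
    ('v + 'w, 'h + 'l, 'e) sgraph \<times> ('v + 'w, 'h + 'l, 'e) sgraph" where
  "insert_pair X v b p = (insert_at X v b (fst p), insert_at X v b (snd p))"

lemma insert_pair_simps [simp]:
  "fst (insert_pair X v b p) = insert_at X v b (fst p)"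
  "snd (insert_pair X v b p) = insert_at X v b (snd p)"
  by (simp_all add: insert_pair_def)

text \<open>The contraction is the old one up to isomorphism. A component common to both graphs after the
  insertion, with the same edges in both, is the preimage of such a component before it, where the
  two specifications agree.\<close>

lemma specified_pair_insert:
  assumes X: "connected_specified_graph T X" and p: "specified_pair T p"
    and v: "v \<in> verts (fst (fst p))" and b: "b \<in> gluings X v (fst p)"
  shows "specified_pair T (insert_pair X v b p)"
proof -
  define Y g where "Y = fst p" and "g = snd p"
  let ?I = "insert_at X v b Y" and ?J = "insert_at X v b g"
  have p': "connected_specified_graph T Y" "specified_covering_subgraph T g Y"
    "connected_specified_graph T (contract Y g)"
    using p by (simp_all add: specified_pair_def Y_def g_def)
  have c: "covering_subgraph (fst g) (fst Y)" using p' by (simp add: specified_covering_subgraph_iff)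
  note D = coveringD[OF c]
  have vg: "v \<in> verts (fst g)" using v D(3) by (simp add: Y_def)
  have bg: "b \<in> gluings X v g" using b by (simp add: gluings_covering[OF c] Y_def)
  have X': "wf_graph (fst X)" "connected_graph (fst X)" "specified_graph T X"
    using X by (simp_all add: connected_specified_graph_def specified_graph_iff)
  note I = X'(1,2) D(2) v[folded Y_def] b[folded Y_def] and J = X'(1,2) D(1) vg bg
  have "snd ?J C' = snd ?I C'"
    if C': "C' \<in> components (fst ?J)" "C' \<in> components (fst ?I)"
      and eq: "\<And>l. l \<in> hedges (fst ?I) \<Longrightarrow> bd (fst ?I) l \<in> C' \<Longrightarrow> sigma (fst ?J) l = sigma (fst ?I) l"
    for C'
  proof -
    obtain C where C: "C \<in> components (fst g)" "C' = inserted_component X v (fst g) C"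
      using C'(1) unfolding components_insert[OF J] by blast
    obtain B where B: "B \<in> components (fst Y)" "C' = inserted_component X v (fst Y) B"
      using C'(2) unfolding components_insert[OF I] by blast
    \<comment> \<open>Both components are recovered from their common preimage, so they coincide.\<close>
    have col: "collapse v ` C' = C" "collapse v ` C' = B"
      unfolding C(2) by (rule collapse_inserted_component[OF J components_subset[OF C(1)]])
        (unfold C(2)[symmetric] B(2), rule collapse_inserted_component[OF I components_subset[OF B(1)]])
    have "sigma (fst g) h = sigma (fst Y) h" if h: "h \<in> hedges (fst Y)" "bd (fst Y) h \<in> B" for h
    proof -
      have "bd (fst ?I) (Inr h) \<in> C'"
        using bd_insert_in_verts[OF I h(1)] collapse_bd[OF I, of h] h(2)
        unfolding B(2) inserted_component_def insert_simps(1) mem_Collect_eq by metis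
      then have "sigma (fst ?J) (Inr h) = sigma (fst ?I) (Inr h)"
        using eq[of "Inr h"] h(1) by (simp del: insert_simps(4))
      then show ?thesis by simp
    qed
    then have "snd g B = snd Y B"
      using p'(2) C(1) B(1) col by (auto simp: specified_covering_subgraph_iff)
    then show ?thesis using col by simp
  qed
  moreover have "connected_specified_graph T (contract ?I ?J)"
    using connected_specified_graph_iso[OF contract_insert[OF I c] p'(3)] .
  moreover have "connected_specified_graph T ?I" "specified_graph T ?J"
    using connected_specified_insert[OF I X'(3) p'(1)] specified_insert[OF J X'(3)] p'(2)
    by (simp_all add: specified_covering_subgraph_iff)
  ultimately show ?thesis
    using covering_insert[OF I c]
    unfolding specified_pair_def specified_covering_subgraph_iff insert_pair_simps
      Y_def[symmetric] g_def[symmetric] connected_specified_graph_def by blast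
qed

lemma bij_betw_map_sum:
  assumes "bij_betw f A A'" "bij_betw g B B'"
  shows "bij_betw (map_sum f g) (Inl ` A \<union> Inr ` B) (Inl ` A' \<union> Inr ` B')"
proof -
  have "inj_on (map_sum f g) (Inl ` A \<union> Inr ` B)"
  proof (rule inj_onI)
    fix x y assume "x \<in> Inl ` A \<union> Inr ` B" "y \<in> Inl ` A \<union> Inr ` B" "map_sum f g x = map_sum f g y"
    then show "x = y"
      using assms by (cases x; cases y) (auto simp: bij_betw_def dest: inj_onD)
  qed
  moreover have "map_sum f g ` (Inl ` A \<union> Inr ` B) = Inl ` f ` A \<union> Inr ` g ` B"
    by (simp add: image_Un image_image)
  ultimately show ?thesis using assms by (simp add: bij_betw_def)
qed

text \<open>The components of an insertion are preimages, so the specification of \<open>Y'\<close> is only evaluated at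
  images of components of \<open>Y\<close>, where it is determined by that of \<open>Y\<close>.\<close>

lemma insert_iso:
  assumes I: "wf_graph (fst X)" "connected_graph (fst X)" "wf_graph (fst Y)" "v \<in> verts (fst Y)"
      "b \<in> gluings X v Y"
    and isoX: "sgraph_iso f1 k1 X X'" and isoY: "sgraph_iso f2 k2 Y Y'"
    and b': "\<And>h. h \<in> star (fst Y) v \<Longrightarrow> b' (k2 h) = k1 (b h)"
  shows "sgraph_iso (map_sum f1 f2) (map_sum k1 k2) (insert_at X v b Y) (insert_at X' (f2 v) b' Y')"
proof -
  let ?I = "insert_at X v b Y" and ?I' = "insert_at X' (f2 v) b' Y'"
  have gX: "graph_iso f1 k1 (fst X) (fst X')" and gY: "graph_iso f2 k2 (fst Y) (fst Y')"
    using isoX isoY by (simp_all add: sgraph_iso_iff)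
  note DX = graph_isoD[OF gX] and DY = graph_isoD[OF gY]
  have "bij_betw (map_sum f1 f2) (verts (fst ?I)) (verts (fst ?I'))"
    unfolding insert_simps
  proof (rule bij_betw_map_sum)
    show "bij_betw f2 (verts (fst Y) - {v}) (verts (fst Y') - {f2 v})"
      using bij_betw_DiffI[OF DY(1), of "{v}" "{f2 v}"] I(4) DY(7) by simp
  qed (rule DX(1))
  moreover have "bij_betw (map_sum k1 k2) (hedges (fst ?I)) (hedges (fst ?I'))"
    unfolding insert_simps
  proof (rule bij_betw_map_sum)
    have "inj_on k1 (internals (fst X))"
      using DX(10) by (rule inj_on_subset) (auto simp: internals_def)
    then show "bij_betw k1 (internals (fst X)) (internals (fst X'))"
      by (simp add: bij_betw_def graph_iso_internals[OF gX I(1)])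
  qed (rule DY(2))
  moreover have "bd (fst ?I') (map_sum k1 k2 l) = map_sum f1 f2 (bd (fst ?I) l) \<and>
      sigma (fst ?I') (map_sum k1 k2 l) = map_sum k1 k2 (sigma (fst ?I) l) \<and>
      htype (fst ?I') (map_sum k1 k2 l) = htype (fst ?I) l" if l: "l \<in> hedges (fst ?I)" for l
  proof (cases l)
    case (Inl h)
    then have "h \<in> hedges (fst X)" using l by (auto simp: internals_def)
    then show ?thesis using Inl DX by simp
  next
    case (Inr h)
    then have h: "h \<in> hedges (fst Y)" using l by auto
    \<comment> \<open>The half-edges to be reattached correspond, as \<open>f2\<close> is injective on vertices.\<close>
    have eq: "f2 (bd (fst Y) h) = f2 v \<longleftrightarrow> bd (fst Y) h = v"
      using inj_onD[OF DY(9)] wf_graphD(3)[OF I(3) h] I(4) by metis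
    have "bd (fst X') (b' (k2 h)) = f1 (bd (fst X) (b h))" if v: "bd (fst Y) h = v"
    proof -
      have "b h \<in> hedges (fst X)" using gluingD(3)[OF I(5) h v] by (simp add: externals_def)
      then show ?thesis using b'[of h] h v DX(3) by (simp add: star_def)
    qed
    then show ?thesis using Inr h DY eq by simp
  qed
  moreover have "vindex (fst ?I') (map_sum f1 f2 x) = vindex (fst ?I) x" if "x \<in> verts (fst ?I)" for x
    using that DX(6) DY(6) by (cases x) auto
  moreover have "snd ?I' (map_sum f1 f2 ` C') = snd ?I C'" if C': "C' \<in> components (fst ?I)" for C'
  proof -
    obtain C where C: "C \<in> components (fst Y)" "C' = inserted_component X v (fst Y) C"
      using C' unfolding components_insert[OF I] by blast
    have col: "collapse v ` C' = C"
      unfolding C(2) by (rule collapse_inserted_component[OF I components_subset[OF C(1)]])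
    have "collapse (f2 v) (map_sum f1 f2 x) = f2 (collapse v x)" for x by (cases x) simp_all
    then have "collapse (f2 v) ` map_sum f1 f2 ` C' = f2 ` collapse v ` C'"
      by (simp only: image_image)
    then show ?thesis using isoY C(1) col by (simp add: sgraph_iso_iff)
  qed
  ultimately show ?thesis by (simp only: sgraph_iso_iff graph_iso_def) blast
qed

section \<open>Iterated insertions\<close>

definition sum_assoc :: "'a + ('b + 'c) \<Rightarrow> ('a + 'b) + 'c" where
  "sum_assoc = case_sum (Inl \<circ> Inl) (case_sum (Inl \<circ> Inr) Inr)"

definition sum_swap :: "'a + ('b + 'c) \<Rightarrow> 'b + ('a + 'c)" where
  "sum_swap = case_sum (Inr \<circ> Inl) (case_sum Inl (Inr \<circ> Inr))"

lemma sum_assoc_simps [simp]: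
  "sum_assoc (Inl a) = Inl (Inl a)" "sum_assoc (Inr (Inl b)) = Inl (Inr b)"
  "sum_assoc (Inr (Inr c)) = Inr c"
  by (simp_all add: sum_assoc_def)

lemma sum_swap_simps [simp]:
  "sum_swap (Inl a) = Inr (Inl a)" "sum_swap (Inr (Inl b)) = Inl b"
  "sum_swap (Inr (Inr c)) = Inr (Inr c)"
  by (simp_all add: sum_swap_def)

lemma inj_sum_assoc: "inj_on sum_assoc S"
  by (rule inj_onI) (auto simp: sum_assoc_def split: sum.splits)

lemma inj_sum_swap: "inj_on sum_swap S"
  by (rule inj_onI) (auto simp: sum_swap_def split: sum.splits)

lemma sum_Diff_single:
  "Inl ` P \<union> Inr ` W - {Inl u} = Inl ` (P - {u}) \<union> Inr ` W"
  "Inl ` P \<union> Inr ` W - {Inr w} = Inl ` P \<union> Inr ` (W - {w})"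
  by auto

text \<open>Inserting \<open>A\<close> at a vertex of \<open>B\<close> and the result into \<open>Y\<close>, or \<open>B\<close> into \<open>Y\<close> and then \<open>A\<close> at the
  vertex that came from \<open>B\<close>, gives the same graph if the gluings match: a half-edge of \<open>Y\<close> at \<open>v\<close>
  takes over the half-edge of \<open>B\<close> glued to it.\<close>

lemma insert_assoc_iso:
  assumes 1: "\<And>h. h \<in> internals (fst B) \<Longrightarrow> bd (fst B) h = u \<Longrightarrow> a (Inl h) = a' h"
    and 2: "\<And>h. h \<in> hedges (fst Y) \<Longrightarrow> bd (fst Y) h = v \<Longrightarrow> bd (fst B) (b h) = u \<Longrightarrow> a (Inr h) = a' (b h)"
    and 3: "\<And>h. h \<in> hedges (fst Y) \<Longrightarrow> bd (fst Y) h = v \<Longrightarrow> b' h = Inr (b h)"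
  shows "sgraph_iso sum_assoc sum_assoc
    (insert_at A (Inl u) a (insert_at B v b Y)) (insert_at (insert_at A u a' B) v b' Y)"
proof -
  let ?L = "insert_at A (Inl u) a (insert_at B v b Y)" and ?R = "insert_at (insert_at A u a' B) v b' Y"
  have "sum_assoc ` verts (fst ?L) = verts (fst ?R)"
    by (simp add: sum_Diff_single image_Un image_image Un_assoc)
  moreover have "sum_assoc ` hedges (fst ?L) = hedges (fst ?R)"
    by (simp add: internals_insert image_Un image_image Un_assoc)
  moreover have "bd (fst ?R) (sum_assoc l) = sum_assoc (bd (fst ?L) l) \<and>
      sigma (fst ?R) (sum_assoc l) = sum_assoc (sigma (fst ?L) l) \<and>
      htype (fst ?R) (sum_assoc l) = htype (fst ?L) l" if "l \<in> hedges (fst ?L)" for l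
    using that 1 2 3 by auto
  moreover have "vindex (fst ?R) (sum_assoc x) = vindex (fst ?L) x" if "x \<in> verts (fst ?L)" for x
    using that by auto
  moreover have "snd ?R (sum_assoc ` C) = snd ?L C" for C
  proof -
    have "collapse v (sum_assoc x) = collapse v (collapse (Inl u) x)" if "x \<in> C" for x
      by (auto simp: sum_assoc_def collapse_def split: sum.splits)
    then show ?thesis by (simp add: image_image cong: image_cong)
  qed
  ultimately show ?thesis
    by (simp only: sgraph_iso_iff graph_iso_def bij_betw_def inj_sum_assoc) blast
qed

text \<open>Insertions at two different vertices of \<open>Y\<close> only rewire the half-edges at
  their own vertex.\<close>

lemma insert_swap_iso:
  assumes "v \<noteq> w"
    and 1: "\<And>h. h \<in> hedges (fst Y) \<Longrightarrow> bd (fst Y) h = w \<Longrightarrow> a (Inr h) = a' h"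
    and 2: "\<And>h. h \<in> hedges (fst Y) \<Longrightarrow> bd (fst Y) h = v \<Longrightarrow> b' (Inr h) = b h"
  shows "sgraph_iso sum_swap sum_swap
    (insert_at A (Inr w) a (insert_at B v b Y)) (insert_at B (Inr v) b' (insert_at A w a' Y))"
proof -
  let ?L = "insert_at A (Inr w) a (insert_at B v b Y)"
    and ?R = "insert_at B (Inr v) b' (insert_at A w a' Y)"
  have "sum_swap ` verts (fst ?L) = verts (fst ?R)"
    by (simp add: sum_Diff_single image_Un image_image Un_ac Diff_insert2[symmetric] insert_commute)
  moreover have "sum_swap ` hedges (fst ?L) = hedges (fst ?R)"
    by (simp add: image_Un image_image Un_ac)
  moreover have "bd (fst ?R) (sum_swap l) = sum_swap (bd (fst ?L) l) \<and>
      sigma (fst ?R) (sum_swap l) = sum_swap (sigma (fst ?L) l) \<and>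
      htype (fst ?R) (sum_swap l) = htype (fst ?L) l" if "l \<in> hedges (fst ?L)" for l
    using that 1 2 \<open>v \<noteq> w\<close> by auto
  moreover have "vindex (fst ?R) (sum_swap x) = vindex (fst ?L) x" if "x \<in> verts (fst ?L)" for x
    using that by auto
  moreover have "snd ?R (sum_swap ` C) = snd ?L C" for C
  proof -
    have "collapse w (collapse (Inr v) (sum_swap x)) = collapse v (collapse (Inr w) x)" if "x \<in> C" for x
      by (auto simp: sum_swap_def collapse_def split: sum.splits)
    then show ?thesis by (simp add: image_image cong: image_cong)
  qed
  ultimately show ?thesis
    by (simp only: sgraph_iso_iff graph_iso_def bij_betw_def inj_sum_swap) blast
qed

section \<open>Sums over insertions\<close>

text \<open>The common form of the three operations: the insertion of \<open>X\<close> at all vertices in \<open>U\<close> of matching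
  type. The weight \<open>\<phi>\<close> is either the basis vector of the pair or that of one of its entries, and \<open>U\<close> is
  either the set of all vertices or that of the active ones.\<close>

definition insertion_sum ::
  "('e pair_class \<Rightarrow> 'm::comm_monoid_add) \<Rightarrow> ('v, 'h, 'e) sgraph \<Rightarrow> 'w set \<Rightarrow>
    ('w, 'l, 'e) sgraph \<times> ('w, 'l, 'e) sgraph \<Rightarrow> 'm" where
  "insertion_sum \<phi> X U p =
     (\<Sum>v\<in>{v \<in> U. vertex_type (fst (fst p)) v = residue_type X}.
        \<Sum>b\<in>gluings X v (fst p). \<phi> (pair_class (insert_pair X v b p)))"

lemma covering_insert_pair:
  assumes "wf_graph (fst X)" "connected_graph (fst X)" "covering_pair p" "v \<in> verts (fst (fst p))"
    "b \<in> gluings X v (fst p)"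
  shows "covering_pair (insert_pair X v b p)"
  using covering_insert[OF assms(1,2) coveringD(2)[OF assms(3)] assms(4,5,3)] by simp

lemma insert_pair_iso:
  assumes X: "wf_graph (fst X)" "connected_graph (fst X)" and p: "covering_pair p"
    and v: "v \<in> verts (fst (fst p))" and b: "b \<in> gluings X v (fst p)"
    and iso: "sgraph_iso f1 k1 X X'" "pair_iso f2 k2 p p'"
    and b': "\<And>h. h \<in> star (fst (fst p)) v \<Longrightarrow> b' (k2 h) = k1 (b h)"
  shows "pair_iso (map_sum f1 f2) (map_sum k1 k2) (insert_pair X v b p) (insert_pair X' (f2 v) b' p')"
proof -
  note D = coveringD[OF p]
  have "star (fst (snd p)) v = star (fst (fst p)) v" using D by (auto simp: star_def)
  then show ?thesis
    using insert_iso[OF X D(2) v b iso(1), of f2 k2 "fst p'" b']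
      insert_iso[OF X D(1) _ _ iso(1), of v b f2 k2 "snd p'" b']
      iso(2) b' v b D(3) gluings_covering[OF p, of X v] by (simp add: pair_iso_def)
qed

text \<open>The operations are defined on classes through representatives; this lemma makes the choice of the
  representatives immaterial.\<close>

lemma insertion_sum_iso:
  assumes X: "wf_graph (fst X)" "connected_graph (fst X)" and p: "covering_pair p"
    and iso: "sgraph_iso f1 k1 X X'" "pair_iso f2 k2 p p'"
    and U: "U \<subseteq> verts (fst (fst p))"
  shows "insertion_sum \<phi> X' (f2 ` U) p' = insertion_sum \<phi> X U p"
proof -
  have gX: "graph_iso f1 k1 (fst X) (fst X')" using iso(1) by (simp add: sgraph_iso_iff)
  have gY: "graph_iso f2 k2 (fst (fst p)) (fst (fst p'))"
    using iso(2) by (simp add: pair_iso_def sgraph_iso_iff)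
  note DX = graph_isoD[OF gX] and DY = graph_isoD[OF gY] and wfY = coveringD(2)[OF p]
  have types: "vertex_type (fst (fst p')) (f2 v) = residue_type X' \<longleftrightarrow>
      vertex_type (fst (fst p)) v = residue_type X" if "v \<in> U" for v
    using graph_iso_vertex_type[OF gY wfY, of v] sgraph_iso_residue_type[OF iso(1) X] that U by auto
  let ?S = "{v \<in> U. vertex_type (fst (fst p)) v = residue_type X}"
  have "{v \<in> f2 ` U. vertex_type (fst (fst p')) v = residue_type X'} = f2 ` ?S"
    using types by auto
  moreover have "inj_on f2 ?S" using DY(9) by (rule inj_on_subset) (use U in auto)
  moreover have "(\<Sum>b'\<in>gluings X' (f2 v) (fst p'). \<phi> (pair_class (insert_pair X' (f2 v) b' p'))) =
      (\<Sum>b\<in>gluings X v (fst p). \<phi> (pair_class (insert_pair X v b p)))" if "v \<in> ?S" for v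
  proof -
    have v: "v \<in> verts (fst (fst p))" using that U by auto
    let ?s = "star (fst (fst p)) v" and ?s' = "star (fst (fst p')) (f2 v)"
    have k2: "bij_betw k2 ?s ?s'"
      unfolding graph_iso_star[OF gY wfY v] bij_betw_def
      using inj_on_subset[OF DY(10), of ?s] by (auto simp: star_def)
    define e where "e = inv_into ?s k2"
    have e: "bij_betw e ?s' ?s" "\<And>h. h \<in> ?s \<Longrightarrow> e (k2 h) = h"
      using k2 unfolding e_def by (auto simp: bij_betw_inv_into bij_betw_inv_into_left)
    have et: "htype (fst (fst p)) (e h') = htype (fst (fst p')) h'" if h': "h' \<in> ?s'" for h'
    proof -
      obtain h where "h \<in> ?s" "h' = k2 h" using bij_betw_imp_surj_on[OF k2] h' by blast
      then show ?thesis using e(2) DY(5) by (simp add: star_def)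
    qed
    have k1: "bij_betw k1 (externals (fst X)) (externals (fst X'))"
      unfolding graph_iso_externals[OF gX X(1)] bij_betw_def
      using inj_on_subset[OF DX(10), of "externals (fst X)"] by (auto simp: externals_def)
    have "bij_betw (\<lambda>b. restrict (k1 \<circ> b \<circ> e) ?s') (gluings X v (fst p)) (gluings X' (f2 v) (fst p'))"
      unfolding gluings_eq
      by (rule bij_betw_typed_bijections, fact e(1), fact et, fact k1)
        (use DX(5) in \<open>auto simp: externals_def\<close>)
    then have "(\<Sum>b'\<in>gluings X' (f2 v) (fst p'). \<phi> (pair_class (insert_pair X' (f2 v) b' p'))) =
      (\<Sum>b\<in>gluings X v (fst p). \<phi> (pair_class (insert_pair X' (f2 v) (restrict (k1 \<circ> b \<circ> e) ?s') p')))"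
      by (rule sum.reindex_bij_betw[symmetric])
    also have "\<dots> = (\<Sum>b\<in>gluings X v (fst p). \<phi> (pair_class (insert_pair X v b p)))"
    proof (rule sum.cong[OF refl])
      fix b assume b: "b \<in> gluings X v (fst p)"
      have "restrict (k1 \<circ> b \<circ> e) ?s' (k2 h) = k1 (b h)" if "h \<in> ?s" for h
        using bij_betwE[OF k2] that e(2) by simp
      from insert_pair_iso[OF X p v b iso this]
      show "\<phi> (pair_class (insert_pair X' (f2 v) (restrict (k1 \<circ> b \<circ> e) ?s') p')) =
          \<phi> (pair_class (insert_pair X v b p))"
        using pair_class_eqI covering_insert_pair[OF X p v b] by metis
    qed
    finally show ?thesis .
  qed
  ultimately show ?thesis unfolding insertion_sum_def by (simp add: sum.reindex)
qed

lemma sum_swap4: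
  "(\<Sum>v\<in>V. \<Sum>b\<in>G v. \<Sum>u\<in>W. \<Sum>a\<in>H u. K v b u a) =
   (\<Sum>u\<in>W. \<Sum>a\<in>H u. \<Sum>v\<in>V. \<Sum>b\<in>G v. K v b u a)"
proof -
  have "(\<Sum>b\<in>G v. \<Sum>u\<in>W. \<Sum>a\<in>H u. K v b u a) = (\<Sum>u\<in>W. \<Sum>a\<in>H u. \<Sum>b\<in>G v. K v b u a)" for v
    by (subst sum.swap) (rule sum.cong[OF refl], rule sum.swap)
  then have "(\<Sum>v\<in>V. \<Sum>b\<in>G v. \<Sum>u\<in>W. \<Sum>a\<in>H u. K v b u a) =
      (\<Sum>v\<in>V. \<Sum>u\<in>W. \<Sum>a\<in>H u. \<Sum>b\<in>G v. K v b u a)" by simp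
  also have "\<dots> = (\<Sum>u\<in>W. \<Sum>a\<in>H u. \<Sum>v\<in>V. \<Sum>b\<in>G v. K v b u a)"
    by (subst sum.swap) (rule sum.cong[OF refl], rule sum.swap)
  finally show ?thesis .
qed

text \<open>A gluing at a vertex \<open>w\<close> of \<open>Y\<close>, read as a gluing at \<open>w\<close> after another graph has been inserted at a
  different vertex of \<open>Y\<close>.\<close>

definition lift_gluing :: "('w, 'l, 'e) sgraph \<Rightarrow> 'w \<Rightarrow> ('l \<Rightarrow> 'g) \<Rightarrow> 'h + 'l \<Rightarrow> 'g" where
  "lift_gluing Y w a = restrict (a \<circ> projr) (Inr ` star (fst Y) w)"

lemma lift_gluing_Inr: "h \<in> star (fst Y) w \<Longrightarrow> lift_gluing Y w a (Inr h) = a h"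
  by (simp add: lift_gluing_def)

text \<open>The insertions of \<open>A\<close> and \<open>B\<close> at two distinct vertices. The condition \<open>w \<noteq> v\<close> is part of the summand
  instead of the index set, so that the sums over \<open>v\<close> and \<open>w\<close> have independent ranges and can be
  interchanged.\<close>

definition disjoint_insertion_sum ::
  "('e pair_class \<Rightarrow> 'm::comm_monoid_add) \<Rightarrow> ('v, 'h, 'e) sgraph \<Rightarrow> ('u, 'g, 'e) sgraph \<Rightarrow> 'w set \<Rightarrow>
    ('w, 'l, 'e) sgraph \<times> ('w, 'l, 'e) sgraph \<Rightarrow> 'm" where
  "disjoint_insertion_sum \<phi> A B U p =
     (\<Sum>v\<in>{v \<in> U. vertex_type (fst (fst p)) v = residue_type B}. \<Sum>b\<in>gluings B v (fst p).
      \<Sum>w\<in>{w \<in> U. vertex_type (fst (fst p)) w = residue_type A}. \<Sum>a\<in>gluings A w (fst p).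
        if w \<noteq> v
        then \<phi> (pair_class (insert_pair A (Inr w) (lift_gluing (fst p) w a) (insert_pair B v b p)))
        else 0)"

context
  fixes A :: "('v, 'h, 'e) sgraph" and B :: "('u, 'g, 'e) sgraph"
    and p :: "('w, 'l, 'e) sgraph \<times> ('w, 'l, 'e) sgraph"
  assumes wfA: "wf_graph (fst A)" and conA: "connected_graph (fst A)"
    and wfB: "wf_graph (fst B)" and conB: "connected_graph (fst B)"
    and p: "covering_pair p"
begin

private lemmas wfY = coveringD(2)[OF p]

lemma star_insert_right:
  assumes "w \<noteq> v"
  shows "star (fst (insert_at B v b Y)) (Inr w) = Inr ` star (fst Y) w"
  using assms by (auto simp: star_def split: if_splits)

lemma bij_betw_lift_gluing:
  assumes "w \<noteq> v"
  shows "bij_betw (lift_gluing (fst p) w) (gluings A w (fst p))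
    (gluings A (Inr w) (insert_at B v b (fst p)))"
proof -
  have "bij_betw projr (Inr ` star (fst (fst p)) w :: ('g + 'l) set) (star (fst (fst p)) w)"
    by (auto simp: bij_betw_def inj_on_def image_image)
  then have "bij_betw (\<lambda>a. restrict (id \<circ> a \<circ> projr) (Inr ` star (fst (fst p)) w))
      (gluings A w (fst p)) (gluings A (Inr w) (insert_at B v b (fst p)))"
    unfolding gluings_eq star_insert_right[OF assms]
    by (rule bij_betw_typed_bijections) auto
  then show ?thesis by (simp add: lift_gluing_def[abs_def])
qed

lemma nested_insert_swap:
  assumes v: "v \<in> verts (fst (fst p))" and w: "w \<in> verts (fst (fst p))" and "w \<noteq> v"
    and b: "b \<in> gluings B v (fst p)" and a: "a \<in> gluings A w (fst p)"
  shows "pair_class (insert_pair A (Inr w) (lift_gluing (fst p) w a) (insert_pair B v b p)) =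
    pair_class (insert_pair B (Inr v) (lift_gluing (fst p) v b) (insert_pair A w a p))"
proof (rule pair_class_eqI)
  show "pair_iso sum_swap sum_swap
      (insert_pair A (Inr w) (lift_gluing (fst p) w a) (insert_pair B v b p))
      (insert_pair B (Inr v) (lift_gluing (fst p) v b) (insert_pair A w a p))"
    unfolding pair_iso_def insert_pair_simps
    by (intro conjI insert_swap_iso)
      (use \<open>w \<noteq> v\<close> coveringD(4,6)[OF p] in \<open>auto simp: lift_gluing_Inr star_def\<close>)
  have "lift_gluing (fst p) w a \<in> gluings A (Inr w) (insert_at B v b (fst p))"
    using bij_betwE[OF bij_betw_lift_gluing[OF \<open>w \<noteq> v\<close>]] a by blast
  then show "covering_pair (insert_pair A (Inr w) (lift_gluing (fst p) w a) (insert_pair B v b p))"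
    using w \<open>w \<noteq> v\<close>
    by (intro covering_insert_pair[OF wfA conA covering_insert_pair[OF wfB conB p v b]]) auto
qed

text \<open>Composing with the bijection from the star of \<open>u\<close> after the insertion of \<open>B\<close> to its star in \<open>B\<close>
  matches the gluings of the two iterated insertions.\<close>

lemma nested_insert_assoc:
  assumes v: "v \<in> verts (fst (fst p))" and b: "b \<in> gluings B v (fst p)"
    and u: "u \<in> verts (fst B)"
  shows "(\<Sum>a\<in>gluings A (Inl u) (insert_at B v b (fst p)).
        \<phi> (pair_class (insert_pair A (Inl u) a (insert_pair B v b p)))) =
    (\<Sum>a\<in>gluings A u B. \<phi> (pair_class (insert_pair (insert_at A u a B) v
        (restrict (Inr \<circ> b) (star (fst (fst p)) v)) p)))"
proof -
  let ?s = "star (fst (insert_at B v b (fst p))) (Inl u)" and ?e = "case_sum id b"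
  note e = star_insert_left[OF wfB conB wfY v b, where u = u]
  have bij: "bij_betw (\<lambda>a. restrict (id \<circ> a \<circ> ?e) ?s) (gluings A u B)
      (gluings A (Inl u) (insert_at B v b (fst p)))"
    unfolding gluings_eq by (rule bij_betw_typed_bijections, fact e(1), fact e(2)) simp_all
  have "pair_class (insert_pair A (Inl u) (restrict (id \<circ> a \<circ> ?e) ?s) (insert_pair B v b p)) =
      pair_class (insert_pair (insert_at A u a B) v (restrict (Inr \<circ> b) (star (fst (fst p)) v)) p)"
    if a: "a \<in> gluings A u B" for a
  proof (rule pair_class_eqI)
    show "pair_iso sum_assoc sum_assoc
        (insert_pair A (Inl u) (restrict (id \<circ> a \<circ> ?e) ?s) (insert_pair B v b p))
        (insert_pair (insert_at A u a B) v (restrict (Inr \<circ> b) (star (fst (fst p)) v)) p)"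
      unfolding pair_iso_def insert_pair_simps
      by (intro conjI insert_assoc_iso) (use coveringD(4,6)[OF p] in \<open>auto simp: star_def\<close>)
    have "restrict (id \<circ> a \<circ> ?e) ?s \<in> gluings A (Inl u) (insert_at B v b (fst p))"
      using bij_betwE[OF bij] a by blast
    then show "covering_pair (insert_pair A (Inl u) (restrict (id \<circ> a \<circ> ?e) ?s) (insert_pair B v b p))"
      using u by (intro covering_insert_pair[OF wfA conA covering_insert_pair[OF wfB conB p v b]]) auto
  qed
  then show ?thesis by (simp add: sum.reindex_bij_betw[OF bij, symmetric])
qed

text \<open>The external edges of \<open>insert_at A u a B\<close> are those of \<open>B\<close>.\<close>

lemma bij_betw_gluings_insert:
  "bij_betw (\<lambda>b. restrict (Inr \<circ> b) (star (fst (fst p)) v))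
     (gluings B v (fst p)) (gluings (insert_at A u a B) v (fst p))"
proof -
  have "bij_betw (\<lambda>b. restrict (Inr \<circ> b \<circ> id) (star (fst (fst p)) v))
     (gluings B v (fst p)) (gluings (insert_at A u a B) v (fst p))"
    unfolding gluings_eq externals_insert
    by (rule bij_betw_typed_bijections) (auto simp: bij_betw_def)
  then show ?thesis by simp
qed

text \<open>The vertices at which \<open>A\<close> is inserted after \<open>B\<close> are those of \<open>B\<close> and the remaining vertices of the
  original graph.\<close>

lemma insertion_sum_insert_pair:
  assumes v: "v \<in> verts (fst (fst p))" and b: "b \<in> gluings B v (fst p)" and fin: "finite U"
  shows "insertion_sum \<phi> A (Inl ` verts (fst B) \<union> Inr ` (U - {v})) (insert_pair B v b p) =
    (\<Sum>u\<in>{u \<in> verts (fst B). vertex_type (fst B) u = residue_type A}. \<Sum>a\<in>gluings A u B.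
       \<phi> (pair_class (insert_pair (insert_at A u a B) v
          (restrict (Inr \<circ> b) (star (fst (fst p)) v)) p))) +
    (\<Sum>w\<in>{w \<in> U. vertex_type (fst (fst p)) w = residue_type A}. \<Sum>a\<in>gluings A w (fst p).
        if w \<noteq> v
        then \<phi> (pair_class (insert_pair A (Inr w) (lift_gluing (fst p) w a) (insert_pair B v b p)))
        else 0)"
proof -
  let ?I = "insert_at B v b (fst p)"
  let ?f = "\<lambda>x. \<Sum>a\<in>gluings A x ?I. \<phi> (pair_class (insert_pair A x a (insert_pair B v b p)))"
  let ?V = "{u \<in> verts (fst B). vertex_type (fst B) u = residue_type A}"
  let ?W = "{w \<in> U. vertex_type (fst (fst p)) w = residue_type A}"
  have tl: "vertex_type (fst ?I) (Inl u) = vertex_type (fst B) u" for u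
    by (rule vertex_type_insert_left[OF wfB conB wfY v b])
  have tr: "vertex_type (fst ?I) (Inr w) = vertex_type (fst (fst p)) w" if "w \<noteq> v" for w
    by (rule vertex_type_insert_right[OF wfB conB wfY v b that])
  have "{x \<in> Inl ` verts (fst B) \<union> Inr ` (U - {v}). vertex_type (fst ?I) x = residue_type A} =
      Inl ` ?V \<union> Inr ` {w \<in> ?W. w \<noteq> v}"
    by (auto simp: tl tr)
  then have "insertion_sum \<phi> A (Inl ` verts (fst B) \<union> Inr ` (U - {v})) (insert_pair B v b p) =
      sum ?f (Inl ` ?V \<union> Inr ` {w \<in> ?W. w \<noteq> v})"
    by (simp add: insertion_sum_def)
  also have "\<dots> = sum ?f (Inl ` ?V) + sum ?f (Inr ` {w \<in> ?W. w \<noteq> v})"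
    using wf_graphD(1)[OF wfB] fin by (intro sum.union_disjoint) auto
  also have "sum ?f (Inl ` ?V) = (\<Sum>u\<in>?V. ?f (Inl u))" by (simp add: sum.reindex)
  also have "\<dots> = (\<Sum>u\<in>?V. \<Sum>a\<in>gluings A u B.
       \<phi> (pair_class (insert_pair (insert_at A u a B) v
          (restrict (Inr \<circ> b) (star (fst (fst p)) v)) p)))"
    by (rule sum.cong[OF refl], rule nested_insert_assoc[OF v b]) auto
  also have "sum ?f (Inr ` {w \<in> ?W. w \<noteq> v}) = (\<Sum>w\<in>{w \<in> ?W. w \<noteq> v}. ?f (Inr w))"
    by (simp add: sum.reindex)
  also have "\<dots> = (\<Sum>w\<in>?W. if w \<noteq> v then ?f (Inr w) else 0)"
    by (rule sum.inter_filter) (use fin in auto)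
  also have "\<dots> = (\<Sum>w\<in>?W. \<Sum>a\<in>gluings A w (fst p). if w \<noteq> v
        then \<phi> (pair_class (insert_pair A (Inr w) (lift_gluing (fst p) w a) (insert_pair B v b p)))
        else 0)"
  proof (rule sum.cong[OF refl])
    fix w
    show "(if w \<noteq> v then ?f (Inr w) else 0) = (\<Sum>a\<in>gluings A w (fst p). if w \<noteq> v
        then \<phi> (pair_class (insert_pair A (Inr w) (lift_gluing (fst p) w a) (insert_pair B v b p)))
        else 0)"
      using sum.reindex_bij_betw[OF bij_betw_lift_gluing[of w v b],
        where g = "\<lambda>a. \<phi> (pair_class (insert_pair A (Inr w) a (insert_pair B v b p)))"] by simp
  qed
  finally show ?thesis .
qed

text \<open>The first sum on the right collects the insertions of the terms of \<open>A \<triangleright> B\<close>.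
  What remains is a sum over pairs of distinct vertices.\<close>

lemma nested_insertion_sum:
  assumes U: "U \<subseteq> verts (fst (fst p))"
  shows "(\<Sum>v\<in>{v \<in> U. vertex_type (fst (fst p)) v = residue_type B}. \<Sum>b\<in>gluings B v (fst p).
      insertion_sum \<phi> A (Inl ` verts (fst B) \<union> Inr ` (U - {v})) (insert_pair B v b p)) =
    (\<Sum>u\<in>{u \<in> verts (fst B). vertex_type (fst B) u = residue_type A}. \<Sum>a\<in>gluings A u B.
      insertion_sum \<phi> (insert_at A u a B) U p) + disjoint_insertion_sum \<phi> A B U p"
proof -
  let ?V = "{v \<in> U. vertex_type (fst (fst p)) v = residue_type B}"
  let ?W = "{u \<in> verts (fst B). vertex_type (fst B) u = residue_type A}"
  let ?K = "\<lambda>v b u a. \<phi> (pair_class (insert_pair (insert_at A u a B) v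
          (restrict (Inr \<circ> b) (star (fst (fst p)) v)) p))"
  have fin: "finite U" using U wf_graphD(1)[OF wfY] by (rule finite_subset)
  have "(\<Sum>v\<in>?V. \<Sum>b\<in>gluings B v (fst p).
      insertion_sum \<phi> A (Inl ` verts (fst B) \<union> Inr ` (U - {v})) (insert_pair B v b p)) =
    (\<Sum>v\<in>?V. \<Sum>b\<in>gluings B v (fst p). \<Sum>u\<in>?W. \<Sum>a\<in>gluings A u B. ?K v b u a) +
    disjoint_insertion_sum \<phi> A B U p"
    unfolding disjoint_insertion_sum_def sum.distrib[symmetric]
    by (intro sum.cong refl insertion_sum_insert_pair fin) (use U in auto)
  \<comment> \<open>The vertices of \<open>B\<close> and the gluings at them do not depend on where \<open>B\<close> is inserted.\<close>
  also have "(\<Sum>v\<in>?V. \<Sum>b\<in>gluings B v (fst p). \<Sum>u\<in>?W. \<Sum>a\<in>gluings A u B. ?K v b u a) =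
    (\<Sum>u\<in>?W. \<Sum>a\<in>gluings A u B. \<Sum>v\<in>?V. \<Sum>b\<in>gluings B v (fst p). ?K v b u a)"
    by (rule sum_swap4)
  also have "\<dots> = (\<Sum>u\<in>?W. \<Sum>a\<in>gluings A u B. insertion_sum \<phi> (insert_at A u a B) U p)"
  proof (intro sum.cong refl)
    fix u a assume u: "u \<in> ?W" and a: "a \<in> gluings A u B"
    have "residue_type (insert_at A u a B) = residue_type B"
      using u by (intro residue_type_insert[OF wfA conA wfB _ a conB]) simp
    then show "(\<Sum>v\<in>?V. \<Sum>b\<in>gluings B v (fst p). ?K v b u a) =
        insertion_sum \<phi> (insert_at A u a B) U p"
      by (simp add: insertion_sum_def sum.reindex_bij_betw[OF bij_betw_gluings_insert, symmetric])
  qed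
  finally show ?thesis .
qed

end

lemma disjoint_insertion_sum_commute:
  assumes "wf_graph (fst A)" "connected_graph (fst A)" "wf_graph (fst B)" "connected_graph (fst B)"
    "covering_pair p" "U \<subseteq> verts (fst (fst p))"
  shows "disjoint_insertion_sum \<phi> A B U p = disjoint_insertion_sum \<phi> B A U p"
proof -
  have eq: "(if w \<noteq> v
      then \<phi> (pair_class (insert_pair A (Inr w) (lift_gluing (fst p) w a) (insert_pair B v b p))) else 0) =
    (if v \<noteq> w
      then \<phi> (pair_class (insert_pair B (Inr v) (lift_gluing (fst p) v b) (insert_pair A w a p))) else 0)"
    if "v \<in> U" "w \<in> U" "b \<in> gluings B v (fst p)" "a \<in> gluings A w (fst p)" for v w a b
  proof (cases "w = v")
    case False
    then show ?thesis
      using that assms(6) by (subst nested_insert_swap[OF assms(1-5)]) auto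
  qed simp
  show ?thesis unfolding disjoint_insertion_sum_def
    by (subst sum_swap4, intro sum.cong refl, rule eq) simp_all
qed

section \<open>The operations on isomorphism classes\<close>

text \<open>The weights of insertion sums: \<open>c\<close> is the identity for pairs and \<open>image fst\<close> for graphs, which are
  regarded as diagonal pairs.\<close>

definition class_basis :: "('a set \<Rightarrow> 'b) \<Rightarrow> 'a set \<Rightarrow> ('b \<Rightarrow>\<^sub>0 'k::field)" where
  "class_basis c P = basis_vec (c P)"

definition connected_classes :: "'e field_theory \<Rightarrow> 'e graph_class set" where
  "connected_classes T =
     {graph_class X | X :: (nat, nat, 'e) sgraph. connected_specified_graph T X}"

definition specified_classes :: "'e field_theory \<Rightarrow> 'e graph_class set" where
  "specified_classes T = {graph_class X | X :: (nat, nat, 'e) sgraph. specified_graph T X}"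

definition pair_classes :: "'e field_theory \<Rightarrow> 'e pair_class set" where
  "pair_classes T =
     {pair_class p | p :: (nat, nat, 'e) sgraph \<times> (nat, nat, 'e) sgraph. specified_pair T p}"

lemma connected_specified_graphD:
  assumes "connected_specified_graph T X"
  shows "wf_graph (fst X)" "connected_graph (fst X)" "specified_graph T X"
  using assms by (auto simp: connected_specified_graph_def specified_graph_iff)

lemma specified_pairD:
  assumes "specified_pair T p"
  shows "covering_pair p" "specified_graph T (snd p)"
  using assms specified_covering_subgraph_iff[of T "snd p" "fst p"] by (auto simp: specified_pair_def)

lemma nat_copy_graph:
  fixes X :: "('v, 'h, 'e) sgraph"
  assumes "wf_graph (fst X)"
  obtains Z :: "(nat, nat, 'e) sgraph" and f k where "sgraph_iso f k X Z" "graph_class X = graph_class Z"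
proof -
  obtain q :: "(nat, nat, 'e) sgraph \<times> (nat, nat, 'e) sgraph" and f k where "pair_iso f k (X, X) q"
    using pair_iso_nat_copy[of "(X, X)"] covering_refl[OF assms] unfolding fst_conv snd_conv by metis
  then have iso: "sgraph_iso f k X (fst q)" by (simp add: pair_iso_def)
  show ?thesis by (rule that[OF iso graph_class_eqI[OF iso assms]])
qed

lemma graph_class_in_specified_classes:
  assumes X: "specified_graph T X"
  shows "graph_class X \<in> specified_classes T"
proof (rule nat_copy_graph)
  show "wf_graph (fst X)" using X by (simp add: specified_graph_iff)
  show "graph_class X \<in> specified_classes T"
    if "sgraph_iso f k X Z" "graph_class X = graph_class Z" for f k and Z :: "(nat, nat, 'a) sgraph"
    using that specified_graph_iso[OF that(1) X] unfolding specified_classes_def by blast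
qed

lemma graph_class_in_connected_classes:
  assumes X: "connected_specified_graph T X"
  shows "graph_class X \<in> connected_classes T"
proof (rule nat_copy_graph)
  show "wf_graph (fst X)" using X by (rule connected_specified_graphD)
  show "graph_class X \<in> connected_classes T"
    if "sgraph_iso f k X Z" "graph_class X = graph_class Z" for f k and Z :: "(nat, nat, 'a) sgraph"
    using that connected_specified_graph_iso[OF that(1) X] unfolding connected_classes_def by blast
qed

lemma pair_class_in_pair_classes:
  assumes p: "specified_pair T p"
  shows "pair_class p \<in> pair_classes T"
proof (rule pair_iso_nat_copy)
  show c: "covering_pair p" using p by (rule specified_pairD)
  show "pair_class p \<in> pair_classes T"
    if "pair_iso f k p q" for f k and q :: "(nat, nat, 'a) sgraph \<times> (nat, nat, 'a) sgraph"
    using pair_class_eqI[OF that c] specified_pair_iso[OF that p] unfolding pair_classes_def by blast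
qed

lemma sum_insert_vertex:
  assumes "finite U"
  shows "(\<Sum>v\<in>U. insert_vertex X v Y) = insertion_sum (class_basis (image fst)) X U (Y, Y)"
  unfolding insertion_sum_def insert_vertex_def class_basis_def graph_class_eq_image insert_pair_def
    fst_conv snd_conv by (rule sum.inter_filter[OF assms, symmetric])

lemma act_graph_eq: "act_graph X p = insertion_sum (class_basis (\<lambda>P. P)) X (active_verts (fst (snd p))) p"
  by (simp add: act_graph_def insertion_sum_def class_basis_def insert_pair_def)

definition graph_insertion :: "'e graph_class \<Rightarrow> 'e graph_class \<Rightarrow> ('e graph_class \<Rightarrow>\<^sub>0 'k::field)" where
  "graph_insertion K L = (\<Sum>v\<in>verts (fst (rep L)). insert_vertex (rep K) v (rep L))"

definition graph_sub_insertion :: "'e graph_class \<Rightarrow> 'e graph_class \<Rightarrow> ('e graph_class \<Rightarrow>\<^sub>0 'k::field)" where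
  "graph_sub_insertion K L = (\<Sum>v\<in>active_verts (fst (rep L)). insert_vertex (rep K) v (rep L))"

definition graph_action :: "'e graph_class \<Rightarrow> 'e pair_class \<Rightarrow> ('e pair_class \<Rightarrow>\<^sub>0 'k::field)" where
  "graph_action K L = act_graph (rep K) (rep L)"

lemma active_verts_subset: "active_verts G \<subseteq> verts G"
  by (auto simp: active_verts_def)

lemma graph_insertion_class:
  assumes X: "wf_graph (fst X)" "connected_graph (fst X)" and Y: "wf_graph (fst Y)"
  shows "graph_insertion (graph_class X) (graph_class Y) =
      insertion_sum (class_basis (image fst)) X (verts (fst Y)) (Y, Y)"
    and "graph_sub_insertion (graph_class X) (graph_class Y) =
      insertion_sum (class_basis (image fst)) X (active_verts (fst Y)) (Y, Y)"
proof -
  obtain f1 k1 where X': "sgraph_iso f1 k1 X (rep (graph_class X))" by (rule rep_graph_class[OF X(1)])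
  obtain f2 k2 where Y': "sgraph_iso f2 k2 Y (rep (graph_class Y))" by (rule rep_graph_class[OF Y])
  have gY: "graph_iso f2 k2 (fst Y) (fst (rep (graph_class Y)))" using Y' by (simp add: sgraph_iso_iff)
  have fin: "finite (verts (fst (rep (graph_class Y))))" using wf_graphD(1)[OF graph_iso_wf[OF gY Y]] .
  have sum: "(\<Sum>v\<in>f2 ` U. insert_vertex (rep (graph_class X)) v (rep (graph_class Y))) =
      insertion_sum (class_basis (image fst)) X U (Y, Y)" if "U \<subseteq> verts (fst Y)" for U
  proof -
    have "finite (f2 ` U)" using finite_subset[OF that wf_graphD(1)[OF Y]] by simp
    then have "(\<Sum>v\<in>f2 ` U. insert_vertex (rep (graph_class X)) v (rep (graph_class Y))) =
        insertion_sum (class_basis (image fst)) (rep (graph_class X)) (f2 ` U)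
          (rep (graph_class Y), rep (graph_class Y))"
      by (rule sum_insert_vertex)
    also have "\<dots> = insertion_sum (class_basis (image fst)) X U (Y, Y)"
      using that Y' covering_refl[OF Y] by (intro insertion_sum_iso[OF X _ X']) (auto simp: pair_iso_def)
    finally show ?thesis .
  qed
  show "graph_insertion (graph_class X) (graph_class Y) =
      insertion_sum (class_basis (image fst)) X (verts (fst Y)) (Y, Y)"
    unfolding graph_insertion_def graph_isoD(11)[OF gY, symmetric] by (rule sum) simp
  show "graph_sub_insertion (graph_class X) (graph_class Y) =
      insertion_sum (class_basis (image fst)) X (active_verts (fst Y)) (Y, Y)"
    unfolding graph_sub_insertion_def graph_iso_active_verts[OF gY Y]
    by (rule sum) (rule active_verts_subset)
qed

lemma graph_action_class:
  assumes X: "wf_graph (fst X)" "connected_graph (fst X)" and p: "covering_pair p"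
  shows "graph_action (graph_class X) (pair_class p) =
      insertion_sum (class_basis (\<lambda>P. P)) X (active_verts (fst (snd p))) p"
proof -
  obtain f1 k1 where X': "sgraph_iso f1 k1 X (rep (graph_class X))" by (rule rep_graph_class[OF X(1)])
  obtain f2 k2 where p': "pair_iso f2 k2 p (rep (pair_class p))" by (rule rep_pair_class[OF p])
  have g: "graph_iso f2 k2 (fst (snd p)) (fst (snd (rep (pair_class p))))"
    using p' by (simp add: pair_iso_def sgraph_iso_iff)
  show ?thesis
    unfolding graph_action_def act_graph_eq graph_iso_active_verts[OF g coveringD(1)[OF p]]
    using active_verts_subset[of "fst (snd p)"] coveringD(3)[OF p]
    by (intro insertion_sum_iso[OF X p X' p']) simp
qed

lemma linear_ext_sum: "linear_ext B (\<Sum>i\<in>S. f i) = (\<Sum>i\<in>S. linear_ext B (f i))"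
  using free_pair.linear_sum[OF linear_linear_ext] .

lemma linear_ext_insertion_sum:
  "linear_ext F (insertion_sum (class_basis c) X U p) =
   insertion_sum (\<lambda>P. F (c P)) X U p"
  by (simp add: insertion_sum_def linear_ext_sum class_basis_def)

lemma insertion_sum_in_subspace:
  assumes "free.subspace W"
    "\<And>v b. v \<in> U \<Longrightarrow> b \<in> gluings X v (fst p) \<Longrightarrow> \<phi> (pair_class (insert_pair X v b p)) \<in> W"
  shows "insertion_sum \<phi> X U p \<in> W"
  unfolding insertion_sum_def by (intro free.subspace_sum assms) auto

text \<open>The associator of an operation that is given by insertion sums is the sum over pairs of distinct
  vertices, which is symmetric in \<open>A\<close> and \<open>B\<close>. The hypothesis \<open>op_insert\<close> is where the operations
  differ: the vertices admitted after inserting \<open>B\<close> have to be those of \<open>B\<close> and the ones admitted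
  before, except \<open>v\<close>.\<close>

lemma pre_lie_defect:
  assumes A: "wf_graph (fst A)" "connected_graph (fst A)"
    and B: "wf_graph (fst B)" "connected_graph (fst B)"
    and p: "covering_pair p" and U: "U \<subseteq> verts (fst (fst p))"
    and op: "op (graph_class B) m = insertion_sum (class_basis c) B U p"
    and op_insert: "\<And>v b. v \<in> U \<Longrightarrow> b \<in> gluings B v (fst p) \<Longrightarrow>
      op (graph_class A) (c (pair_class (insert_pair B v b p))) =
      insertion_sum (class_basis c) A (Inl ` verts (fst B) \<union> Inr ` (U - {v})) (insert_pair B v b p)"
    and insert_op: "\<And>u a. u \<in> verts (fst B) \<Longrightarrow> a \<in> gluings A u B \<Longrightarrow>
      op (graph_class (insert_at A u a B)) m = insertion_sum (class_basis c) (insert_at A u a B) U p"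
  shows "linear_ext (op (graph_class A)) (op (graph_class B) m) -
      bilinear_ext op (graph_insertion (graph_class A) (graph_class B)) (basis_vec m) =
    disjoint_insertion_sum (class_basis c) A B U p"
proof -
  have "linear_ext (op (graph_class A)) (op (graph_class B) m) =
      (\<Sum>v\<in>{v \<in> U. vertex_type (fst (fst p)) v = residue_type B}. \<Sum>b\<in>gluings B v (fst p).
        insertion_sum (class_basis c) A (Inl ` verts (fst B) \<union> Inr ` (U - {v})) (insert_pair B v b p))"
    unfolding op linear_ext_insertion_sum insertion_sum_def[of "\<lambda>P. op (graph_class A) (c P)"]
    by (intro sum.cong refl op_insert) auto
  moreover have "bilinear_ext op (graph_insertion (graph_class A) (graph_class B)) (basis_vec m) =
      (\<Sum>u\<in>{u \<in> verts (fst B). vertex_type (fst B) u = residue_type A}. \<Sum>a\<in>gluings A u B.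
        insertion_sum (class_basis c) (insert_at A u a B) U p)"
    unfolding bilinear_ext_def linear_ext_basis graph_insertion_class(1)[OF A B(1)]
      linear_ext_insertion_sum insertion_sum_def[of "\<lambda>P. op (fst ` P) m"]
    by (intro sum.cong) (auto simp: insert_op graph_class_eq_image[symmetric] insert_pair_def)
  ultimately show ?thesis
    using nested_insertion_sum[OF A B p U] by (simp add: algebra_simps)
qed

lemma graph_insertion_pre_lie:
  assumes A: "wf_graph (fst A)" "connected_graph (fst A)"
    and B: "wf_graph (fst B)" "connected_graph (fst B)" and Y: "wf_graph (fst Y)"
  shows "linear_ext (graph_insertion (graph_class A)) (graph_insertion (graph_class B) (graph_class Y)) -
      bilinear_ext graph_insertion (graph_insertion (graph_class A) (graph_class B))
        (basis_vec (graph_class Y)) =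
    disjoint_insertion_sum (class_basis (image fst)) A B (verts (fst Y)) (Y, Y)"
proof (rule pre_lie_defect[OF A B])
  fix v b assume vb: "v \<in> verts (fst Y)" "b \<in> gluings B v (fst (Y, Y))"
  then have "wf_graph (fst (insert_at B v b Y))" using wf_insert[OF B Y] by simp
  then show "graph_insertion (graph_class A) (fst ` pair_class (insert_pair B v b (Y, Y))) =
      insertion_sum (class_basis (image fst)) A (Inl ` verts (fst B) \<union> Inr ` (verts (fst Y) - {v}))
        (insert_pair B v b (Y, Y))"
    using graph_insertion_class(1)[OF A, of "insert_at B v b Y"]
    by (simp add: graph_class_eq_image insert_pair_def)
next
  fix u a assume ua: "u \<in> verts (fst B)" "a \<in> gluings A u B"
  show "graph_insertion (graph_class (insert_at A u a B)) (graph_class Y) =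
      insertion_sum (class_basis (image fst)) (insert_at A u a B) (verts (fst Y)) (Y, Y)"
    using wf_insert[OF A B(1) ua] connected_insert[OF A B(1) ua B(2)] Y by (rule graph_insertion_class)
qed (simp_all add: covering_refl Y graph_insertion_class B)

lemma graph_sub_insertion_pre_lie:
  assumes A: "wf_graph (fst A)" "connected_graph (fst A)"
    and B: "wf_graph (fst B)" "connected_graph (fst B)" and Y: "wf_graph (fst Y)"
  shows "linear_ext (graph_sub_insertion (graph_class A))
        (graph_sub_insertion (graph_class B) (graph_class Y)) -
      bilinear_ext graph_sub_insertion (graph_insertion (graph_class A) (graph_class B))
        (basis_vec (graph_class Y)) =
    disjoint_insertion_sum (class_basis (image fst)) A B (active_verts (fst Y)) (Y, Y)"
proof (rule pre_lie_defect[OF A B])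
  fix v b assume vb: "v \<in> active_verts (fst Y)" "b \<in> gluings B v (fst (Y, Y))"
  then have v: "v \<in> verts (fst Y)" and b: "b \<in> gluings B v Y" by (auto simp: active_verts_def)
  then have "wf_graph (fst (insert_at B v b Y))" using wf_insert[OF B Y] by simp
  then show "graph_sub_insertion (graph_class A) (fst ` pair_class (insert_pair B v b (Y, Y))) =
      insertion_sum (class_basis (image fst)) A (Inl ` verts (fst B) \<union> Inr ` (active_verts (fst Y) - {v}))
        (insert_pair B v b (Y, Y))"
    using graph_insertion_class(2)[OF A, of "insert_at B v b Y"] active_verts_insert[OF B Y v b vb(1)]
    by (simp add: graph_class_eq_image insert_pair_def)
next
  fix u a assume ua: "u \<in> verts (fst B)" "a \<in> gluings A u B"
  show "graph_sub_insertion (graph_class (insert_at A u a B)) (graph_class Y) =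
      insertion_sum (class_basis (image fst)) (insert_at A u a B) (active_verts (fst Y)) (Y, Y)"
    using wf_insert[OF A B(1) ua] connected_insert[OF A B(1) ua B(2)] Y by (rule graph_insertion_class)
qed (simp_all add: covering_refl Y graph_insertion_class B active_verts_subset)

lemma graph_action_pre_lie:
  assumes A: "wf_graph (fst A)" "connected_graph (fst A)"
    and B: "wf_graph (fst B)" "connected_graph (fst B)" and p: "covering_pair p"
  shows "linear_ext (graph_action (graph_class A)) (graph_action (graph_class B) (pair_class p)) -
      bilinear_ext graph_action (graph_insertion (graph_class A) (graph_class B))
        (basis_vec (pair_class p)) =
    disjoint_insertion_sum (class_basis (\<lambda>P. P)) A B (active_verts (fst (snd p))) p"
proof (rule pre_lie_defect[OF A B p])
  note D = coveringD[OF p]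
  fix v b assume vb: "v \<in> active_verts (fst (snd p))" "b \<in> gluings B v (fst p)"
  then have v: "v \<in> verts (fst (snd p))" "v \<in> verts (fst (fst p))" using D(3) by (auto simp: active_verts_def)
  have b: "b \<in> gluings B v (snd p)" using vb(2) by (simp add: gluings_covering[OF p])
  have "graph_action (graph_class A) (pair_class (insert_pair B v b p)) =
      insertion_sum (class_basis (\<lambda>P. P)) A (active_verts (fst (snd (insert_pair B v b p))))
        (insert_pair B v b p)"
    by (rule graph_action_class[OF A covering_insert_pair[OF B p v(2) vb(2)]])
  then show "graph_action (graph_class A) (pair_class (insert_pair B v b p)) =
      insertion_sum (class_basis (\<lambda>P. P)) A (Inl ` verts (fst B) \<union> Inr ` (active_verts (fst (snd p)) - {v}))
        (insert_pair B v b p)"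
    using active_verts_insert[OF B D(1) v(1) b vb(1)] by simp
next
  fix u a assume ua: "u \<in> verts (fst B)" "a \<in> gluings A u B"
  show "graph_action (graph_class (insert_at A u a B)) (pair_class p) =
      insertion_sum (class_basis (\<lambda>P. P)) (insert_at A u a B) (active_verts (fst (snd p))) p"
    using wf_insert[OF A B(1) ua] connected_insert[OF A B(1) ua B(2)] p by (rule graph_action_class)
qed (use active_verts_subset[of "fst (snd p)"] coveringD(3)[OF p] graph_action_class[OF B p] in auto)

lemma graph_insertion_closed:
  assumes X: "connected_specified_graph T X" and Y: "connected_specified_graph T Y"
  shows "graph_insertion (graph_class X) (graph_class Y) \<in> free_space (connected_classes T)"
proof -
  note X' = connected_specified_graphD[OF X] and Y' = connected_specified_graphD[OF Y]
  show ?thesis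
    unfolding graph_insertion_class[OF X'(1,2) Y'(1)]
  proof (rule insertion_sum_in_subspace[OF subspace_free_space])
    fix v b assume "v \<in> verts (fst Y)" "b \<in> gluings X v (fst (Y, Y))"
    then have "graph_class (insert_at X v b Y) \<in> connected_classes T"
      by (intro graph_class_in_connected_classes connected_specified_insert[OF X'(1,2) Y'(1) _ _ X'(3) Y]) auto
    then show "class_basis (image fst) (pair_class (insert_pair X v b (Y, Y))) \<in>
        free_space (connected_classes T)"
      by (simp add: class_basis_def insert_pair_def graph_class_eq_image basis_vec_in_free_space)
  qed
qed

lemma graph_sub_insertion_closed:
  assumes X: "connected_specified_graph T X" and Y: "specified_graph T Y"
  shows "graph_sub_insertion (graph_class X) (graph_class Y) \<in> free_space (specified_classes T)"
proof -
  note X' = connected_specified_graphD[OF X]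
  have wfY: "wf_graph (fst Y)" using Y by (simp add: specified_graph_iff)
  show ?thesis
    unfolding graph_insertion_class[OF X'(1,2) wfY]
  proof (rule insertion_sum_in_subspace[OF subspace_free_space])
    fix v b assume "v \<in> active_verts (fst Y)" "b \<in> gluings X v (fst (Y, Y))"
    then have "graph_class (insert_at X v b Y) \<in> specified_classes T"
      using active_verts_subset[of "fst Y"]
      by (intro graph_class_in_specified_classes specified_insert[OF X'(1,2) wfY _ _ X'(3) Y]) auto
    then show "class_basis (image fst) (pair_class (insert_pair X v b (Y, Y))) \<in>
        free_space (specified_classes T)"
      by (simp add: class_basis_def insert_pair_def graph_class_eq_image basis_vec_in_free_space)
  qed
qed

lemma graph_action_closed:
  assumes X: "connected_specified_graph T X" and p: "specified_pair T p"
  shows "graph_action (graph_class X) (pair_class p) \<in> free_space (pair_classes T)"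
proof -
  note X' = connected_specified_graphD[OF X] and c = specified_pairD(1)[OF p]
  show ?thesis
    unfolding graph_action_class[OF X'(1,2) c]
  proof (rule insertion_sum_in_subspace[OF subspace_free_space])
    fix v b assume "v \<in> active_verts (fst (snd p))" "b \<in> gluings X v (fst p)"
    then have "pair_class (insert_pair X v b p) \<in> pair_classes T"
      using active_verts_subset[of "fst (snd p)"] coveringD(3)[OF c]
      by (intro pair_class_in_pair_classes specified_pair_insert[OF X p]) auto
    then show "class_basis (\<lambda>P. P) (pair_class (insert_pair X v b p)) \<in> free_space (pair_classes T)"
      by (simp add: class_basis_def basis_vec_in_free_space)
  qed
qed

lemma P2_basis:
  assumes p: "covering_pair p"
  shows "P2 (basis_vec (pair_class p)) = basis_vec (graph_class (snd p))"
proof -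
  obtain f k where "pair_iso f k p (rep (pair_class p))" by (rule rep_pair_class[OF p])
  then have "graph_class (snd p) = graph_class (snd (rep (pair_class p)))"
    using coveringD(1)[OF p] by (intro graph_class_eqI) (auto simp: pair_iso_def)
  then show ?thesis by (simp add: P2_def)
qed

text \<open>The second entries of the terms of the action are the insertions into the subgraph. The terms are
  indexed by the same vertices and gluings, since vertex types and gluings of a graph agree with those
  of its covering subgraphs.\<close>

lemma P2_graph_action:
  assumes X: "wf_graph (fst X)" "connected_graph (fst X)" and p: "covering_pair p"
  shows "P2 (graph_action (graph_class X) (pair_class p)) =
    graph_sub_insertion (graph_class X) (graph_class (snd p))"
proof -
  note D = coveringD[OF p]
  have "P2 (graph_action (graph_class X) (pair_class p)) =
      insertion_sum (\<lambda>P. P2 (basis_vec P)) X (active_verts (fst (snd p))) p"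
    unfolding graph_action_class[OF X p] P2_def linear_ext_insertion_sum by simp
  also have "\<dots> = insertion_sum (class_basis (image fst)) X (active_verts (fst (snd p))) (snd p, snd p)"
    unfolding insertion_sum_def fst_conv
  proof (rule sum.cong)
    show "{v \<in> active_verts (fst (snd p)). vertex_type (fst (fst p)) v = residue_type X} =
        {v \<in> active_verts (fst (snd p)). vertex_type (fst (snd p)) v = residue_type X}"
      using vertex_type_covering[OF p] D(3) by (auto simp: active_verts_def)
    fix v assume "v \<in> {v \<in> active_verts (fst (snd p)). vertex_type (fst (snd p)) v = residue_type X}"
    then have v: "v \<in> verts (fst (fst p))" using D(3) by (auto simp: active_verts_def)
    show "(\<Sum>b\<in>gluings X v (fst p). P2 (basis_vec (pair_class (insert_pair X v b p)))) =
        (\<Sum>b\<in>gluings X v (snd p). class_basis (image fst) (pair_class (insert_pair X v b (snd p, snd p))))"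
      unfolding gluings_covering[OF p]
      by (intro sum.cong refl)
        (simp add: P2_basis[OF covering_insert_pair[OF X p v]] class_basis_def
          insert_pair_def[of _ _ _ "(snd p, snd p)"] graph_class_eq_image)
  qed
  finally show ?thesis by (simp add: graph_insertion_class(2)[OF X D(1)])
qed

section \<open>The modules and the projection\<close>

lemma spaces_eq:
  "V_space T = free_space (connected_classes T)" "H_space T = free_space (specified_classes T)"
  "F_space T = free_space (pair_classes T)"
  by (simp_all add: V_space_def H_space_def F_space_def connected_classes_def specified_classes_def
      pair_classes_def)

lemma operations_eq:
  "insertion = bilinear_ext graph_insertion" "sub_insertion = bilinear_ext graph_sub_insertion"
  "action = bilinear_ext graph_action"
  by (simp_all add: insertion_def sub_insertion_def action_def graph_insertion_def[abs_def]
      graph_sub_insertion_def[abs_def] graph_action_def[abs_def])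

lemma connected_classesE:
  assumes "K \<in> connected_classes T"
  obtains X :: "(nat, nat, 'e) sgraph" where "K = graph_class X" "connected_specified_graph T X"
  using assms by (auto simp: connected_classes_def)

lemma specified_classesE:
  assumes "K \<in> specified_classes T"
  obtains X :: "(nat, nat, 'e) sgraph" where "K = graph_class X" "specified_graph T X"
  using assms by (auto simp: specified_classes_def)

lemma pair_classesE:
  assumes "K \<in> pair_classes T"
  obtains p :: "(nat, nat, 'e) sgraph \<times> (nat, nat, 'e) sgraph"
  where "K = pair_class p" "specified_pair T p"
  using assms by (auto simp: pair_classes_def)

lemma left_pre_lie_algebra_V:
  "left_pre_lie_algebra scal (V_space T :: ('e graph_class \<Rightarrow>\<^sub>0 'k::field) set) (\<triangleright>)"
  unfolding spaces_eq operations_eq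
proof (rule left_pre_lie_algebra_bilinear_ext)
  fix a b assume "a \<in> connected_classes T" "b \<in> connected_classes T"
  then show "(graph_insertion a b :: _ \<Rightarrow>\<^sub>0 'k) \<in> free_space (connected_classes T)"
    by (elim connected_classesE) (simp add: graph_insertion_closed)
next
  fix a b m assume "a \<in> connected_classes T" "b \<in> connected_classes T" "m \<in> connected_classes T"
  then obtain A B Y :: "(nat, nat, 'e) sgraph"
    where K: "a = graph_class A" "b = graph_class B" "m = graph_class Y"
    and s: "connected_specified_graph T A" "connected_specified_graph T B" "connected_specified_graph T Y"
    by (elim connected_classesE)
  note A = connected_specified_graphD[OF s(1)] and B = connected_specified_graphD[OF s(2)]
    and Y = connected_specified_graphD[OF s(3)]
  show "linear_ext (graph_insertion a) (graph_insertion b m) -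
      bilinear_ext graph_insertion (graph_insertion a b) (basis_vec m) =
      linear_ext (graph_insertion b) (graph_insertion a m) -
      bilinear_ext graph_insertion (graph_insertion b a) (basis_vec m :: _ \<Rightarrow>\<^sub>0 'k)"
    unfolding K graph_insertion_pre_lie[OF A(1,2) B(1,2) Y(1)]
      graph_insertion_pre_lie[OF B(1,2) A(1,2) Y(1)]
    by (rule disjoint_insertion_sum_commute[OF A(1,2) B(1,2)]) (simp_all add: covering_refl Y)
qed

lemma left_pre_lie_module_H:
  "left_pre_lie_module scal (V_space T :: ('e graph_class \<Rightarrow>\<^sub>0 'k::field) set) (\<triangleright>)
     scal (H_space T :: ('e graph_class \<Rightarrow>\<^sub>0 'k) set) (\<triangleright>\<^sub>s)"
  using left_pre_lie_algebra_V unfolding spaces_eq operations_eq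
proof (rule left_pre_lie_module_bilinear_ext)
  fix a m assume "a \<in> connected_classes T" "m \<in> specified_classes T"
  then show "(graph_sub_insertion a m :: _ \<Rightarrow>\<^sub>0 'k) \<in> free_space (specified_classes T)"
    by (elim connected_classesE specified_classesE) (simp add: graph_sub_insertion_closed)
next
  fix a b m assume "a \<in> connected_classes T" "b \<in> connected_classes T" "m \<in> specified_classes T"
  then obtain A B Y :: "(nat, nat, 'e) sgraph"
    where K: "a = graph_class A" "b = graph_class B" "m = graph_class Y"
    and s: "connected_specified_graph T A" "connected_specified_graph T B" "specified_graph T Y"
    by (elim connected_classesE specified_classesE)
  note A = connected_specified_graphD[OF s(1)] and B = connected_specified_graphD[OF s(2)]
  have Y: "wf_graph (fst Y)" using s(3) by (simp add: specified_graph_iff)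
  show "linear_ext (graph_sub_insertion a) (graph_sub_insertion b m) -
      bilinear_ext graph_sub_insertion (graph_insertion a b) (basis_vec m) =
      linear_ext (graph_sub_insertion b) (graph_sub_insertion a m) -
      bilinear_ext graph_sub_insertion (graph_insertion b a) (basis_vec m :: _ \<Rightarrow>\<^sub>0 'k)"
    unfolding K graph_sub_insertion_pre_lie[OF A(1,2) B(1,2) Y]
      graph_sub_insertion_pre_lie[OF B(1,2) A(1,2) Y]
    by (rule disjoint_insertion_sum_commute[OF A(1,2) B(1,2)])
      (simp_all add: covering_refl Y active_verts_subset)
qed

lemma left_pre_lie_module_F:
  "left_pre_lie_module scal (V_space T :: ('e graph_class \<Rightarrow>\<^sub>0 'k::field) set) (\<triangleright>)
     scal (F_space T :: ('e pair_class \<Rightarrow>\<^sub>0 'k) set) (\<rightarrow>\<^sub>F)"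
  using left_pre_lie_algebra_V unfolding spaces_eq operations_eq
proof (rule left_pre_lie_module_bilinear_ext)
  fix a m assume "a \<in> connected_classes T" "m \<in> pair_classes T"
  then show "(graph_action a m :: _ \<Rightarrow>\<^sub>0 'k) \<in> free_space (pair_classes T)"
    by (elim connected_classesE pair_classesE) (simp add: graph_action_closed)
next
  fix a b m assume "a \<in> connected_classes T" "b \<in> connected_classes T" "m \<in> pair_classes T"
  then obtain A B :: "(nat, nat, 'e) sgraph" and p :: "(nat, nat, 'e) sgraph \<times> (nat, nat, 'e) sgraph"
    where K: "a = graph_class A" "b = graph_class B" "m = pair_class p"
    and s: "connected_specified_graph T A" "connected_specified_graph T B" "specified_pair T p"
    by (elim connected_classesE pair_classesE)
  note A = connected_specified_graphD[OF s(1)] and B = connected_specified_graphD[OF s(2)]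
    and p = specified_pairD(1)[OF s(3)]
  show "linear_ext (graph_action a) (graph_action b m) -
      bilinear_ext graph_action (graph_insertion a b) (basis_vec m) =
      linear_ext (graph_action b) (graph_action a m) -
      bilinear_ext graph_action (graph_insertion b a) (basis_vec m :: _ \<Rightarrow>\<^sub>0 'k)"
    unfolding K graph_action_pre_lie[OF A(1,2) B(1,2) p] graph_action_pre_lie[OF B(1,2) A(1,2) p]
    by (rule disjoint_insertion_sum_commute[OF A(1,2) B(1,2) p])
      (use active_verts_subset[of "fst (snd p)"] coveringD(3)[OF p] in simp)
qed

lemma linear_P2: "free_linear P2"
  unfolding P2_def by (rule linear_linear_ext)

lemma P2_in_H_space:
  assumes "y \<in> F_space T"
  shows "P2 y \<in> H_space T"
  using assms unfolding spaces_eq P2_def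
proof (rule linear_ext_in_subspace[OF subspace_free_space])
  fix L assume "L \<in> pair_classes T"
  then obtain p :: "(nat, nat, 'a) sgraph \<times> (nat, nat, 'a) sgraph"
    where p: "L = pair_class p" "specified_pair T p" by (elim pair_classesE)
  have "P2 (basis_vec L) \<in> free_space (specified_classes T)"
    unfolding p(1) P2_basis[OF specified_pairD(1)[OF p(2)]]
    by (intro basis_vec_in_free_space graph_class_in_specified_classes specified_pairD(2)[OF p(2)])
  then show "basis_vec (graph_class (snd (rep L))) \<in> free_space (specified_classes T)"
    by (simp add: P2_def)
qed

text \<open>Both sides are bilinear, which reduces the identity to classes.\<close>

lemma P2_action:
  assumes x: "x \<in> V_space T" and y: "y \<in> F_space T"
  shows "P2 (x \<rightarrow>\<^sub>F y) = x \<triangleright>\<^sub>s P2 y"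
proof -
  note lin = linear_P2 bilinear_ext_linear_left bilinear_ext_linear_right
    Vector_Spaces.linear_compose[OF _ linear_P2, unfolded comp_def]
    Vector_Spaces.linear_compose[OF linear_P2 bilinear_ext_linear_right, unfolded comp_def]
  have basis: "P2 (bilinear_ext graph_action (basis_vec a) (basis_vec m)) =
      bilinear_ext graph_sub_insertion (basis_vec a) (P2 (basis_vec m))"
    if "a \<in> connected_classes T" "m \<in> pair_classes T" for a m
    using that
    by (elim connected_classesE pair_classesE)
      (simp add: P2_basis P2_graph_action specified_pairD connected_specified_graphD)
  have "P2 (bilinear_ext graph_action (basis_vec a) y) =
      bilinear_ext graph_sub_insertion (basis_vec a) (P2 y)" if a: "a \<in> connected_classes T" for a
    by (rule linear_eq_on_free_space[OF _ _ _ y[unfolded spaces_eq]])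
      (intro lin, intro lin, rule basis[OF a])
  then have "P2 (bilinear_ext graph_action x y) = bilinear_ext graph_sub_insertion x (P2 y)"
    by (rule linear_eq_on_free_space[OF lin(4)[OF bilinear_ext_linear_left]
          bilinear_ext_linear_left _ x[unfolded spaces_eq]])
  then show ?thesis by (simp add: operations_eq)
qed

theorem theorem6:
  fixes T :: "'e field_theory"
  assumes "physical_theory T"
  shows "(\<forall>x \<in> (V_space T :: ('e graph_class \<Rightarrow>\<^sub>0 'k::field) set).
            \<forall>y \<in> (F_space T :: ('e pair_class \<Rightarrow>\<^sub>0 'k) set).
              P2 (x \<rightarrow>\<^sub>F y) = x \<triangleright>\<^sub>s P2 y) \<and>
         left_pre_lie_module_morphism
           scal (V_space T :: ('e graph_class \<Rightarrow>\<^sub>0 'k) set) (\<triangleright>)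
           scal (F_space T :: ('e pair_class \<Rightarrow>\<^sub>0 'k) set) (\<rightarrow>\<^sub>F)
           scal (H_space T :: ('e graph_class \<Rightarrow>\<^sub>0 'k) set) (\<triangleright>\<^sub>s)
           P2"
proof
  show "\<forall>x \<in> (V_space T :: ('e graph_class \<Rightarrow>\<^sub>0 'k) set).
      \<forall>y \<in> (F_space T :: ('e pair_class \<Rightarrow>\<^sub>0 'k) set). P2 (x \<rightarrow>\<^sub>F y) = x \<triangleright>\<^sub>s P2 y"
    by (intro ballI P2_action)
  show "left_pre_lie_module_morphism
      scal (V_space T :: ('e graph_class \<Rightarrow>\<^sub>0 'k) set) (\<triangleright>)
      scal (F_space T :: ('e pair_class \<Rightarrow>\<^sub>0 'k) set) (\<rightarrow>\<^sub>F)
      scal (H_space T :: ('e graph_class \<Rightarrow>\<^sub>0 'k) set) (\<triangleright>\<^sub>s) P2"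
    by (intro left_pre_lie_module_morphism.intro left_pre_lie_module_morphism_axioms.intro
        left_pre_lie_module_F left_pre_lie_module_H linear_map_free_linear[OF linear_P2]
        P2_in_H_space P2_action)
qed

end
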